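(* Let $\alpha\in(\frac13,1]$, $\mathbf Z\in\boldsymbol{\mathcal C}^\alpha_{g,T}(\mathbb R^K)$, $\xi\in\mathfrak X^K$, and let $\ell:\mathfrak X\times\mathfrak A\to\mathbb R$ be a Lagrangian with functional derivatives such that $\frac{\delta\ell}{\delta u}(\cdot,a):\mathfrak X\to\mathfrak X^\vee$ is invertible for each $a$. Let $(m,a)\in\boldsymbol{\mathcal D}_{Z,T}(\mathfrak X^\vee)\oplus\boldsymbol{\mathcal D}_{Z,T}(\mathfrak A)$, let $u$ be determined by $m=\frac{\delta\ell}{\delta u}(u,a)$, let $dx_t=u_t\,dt+\xi\,d\mathbf Z_t$, and let $h$ be the rough Hamiltonian $$h_t(m,a)=\int_0^t\big(\langle m_s,u_s\rangle_{\mathfrak X}-\ell(u_s,a_s)\big)ds+\int_0^t\langle m_s,\xi\rangle_{\mathfrak X}\,d\mathbf Z_s=\int_0^tH(m_s,a_s)\,ds+\int_0^tG(m_s)\,d\mathbf Z_s.$$ The Euler–Poincaré equations $$dm_t+\operatorname{ad}^*_{dx_t}m_t=\frac{\delta\ell}{\delta a}(u_t,a_t)\diamond a_t\,dt,\qquad da_t+\pounds_{dx_t}a_t=0$$ can be written in Lie–Poisson form $$\begin{bmatrix} m_t \\ a_t \end{bmatrix}=\begin{bmatrix} m_0 \\ a_0 \end{bmatrix}-\int_0^t\begin{bmatrix} \operatorname{ad}^*_\Box m_s & \Box\diamond a_s \\ \pounds_\Box a_s & 0 \end{bmatrix}\begin{bmatrix} d\frac{\delta h_s}{\delta m}(m,a)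 \\ d\frac{\delta h_s}{\delta a}(m,a) \end{bmatrix}\quad\text{in }\mathfrak X^\vee\oplus\mathfrak A,$$ where $\Box$ denotes substitution into the operator, $d\frac{\delta h_t}{\delta m}(m,a)=dx_t$ and $d\frac{\delta h_t}{\delta a}(m,a)=-\frac{\delta\ell}{\delta a}(u_t,a_t)\,dt$. Moreover, if these equations hold and $f:\mathfrak X^\vee\times\mathfrak A\to\mathbb R$ is regular enough for the rough chain rule (see context) and has functional derivatives $\frac{\delta f}{\delta m}(m,a)\in C_T(\mathfrak X)$ and $\frac{\delta f}{\delta a}(m,a)\in\boldsymbol{\mathcal D}_{Z,T}(\mathfrak A^\vee)$, then for all $t\in[0,T]$ $$f(m_t,a_t)=f(m_0,a_0)+\int_0^t\{f,H\}(m_s,a_s)\,ds+\int_0^t\{f,G\}(m_s,a_s)\,d\mathbf Z_s,$$ i.e. $df(m_t,a_t)=\{f,dh_t\}(m_t,a_t)$, where $\{\cdot,\cdot\}$ is the semidirect-product Lie–Poisson bracket $$\{f,k\}(m,a)=-\Big\langle\operatorname{ad}^*_{\frac{\delta k}{\delta m}}m+\frac{\delta k}{\delta a}\diamond a,\ \frac{\delta f}{\delta m}\Big\rangle_{\mathfrak X}-\Big\langle\frac{\delta f}{\delta a},\ \pounds_{\frac{\delta k}{\delta m}}a\Big\rangle_{\mathfrak A}.$$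
   Context: **Rough paths.** Fix $T>0$, $K\ge1$. $\Delta_T=\{(s,t):0\le s\le t\le T\}$, $\delta f_{st}=f_t-f_s$. For a Fréchet space $E$, $C_T(E)$, $C^\alpha_T(E)$ are the continuous and $\alpha$-Hölder paths $[0,T]\to E$; $C^\beta_{2,T}(E)$ is the space of maps $\Xi:\Delta_T\to E$ with $\sup_{s<t}p(\Xi_{st})/|t-s|^\beta<\infty$ for every continuous seminorm $p$. For $\alpha\in(\frac13,\frac12]$, $\boldsymbol{\mathcal C}^\alpha_{g,T}(\mathbb R^K)$ (geometric rough paths $\mathbf Z=(Z,\mathbb Z)$) is the closure of $\{(Z,\mathbb Z):Z\text{ Lipschitz},\ \mathbb Z^{lk}_{st}=\int_s^t\delta Z^l_{sr}\,dZ^k_r\}$ in the metric $[Z^{(1)}-Z^{(2)}]_\alpha+[\mathbb Z^{(1)}-\mathbb Z^{(2)}]_{2\alpha}$; for $\alpha\in(\frac12,1]$ it is $C^\alpha_T(\mathbb R^K)$ and $\mathbf Z=Z$. For $\alpha\in(\frac13,\frac12]$, $\boldsymbol{\mathcal D}_{Z,T}(E)$ is the space of $(Y,Y')\in C^\alpha_T(E)\oplus C^\alpha_T(E^K)$ with $\delta Y_{st}-\sum_kY'^k_s\delta Z^k_{st}\in C^{2\alpha}_{2,T}(E)$; for $\alpha\in(\frac12,1]$, $\boldsymbol{\mathcal D}_{Z,T}(E)=C^\alpha_T(E)$. For $(Y,Y')\in\boldsymbol{\mathcal D}_{Z,T}(E^K)$, $\int_s^tY_r\,d\mathbf Z_r$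 is the limit, as the mesh of partitions of $[s,t]$ tends to $0$, of $\sum_i\big(\sum_kY^k_{t_i}\delta Z^k_{t_it_{i+1}}+\sum_{k,l}Y'^{kl}_{t_i}\mathbb Z^{lk}_{t_it_{i+1}}\big)$ (Young integral if $\alpha>\frac12$). Differential notation abbreviates integral equations: e.g. $dm_t+\operatorname{ad}^*_{dx_t}m_t=\theta_t\,dt$ means $m_t+\int_0^t\operatorname{ad}^*_{u_s}m_s\,ds+\int_0^t\operatorname{ad}^*_\xi m_s\,d\mathbf Z_s=m_0+\int_0^t\theta_s\,ds$, and $\pounds_\xi a\,d\mathbf Z$ means the integral of $(\pounds_{\xi_k}a)_{k=1}^K$. All integrands are assumed to exist in the stated spaces (with the integrands of rough integrals controlled by $Z$). Regularity for the chain rule: with $N_\alpha=0,1,2$ for $\alpha=1$, $\alpha\in(\frac12,1)$, $\alpha\in(\frac13,\frac12]$ respectively, $f\in C_b^{N_\alpha+1}$, i.e. $f$ is bounded with directional derivatives up to order $N_\alpha+1$ that are jointly continuous and bounded. **Geometry.** $M$ is a smooth compact connected oriented $d$-dimensional manifold without boundary; $\mathfrak X$, $\mathfrak X^\vee$ are function spaces of vector fields and of one-form densities (sections of $T^*M\otimes\Lambda^dT^*M$) such that $\langle\beta\otimes\mu,v\rangle_{\mathfrak X}=\int_M\beta(v)\mu$ extends continuously to $\mathfrak X^\vee\times\mathfrak X$; $\mathfrak A$, $\mathfrak A^\vee$ are function spaces of sections of $A$ and $A^*\otimes\Lambda^dT^*M$, where $A$ is a direct sum of alternating form and tensor bundles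 with first summand $\Lambda^dT^*M$, with continuous pairing $\langle\lambda,a\rangle_{\mathfrak A}=\int_M\lambda(a)$. $\pounds$: Lie derivative; $\operatorname{ad}_uv=-\pounds_uv$ on vector fields, with adjoint $\operatorname{ad}^*_u=\pounds_u$ on one-form densities. The diamond operator is defined by $\langle\lambda\diamond a,v\rangle_{\mathfrak X}=-\langle\lambda,\pounds_va\rangle_{\mathfrak A}$ for smooth $v$, and assumed continuous $\mathfrak A^\vee\times\mathfrak A\to\mathfrak X^\vee$. **Functional derivatives and Hamiltonians.** For $\ell$: $\frac{d}{d\epsilon}|_{\epsilon=0}\ell(u+\epsilon\delta u,a+\epsilon\delta a)=\langle\frac{\delta\ell}{\delta u},\delta u\rangle_{\mathfrak X}+\langle\frac{\delta\ell}{\delta a},\delta a\rangle_{\mathfrak A}$. For $f$ on $\mathfrak X^\vee\times\mathfrak A$: $\frac{d}{d\epsilon}|_{\epsilon=0}f(m+\epsilon\delta m,a+\epsilon\delta a)=\langle\delta m,\frac{\delta f}{\delta m}\rangle_{\mathfrak X}+\langle\frac{\delta f}{\delta a},\delta a\rangle_{\mathfrak A}$. $H(m,a)=\langle m,u\rangle_{\mathfrak X}-\ell(u,a)$ with $u$ given by $m=\frac{\delta\ell}{\delta u}(u,a)$, so that $\frac{\delta H}{\delta m}=u$, $\frac{\delta H}{\delta a}=-\frac{\delta\ell}{\delta a}(u,a)$; $G=(G_k)_{k=1}^K$, $G_k(m)=\langle m,\xi_k\rangle_{\mathfrak X}$, so that $\frac{\delta G_k}{\delta m}=\xi_k$, $\frac{\delta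 G_k}{\delta a}=0$; $\{f,G\}\,d\mathbf Z$ is the integral of $(\{f,G_k\})_k$.
   Formalization: It is assumed, not derived, that H has functional derivatives δH/δm = u and δH/δa = −δℓ/δa(u,a) at every (m,a); mere existence of functional derivatives of ℓ and invertibility of δℓ/δu(·,a) do not imply this. *)

theory Defs
  imports "HOL-Analysis.Analysis"
begin

section \<open>Frechet spaces\<close>

text \<open>A Frechet space is a real vector space (all of a type) together with a countable separating
  family of seminorms for which it is complete.\<close>

definition seminorm :: "('e::real_vector \<Rightarrow> real) \<Rightarrow> bool" where
  "seminorm q \<longleftrightarrow> (\<forall>x y. q (x + y) \<le> q x + q y) \<and> (\<forall>c x. q (c *\<^sub>R x) = \<bar>c\<bar> * q x)"

definition frechet_space :: "(nat \<Rightarrow> 'e::real_vector \<Rightarrow> real) \<Rightarrow> bool" where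
  "frechet_space p \<longleftrightarrow>
     (\<forall>n. seminorm (p n)) \<and>
     (\<forall>x. (\<forall>n. p n x = 0) \<longrightarrow> x = 0) \<and>
     (\<forall>X :: nat \<Rightarrow> 'e. (\<forall>n. \<forall>e>0. \<exists>N. \<forall>i\<ge>N. \<forall>j\<ge>N. p n (X i - X j) < e) \<longrightarrow>
        (\<exists>x. \<forall>n. (\<lambda>i. p n (X i - x)) \<longlonglongrightarrow> 0))"

definition ftop :: "(nat \<Rightarrow> 'e::real_vector \<Rightarrow> real) \<Rightarrow> 'e topology" where
  "ftop p = topology_generated_by {{y. p n (y - x) < e} | n x e. e > 0}"

definition cont_seminorm :: "(nat \<Rightarrow> 'e::real_vector \<Rightarrow> real) \<Rightarrow> ('e \<Rightarrow> real) \<Rightarrow> bool" where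
  "cont_seminorm p q \<longleftrightarrow> seminorm q \<and> continuous_map (ftop p) euclideanreal q"

definition prod_sn ::
  "(nat \<Rightarrow> 'e::real_vector \<Rightarrow> real) \<Rightarrow> (nat \<Rightarrow> 'f::real_vector \<Rightarrow> real) \<Rightarrow> nat \<Rightarrow> 'e \<times> 'f \<Rightarrow> real" where
  "prod_sn p q n z = p n (fst z) + q n (snd z)"

definition real_sn :: "nat \<Rightarrow> real \<Rightarrow> real" where
  "real_sn n x = \<bar>x\<bar>"

definition cont_path :: "(nat \<Rightarrow> 'e::real_vector \<Rightarrow> real) \<Rightarrow> real \<Rightarrow> (real \<Rightarrow> 'e) \<Rightarrow> bool" where
  "cont_path p T Y \<longleftrightarrow> continuous_map (top_of_set {0..T}) (ftop p) Y"

definition holder2 ::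
  "(nat \<Rightarrow> 'e::real_vector \<Rightarrow> real) \<Rightarrow> real \<Rightarrow> real \<Rightarrow> (real \<Rightarrow> real \<Rightarrow> 'e) \<Rightarrow> bool" where
  "holder2 p T \<beta> \<Xi> \<longleftrightarrow>
     (\<forall>q. cont_seminorm p q \<longrightarrow>
        (\<exists>C. \<forall>s t. 0 \<le> s \<and> s < t \<and> t \<le> T \<longrightarrow> q (\<Xi> s t) \<le> C * (t - s) powr \<beta>))"

definition holder ::
  "(nat \<Rightarrow> 'e::real_vector \<Rightarrow> real) \<Rightarrow> real \<Rightarrow> real \<Rightarrow> (real \<Rightarrow> 'e) \<Rightarrow> bool" where
  "holder p T \<alpha> Y \<longleftrightarrow> holder2 p T \<alpha> (\<lambda>s t. Y t - Y s)"

text \<open>\<open>Ddir f [v1, ..., vj] x\<close> is the iterated directional derivative of \<open>f\<close> at \<open>x\<close>, the innermost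
  differentiation being in the direction of the last entry.\<close>

primrec Ddir :: "('e::real_vector \<Rightarrow> real) \<Rightarrow> 'e list \<Rightarrow> 'e \<Rightarrow> real" where
  "Ddir f [] x = f x"
| "Ddir f (v # vs) x = deriv (\<lambda>\<epsilon>. Ddir f vs (x + \<epsilon> *\<^sub>R v)) 0"

text \<open>The class \<open>C\<^sub>b\<^sup>n\<close>. The \<open>j\<close>-th derivative is a jointly continuous function on \<open>E\<^sup>1\<^sup>+\<^sup>j\<close>, and it is bounded
  as a \<open>j\<close>-linear form, uniformly in the base point.\<close>

definition Cb :: "(nat \<Rightarrow> 'e::real_vector \<Rightarrow> real) \<Rightarrow> nat \<Rightarrow> ('e \<Rightarrow> real) \<Rightarrow> bool" where
  "Cb p n f \<longleftrightarrow>
     (\<forall>vs v x. length vs < n \<longrightarrow> (\<lambda>\<epsilon>. Ddir f vs (x + \<epsilon> *\<^sub>R v)) field_differentiable (at 0)) \<and>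
     (\<forall>j\<le>n. continuous_map (product_topology (\<lambda>_. ftop p) {..j}) euclideanreal
               (\<lambda>w. Ddir f (map w [1..<Suc j]) (w 0))) \<and>
     (\<forall>j\<le>n. \<exists>N C. \<forall>x vs. length vs = j \<longrightarrow>
               \<bar>Ddir f vs x\<bar> \<le> C * prod_list (map (\<lambda>v. \<Sum>i\<le>N. p i v) vs))"

section \<open>Rough paths and integrals\<close>

definition partition_of :: "real \<Rightarrow> real \<Rightarrow> real list \<Rightarrow> bool" where
  "partition_of s t ts \<longleftrightarrow> ts \<noteq> [] \<and> hd ts = s \<and> last ts = t \<and> sorted_wrt (<) ts"

definition has_mesh_limit ::
  "(nat \<Rightarrow> 'e::real_vector \<Rightarrow> real) \<Rightarrow> (real \<Rightarrow> real \<Rightarrow> 'e) \<Rightarrow> real \<Rightarrow> real \<Rightarrow> 'e \<Rightarrow> bool" where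
  "has_mesh_limit p \<Xi> s t I \<longleftrightarrow>
     (\<forall>n. \<forall>e>0. \<exists>\<delta>>0. \<forall>ts. partition_of s t ts \<and>
        (\<forall>i. Suc i < length ts \<longrightarrow> ts ! Suc i - ts ! i < \<delta>) \<longrightarrow>
        p n ((\<Sum>i<length ts - 1. \<Xi> (ts ! i) (ts ! Suc i)) - I) < e)"

text \<open>The \<open>dt\<close>-integral of a continuous path in a Frechet space.\<close>

definition has_dt_integral ::
  "(nat \<Rightarrow> 'e::real_vector \<Rightarrow> real) \<Rightarrow> (real \<Rightarrow> 'e) \<Rightarrow> real \<Rightarrow> real \<Rightarrow> 'e \<Rightarrow> bool" where
  "has_dt_integral p F s t I \<longleftrightarrow> has_mesh_limit p (\<lambda>v w. (w - v) *\<^sub>R F v) s t I"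

text \<open>A driving path is a pair \<open>(Z, ZZ)\<close> where \<open>ZZ s t $ l $ k\<close> stands for the iterated integral
  of \<open>\<delta>Z\<^sup>l\<close> against \<open>dZ\<^sup>k\<close>; for \<open>\<alpha> > 1/2\<close> the second component is never used.\<close>

definition lipschitz_lift ::
  "real \<Rightarrow> (real \<Rightarrow> real ^ 'k) \<Rightarrow> (real \<Rightarrow> real \<Rightarrow> real ^ 'k ^ 'k) \<Rightarrow> bool" where
  "lipschitz_lift T W WW \<longleftrightarrow>
     (\<exists>C. C-lipschitz_on {0..T} W) \<and>
     (\<forall>s t l k. 0 \<le> s \<and> s \<le> t \<and> t \<le> T \<longrightarrow>
        has_mesh_limit real_sn (\<lambda>v w. (W v - W s) $ l * (W w - W v) $ k) s t (WW s t $ l $ k))"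

definition geometric_rough_path ::
  "real \<Rightarrow> real \<Rightarrow> (real \<Rightarrow> real ^ 'k) \<Rightarrow> (real \<Rightarrow> real \<Rightarrow> real ^ 'k ^ 'k) \<Rightarrow> bool" where
  "geometric_rough_path \<alpha> T Z ZZ \<longleftrightarrow>
     (if \<alpha> \<le> 1/2
      then \<forall>e>0. \<exists>W WW. lipschitz_lift T W WW \<and>
             (\<forall>s t. 0 \<le> s \<and> s < t \<and> t \<le> T \<longrightarrow>
                norm ((Z t - Z s) - (W t - W s)) \<le> e * (t - s) powr \<alpha> \<and>
                norm (ZZ s t - WW s t) \<le> e * (t - s) powr (2 * \<alpha>))
      else holder (\<lambda>_. norm) T \<alpha> Z)"

definition controlled ::
  "real \<Rightarrow> real \<Rightarrow> (real \<Rightarrow> real ^ 'k) \<Rightarrow> (nat \<Rightarrow> 'e::real_vector \<Rightarrow> real) \<Rightarrow>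
   (real \<Rightarrow> 'e) \<Rightarrow> ('k \<Rightarrow> real \<Rightarrow> 'e) \<Rightarrow> bool" where
  "controlled \<alpha> T Z p Y Y' \<longleftrightarrow>
     holder p T \<alpha> Y \<and>
     (\<alpha> \<le> 1/2 \<longrightarrow>
        (\<forall>k. holder p T \<alpha> (Y' k)) \<and>
        holder2 p T (2 * \<alpha>)
          (\<lambda>s t. Y t - Y s - (\<Sum>k\<in>UNIV. (Z t - Z s) $ k *\<^sub>R Y' k s)))"

definition has_rough_integral ::
  "real \<Rightarrow> (real \<Rightarrow> real ^ 'k) \<Rightarrow> (real \<Rightarrow> real \<Rightarrow> real ^ 'k ^ 'k) \<Rightarrow> (nat \<Rightarrow> 'e::real_vector \<Rightarrow> real) \<Rightarrow>
   ('k \<Rightarrow> real \<Rightarrow> 'e) \<Rightarrow> ('k \<Rightarrow> 'k \<Rightarrow> real \<Rightarrow> 'e) \<Rightarrow> real \<Rightarrow> real \<Rightarrow> 'e \<Rightarrow> bool" where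
  "has_rough_integral \<alpha> Z ZZ p Y Y' s t I \<longleftrightarrow>
     has_mesh_limit p
       (\<lambda>v w. (\<Sum>k\<in>UNIV. (Z w - Z v) $ k *\<^sub>R Y k v) +
               (if \<alpha> \<le> 1/2 then \<Sum>k\<in>UNIV. \<Sum>l\<in>UNIV. ZZ v w $ l $ k *\<^sub>R Y' k l v else 0))
       s t I"

text \<open>A rough differential \<open>F\<^sub>t dt + Y\<^sub>t dZ\<^sub>t\<close> is represented by the pair \<open>(F, Y)\<close>. Its integral
  also depends on the Gubinelli derivative \<open>Y'\<close> of the rough integrand.\<close>

type_synonym ('e, 'k) rdiff = "(real \<Rightarrow> 'e) \<times> ('k \<Rightarrow> real \<Rightarrow> 'e)"

definition has_rdiff_integral ::
  "real \<Rightarrow> (real \<Rightarrow> real ^ 'k) \<Rightarrow> (real \<Rightarrow> real \<Rightarrow> real ^ 'k ^ 'k) \<Rightarrow> (nat \<Rightarrow> 'e::real_vector \<Rightarrow> real) \<Rightarrow>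
   ('e, 'k) rdiff \<Rightarrow> ('k \<Rightarrow> 'k \<Rightarrow> real \<Rightarrow> 'e) \<Rightarrow> real \<Rightarrow> 'e \<Rightarrow> bool" where
  "has_rdiff_integral \<alpha> Z ZZ p dX Y' t I \<longleftrightarrow>
     (\<exists>I1 I2. has_dt_integral p (fst dX) 0 t I1 \<and>
              has_rough_integral \<alpha> Z ZZ p (snd dX) Y' 0 t I2 \<and> I = I1 + I2)"

definition N_reg :: "real \<Rightarrow> nat" where
  "N_reg \<alpha> = (if \<alpha> = 1 then 0 else if \<alpha> > 1/2 then 1 else 2)"

text \<open>If \<open>dX = b dt + V dZ\<close> and \<open>V\<close> has Gubinelli derivative \<open>V'\<close>, then
  \<open>Df(X) V\<close> has Gubinelli derivative \<open>D\<^sup>2f(X)(V\<^sub>l, V\<^sub>k) + Df(X) V'\<^sub>k\<^sub>l\<close>.\<close>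

definition chain_gub ::
  "('e::real_vector \<Rightarrow> real) \<Rightarrow> (real \<Rightarrow> 'e) \<Rightarrow> ('k \<Rightarrow> real \<Rightarrow> 'e) \<Rightarrow> ('k \<Rightarrow> 'k \<Rightarrow> real \<Rightarrow> 'e) \<Rightarrow>
   'k \<Rightarrow> 'k \<Rightarrow> real \<Rightarrow> real" where
  "chain_gub f X V V' k l s = Ddir f [V l s, V k s] (X s) + Ddir f [V' k l s] (X s)"

section \<open>Closed oriented manifolds and tensor fields\<close>

type_synonym ('m, 'd) chart = "'m set \<times> ('m \<Rightarrow> real ^ 'd)"

definition pd :: "'d \<Rightarrow> (real ^ 'd \<Rightarrow> real) \<Rightarrow> real ^ 'd::finite \<Rightarrow> real" where
  "pd j g x = frechet_derivative g (at x) (axis j 1)"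

definition pds :: "'d list \<Rightarrow> (real ^ 'd \<Rightarrow> real) \<Rightarrow> real ^ 'd::finite \<Rightarrow> real" where
  "pds js g = foldr pd js g"

definition smooth_on :: "(real ^ 'd::finite) set \<Rightarrow> (real ^ 'd \<Rightarrow> real) \<Rightarrow> bool" where
  "smooth_on S g \<longleftrightarrow> (\<forall>js. \<forall>x\<in>S. pds js g differentiable (at x))"

definition chart_range :: "('m, 'd::finite) chart \<Rightarrow> (real ^ 'd) set" where
  "chart_range c = snd c ` fst c"

definition transition :: "('m, 'd::finite) chart \<Rightarrow> ('m, 'd) chart \<Rightarrow> real ^ 'd \<Rightarrow> real ^ 'd" where
  "transition c c' x = snd c' (inv_into (fst c) (snd c) x)"

definition jac :: "('m, 'd::finite) chart \<Rightarrow> ('m, 'd) chart \<Rightarrow> real ^ 'd \<Rightarrow> real ^ 'd ^ 'd" where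
  "jac c c' x = jacobian (transition c c') (at x)"

definition closed_oriented_manifold :: "('m::t2_space, 'd::finite) chart set \<Rightarrow> bool" where
  "closed_oriented_manifold \<A> \<longleftrightarrow>
     compact (UNIV :: 'm set) \<and> connected (UNIV :: 'm set) \<and>
     (\<forall>c\<in>\<A>. open (fst c) \<and> open (chart_range c) \<and>
        homeomorphism (fst c) (chart_range c) (snd c) (inv_into (fst c) (snd c))) \<and>
     (\<Union>c\<in>\<A>. fst c) = UNIV \<and>
     (\<forall>c\<in>\<A>. \<forall>c'\<in>\<A>. \<forall>i. smooth_on (snd c ` (fst c \<inter> fst c')) (\<lambda>x. transition c c' x $ i)) \<and>
     (\<forall>c\<in>\<A>. \<forall>c'\<in>\<A>. \<forall>x \<in> snd c ` (fst c \<inter> fst c'). det (jac c c' x) > 0)"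

text \<open>A bundle is a direct sum of tensor bundles \<open>T\<^sup>r\<^sub>s M\<close> (\<open>Tensor r s\<close>, with \<open>r\<close> contravariant and \<open>s\<close>
  covariant slots), bundles of alternating forms \<open>\<Lambda>\<^sup>kT\<^sup>*M\<close> (\<open>Form k\<close>) and their duals
  \<open>\<Lambda>\<^sup>kTM\<close> (\<open>Multivector k\<close>), tensored with the \<open>w\<close>-th power of \<open>\<Lambda>\<^sup>dT\<^sup>*M\<close>, \<open>w \<in> {0, 1}\<close>.
  The factor \<open>\<Lambda>\<^sup>dT\<^sup>*M\<close> is represented by its single coefficient in a positively oriented chart.\<close>

datatype summand = Tensor nat nat | Form nat | Multivector nat

type_synonym vbundle = "summand list \<times> nat"

fun n_up :: "summand \<Rightarrow> nat" where
  "n_up (Tensor r s) = r" | "n_up (Form k) = 0" | "n_up (Multivector k) = k"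

fun n_low :: "summand \<Rightarrow> nat" where
  "n_low (Tensor r s) = s" | "n_low (Form k) = k" | "n_low (Multivector k) = 0"

fun dual_summand :: "summand \<Rightarrow> summand" where
  "dual_summand (Tensor r s) = Tensor s r"
| "dual_summand (Form k) = Multivector k"
| "dual_summand (Multivector k) = Form k"

text \<open>The bundle \<open>F\<^sup>* \<otimes> \<Lambda>\<^sup>dT\<^sup>*M\<close>; for a bundle \<open>F = F\<^sub>0 \<otimes> \<Lambda>\<^sup>dT\<^sup>*M\<close> of densities it is identified with \<open>F\<^sub>0\<^sup>*\<close>.\<close>

definition dual_density :: "vbundle \<Rightarrow> vbundle" where
  "dual_density F = (map dual_summand (fst F), 1 - snd F)"

definition tangent_bundle :: vbundle where
  "tangent_bundle = ([Tensor 1 0], 0)"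

definition one_form_densities :: vbundle where
  "one_form_densities = ([Tensor 0 1], 1)"

text \<open>An index \<open>(n, I, J)\<close> names the component of the \<open>n\<close>-th summand with upper indices \<open>I\<close> and lower
  indices \<open>J\<close>. A field is given by its components in all charts, as functions of the coordinates.\<close>

type_synonym 'd idx = "nat \<times> 'd list \<times> 'd list"

type_synonym ('m, 'd) field = "('m, 'd) chart \<Rightarrow> 'd idx \<Rightarrow> real ^ 'd \<Rightarrow> real"

definition idxs :: "vbundle \<Rightarrow> 'd idx set" where
  "idxs F = {(n, I, J). n < length (fst F) \<and>
               length I = n_up (fst F ! n) \<and> length J = n_low (fst F ! n)}"

definition swap :: "nat \<Rightarrow> nat \<Rightarrow> 'd list \<Rightarrow> 'd list" where
  "swap i j I = I[i := I ! j, j := I ! i]"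

definition alternating :: "vbundle \<Rightarrow> ('m, 'd) field \<Rightarrow> bool" where
  "alternating F s \<longleftrightarrow>
     (\<forall>c x. \<forall>(n, I, J) \<in> idxs F.
        case fst F ! n of
          Tensor r q \<Rightarrow> True
        | Form k \<Rightarrow> (\<forall>i<k. \<forall>j<k. i \<noteq> j \<longrightarrow> s c (n, I, swap i j J) x = - s c (n, I, J) x)
        | Multivector k \<Rightarrow> (\<forall>i<k. \<forall>j<k. i \<noteq> j \<longrightarrow> s c (n, swap i j I, J) x = - s c (n, I, J) x))"

definition smooth_section ::
  "('m, 'd::finite) chart set \<Rightarrow> vbundle \<Rightarrow> ('m, 'd) field \<Rightarrow> bool" where
  "smooth_section \<A> F s \<longleftrightarrow>
     (\<forall>c i x. c \<notin> \<A> \<or> i \<notin> idxs F \<or> x \<notin> chart_range c \<longrightarrow> s c i x = 0) \<and>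
     (\<forall>c\<in>\<A>. \<forall>i\<in>idxs F. smooth_on (chart_range c) (s c i)) \<and>
     alternating F s \<and>
     (\<forall>c\<in>\<A>. \<forall>c'\<in>\<A>. \<forall>P \<in> fst c \<inter> fst c'. \<forall>(n, I, J) \<in> idxs F.
        let x = snd c P; x' = snd c' P in
        s c' (n, I, J) x' =
          det (jac c' c x') ^ snd F *
          (\<Sum>K | length K = length I. \<Sum>L | length L = length J.
             (\<Prod>q<length I. jac c c' x $ (I ! q) $ (K ! q)) *
             (\<Prod>q<length J. jac c' c x' $ (L ! q) $ (J ! q)) * s c (n, K, L) x))"

text \<open>The Lie derivative \<open>\<pounds>\<^sub>v s\<close> in coordinates.\<close>

definition lie_deriv ::
  "('m, 'd::finite) chart set \<Rightarrow> vbundle \<Rightarrow> ('m, 'd) field \<Rightarrow> ('m, 'd) field \<Rightarrow> ('m, 'd) field" where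
  "lie_deriv \<A> F v s c = (\<lambda>(n, I, J) x.
     let vc = (\<lambda>k. v c (0, [k], [])) in
     if c \<in> \<A> \<and> x \<in> chart_range c \<and> (n, I, J) \<in> idxs F then
       (\<Sum>k\<in>UNIV. vc k x * pd k (s c (n, I, J)) x)
       - (\<Sum>q<length I. \<Sum>k\<in>UNIV. pd k (vc (I ! q)) x * s c (n, I[q := k], J) x)
       + (\<Sum>q<length J. \<Sum>k\<in>UNIV. pd (J ! q) (vc k) x * s c (n, I, J[q := k]) x)
       + real (snd F) * (\<Sum>k\<in>UNIV. pd k (vc k) x) * s c (n, I, J) x
     else 0)"

text \<open>The natural pairing of \<open>F\<close> with \<open>F\<^sup>* \<otimes> \<Lambda>\<^sup>dT\<^sup>*M\<close>, as the coefficient of a density. In the alternating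
  summands \<open>1/k!\<close> times the full contraction is the sum over increasing indices.\<close>

fun contraction_factor :: "summand \<Rightarrow> real" where
  "contraction_factor (Tensor r s) = 1"
| "contraction_factor (Form k) = 1 / fact k"
| "contraction_factor (Multivector k) = 1 / fact k"

definition contract ::
  "vbundle \<Rightarrow> ('m, 'd::finite) field \<Rightarrow> ('m, 'd) field \<Rightarrow> ('m, 'd) chart \<Rightarrow> real ^ 'd \<Rightarrow> real" where
  "contract F s \<phi> c x =
     (\<Sum>(n, I, J)\<in>idxs F. contraction_factor (fst F ! n) * s c (n, I, J) x * \<phi> c (n, J, I) x)"

text \<open>The integral of a density over \<open>M\<close>: a finite cover by charts is made disjoint. The value does not
  depend on the chosen cover.\<close>

definition manifold_integral ::
  "('m, 'd::finite) chart set \<Rightarrow> (('m, 'd) chart \<Rightarrow> real ^ 'd \<Rightarrow> real) \<Rightarrow> real" where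
  "manifold_integral \<A> \<mu> =
     (let cs = (SOME cs. set cs \<subseteq> \<A> \<and> (\<Union>c\<in>set cs. fst c) = UNIV) in
      \<Sum>i<length cs. integral (snd (cs ! i) ` (fst (cs ! i) - (\<Union>j<i. fst (cs ! j)))) (\<mu> (cs ! i)))"

section \<open>Distributional sections and function spaces\<close>

text \<open>Distributional sections of \<open>F\<close> are the continuous linear functionals on the smooth sections of
  \<open>F\<^sup>* \<otimes> \<Lambda>\<^sup>dT\<^sup>*M\<close>, extended by \<open>0\<close> to arguments which are not smooth sections.\<close>

type_synonym ('m, 'd) distr = "('m, 'd) field \<Rightarrow> real"

definition smooth_null_sequence ::
  "('m, 'd::finite) chart set \<Rightarrow> vbundle \<Rightarrow> (nat \<Rightarrow> ('m, 'd) field) \<Rightarrow> bool" where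
  "smooth_null_sequence \<A> F s \<longleftrightarrow>
     (\<forall>n. smooth_section \<A> F (s n)) \<and>
     (\<forall>c\<in>\<A>. \<forall>i\<in>idxs F. \<forall>js. \<forall>K. compact K \<and> K \<subseteq> chart_range c \<longrightarrow>
        uniform_limit K (\<lambda>n. pds js (s n c i)) (\<lambda>_. 0) sequentially)"

definition distribution ::
  "('m, 'd::finite) chart set \<Rightarrow> vbundle \<Rightarrow> ('m, 'd) distr \<Rightarrow> bool" where
  "distribution \<A> F \<Theta> \<longleftrightarrow>
     (\<forall>\<phi>. \<not> smooth_section \<A> (dual_density F) \<phi> \<longrightarrow> \<Theta> \<phi> = 0) \<and>
     (\<forall>r \<phi> \<mu>. smooth_section \<A> (dual_density F) \<phi> \<and> smooth_section \<A> (dual_density F) \<mu> \<longrightarrow>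
        \<Theta> (\<lambda>c i x. r * \<phi> c i x + \<mu> c i x) = r * \<Theta> \<phi> + \<Theta> \<mu>) \<and>
     (\<forall>s. smooth_null_sequence \<A> (dual_density F) s \<longrightarrow> (\<lambda>n. \<Theta> (s n)) \<longlonglongrightarrow> 0)"

definition of_smooth ::
  "('m, 'd::finite) chart set \<Rightarrow> vbundle \<Rightarrow> ('m, 'd) field \<Rightarrow> ('m, 'd) distr" where
  "of_smooth \<A> F s = (\<lambda>\<phi>. if smooth_section \<A> (dual_density F) \<phi>
                            then manifold_integral \<A> (contract F s \<phi>) else 0)"

text \<open>The Lie derivative of a distribution along a smooth vector field, by duality.\<close>

definition dist_lie ::
  "('m, 'd::finite) chart set \<Rightarrow> vbundle \<Rightarrow> ('m, 'd) field \<Rightarrow> ('m, 'd) distr \<Rightarrow> ('m, 'd) distr" where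
  "dist_lie \<A> F v \<Theta> = (\<lambda>\<phi>. if smooth_section \<A> (dual_density F) \<phi>
                            then - \<Theta> (lie_deriv \<A> (dual_density F) v \<phi>) else 0)"

text \<open>A function space of sections of \<open>F\<close> is a Frechet space continuously embedded into the
  distributional sections of \<open>F\<close> and containing the smooth sections. The embedding \<open>emb\<close> identifies
  elements of the abstract type \<open>'e\<close> with sections.\<close>

record ('m, 'd, 'e) fspace =
  sn :: "nat \<Rightarrow> 'e \<Rightarrow> real"
  emb :: "'e \<Rightarrow> ('m, 'd) distr"

definition function_space ::
  "('m, 'd::finite) chart set \<Rightarrow> vbundle \<Rightarrow> ('m, 'd, 'e::real_vector) fspace \<Rightarrow> bool" where
  "function_space \<A> F E \<longleftrightarrow>
     frechet_space (sn E) \<and>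
     (\<forall>e. distribution \<A> F (emb E e)) \<and>
     inj (emb E) \<and>
     (\<forall>\<phi>. linear (\<lambda>e. emb E e \<phi>) \<and> continuous_map (ftop (sn E)) euclideanreal (\<lambda>e. emb E e \<phi>)) \<and>
     (\<forall>s. smooth_section \<A> F s \<longrightarrow> of_smooth \<A> F s \<in> range (emb E))"

definition in_space :: "('m, 'd, 'e) fspace \<Rightarrow> ('m, 'd) distr \<Rightarrow> bool" where
  "in_space E \<Theta> \<longleftrightarrow> \<Theta> \<in> range (emb E)"

definition elem :: "('m, 'd, 'e) fspace \<Rightarrow> ('m, 'd) distr \<Rightarrow> 'e" where
  "elem E \<Theta> = inv (emb E) \<Theta>"

text \<open>\<open>B\<close> is the continuous extension to \<open>EV \<times> E\<close> of the pairing \<open>(\<phi>, s) \<mapsto> \<integral>\<^sub>M \<phi>(s)\<close> of smooth sections of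
  \<open>F\<^sup>* \<otimes> \<Lambda>\<^sup>dT\<^sup>*M\<close> and \<open>F\<close>. When only one argument is smooth, \<open>B\<close> is the action of the distribution.\<close>

definition pairing_extends ::
  "('m, 'd::finite) chart set \<Rightarrow> vbundle \<Rightarrow> ('m, 'd, 'ev::real_vector) fspace \<Rightarrow>
   ('m, 'd, 'e::real_vector) fspace \<Rightarrow> ('ev \<Rightarrow> 'e \<Rightarrow> real) \<Rightarrow> bool" where
  "pairing_extends \<A> F EV E B \<longleftrightarrow>
     bilinear B \<and>
     continuous_map (prod_topology (ftop (sn EV)) (ftop (sn E))) euclideanreal (\<lambda>(l, e). B l e) \<and>
     (\<forall>l e s. smooth_section \<A> F s \<and> emb E e = of_smooth \<A> F s \<longrightarrow> B l e = emb EV l s) \<and>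
     (\<forall>l e \<phi>. smooth_section \<A> (dual_density F) \<phi> \<and> emb EV l = of_smooth \<A> (dual_density F) \<phi> \<longrightarrow>
        B l e = emb E e \<phi>)"

text \<open>\<open>L u e\<close> is \<open>\<pounds>\<^sub>u e\<close> for \<open>u\<close> in a space \<open>X\<close> of vector fields and \<open>e\<close> in a space \<open>E\<close> of sections of \<open>F\<close>:
  the continuous extension of the Lie derivative along smooth vector fields. Since it loses a
  derivative, its values are distributions; whether they lie in \<open>E\<close> is a separate question.\<close>

definition lie_extends ::
  "('m, 'd::finite) chart set \<Rightarrow> vbundle \<Rightarrow> ('m, 'd, 'x::real_vector) fspace \<Rightarrow>
   ('m, 'd, 'e::real_vector) fspace \<Rightarrow> ('x \<Rightarrow> 'e \<Rightarrow> ('m, 'd) distr) \<Rightarrow> bool" where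
  "lie_extends \<A> F X E L \<longleftrightarrow>
     (\<forall>u e. distribution \<A> F (L u e)) \<and>
     (\<forall>\<phi>. bilinear (\<lambda>u e. L u e \<phi>) \<and>
        continuous_map (prod_topology (ftop (sn X)) (ftop (sn E))) euclideanreal
          (\<lambda>(u, e). L u e \<phi>)) \<and>
     (\<forall>u e v. smooth_section \<A> tangent_bundle v \<and> emb X u = of_smooth \<A> tangent_bundle v \<longrightarrow>
        L u e = dist_lie \<A> F v (emb E e))"

text \<open>\<open>adstarD\<close> is \<open>ad\<^sup>*\<^sub>u m = \<pounds>\<^sub>u m\<close> (the adjoint of \<open>ad\<^sub>u v = - \<pounds>\<^sub>u v\<close>, by \<open>dist_lie\<close>) and \<open>lieAD\<close> is \<open>\<pounds>\<^sub>u a\<close>, both distribution-valued.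
  \<open>summands\<close> lists the summands of the bundle \<open>A\<close> after the first one, \<open>\<Lambda>\<^sup>dT\<^sup>*M\<close>.\<close>

record ('m, 'd, 'x, 'xv, 'a, 'av) setting =
  atlas :: "('m, 'd) chart set"
  summands :: "summand list"
  spX :: "('m, 'd, 'x) fspace"
  spXV :: "('m, 'd, 'xv) fspace"
  spA :: "('m, 'd, 'a) fspace"
  spAV :: "('m, 'd, 'av) fspace"
  pairX :: "'xv \<Rightarrow> 'x \<Rightarrow> real"
  pairA :: "'av \<Rightarrow> 'a \<Rightarrow> real"
  adstarD :: "'x \<Rightarrow> 'xv \<Rightarrow> ('m, 'd) distr"
  lieAD :: "'x \<Rightarrow> 'a \<Rightarrow> ('m, 'd) distr"
  diamond :: "'av \<Rightarrow> 'a \<Rightarrow> 'xv"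

definition bundle_A :: "('m, 'd::finite, 'x, 'xv, 'a, 'av) setting \<Rightarrow> vbundle" where
  "bundle_A S = (Form CARD('d) # summands S, 0)"

definition is_diamond ::
  "('m::t2_space, 'd::finite, 'x::real_vector, 'xv::real_vector, 'a::real_vector, 'av::real_vector) setting
   \<Rightarrow> bool" where
  "is_diamond S \<longleftrightarrow>
     bilinear (diamond S) \<and>
     continuous_map (prod_topology (ftop (sn (spAV S))) (ftop (sn (spA S)))) (ftop (sn (spXV S)))
       (\<lambda>(\<phi>, a). diamond S \<phi> a) \<and>
     (\<forall>\<phi> a v b. smooth_section (atlas S) tangent_bundle (v :: ('m, 'd) field) \<and>
        emb (spA S) b = dist_lie (atlas S) (bundle_A S) v (emb (spA S) a) \<longrightarrow>
        (\<forall>u. emb (spX S) u = of_smooth (atlas S) tangent_bundle v \<longrightarrow>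
           pairX S (diamond S \<phi> a) u = - pairA S \<phi> b))"

definition geometric_setting ::
  "('m::t2_space, 'd::finite, 'x::real_vector, 'xv::real_vector, 'a::real_vector, 'av::real_vector) setting
   \<Rightarrow> bool" where
  "geometric_setting S \<longleftrightarrow>
     closed_oriented_manifold (atlas S) \<and>
     (\<forall>F\<in>set (summands S). \<forall>k. F \<noteq> Multivector k) \<and>
     function_space (atlas S) tangent_bundle (spX S) \<and>
     function_space (atlas S) one_form_densities (spXV S) \<and>
     function_space (atlas S) (bundle_A S) (spA S) \<and>
     function_space (atlas S) (dual_density (bundle_A S)) (spAV S) \<and>
     pairing_extends (atlas S) tangent_bundle (spXV S) (spX S) (pairX S) \<and>
     pairing_extends (atlas S) (bundle_A S) (spAV S) (spA S) (pairA S) \<and>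
     lie_extends (atlas S) one_form_densities (spX S) (spXV S) (adstarD S) \<and>
     lie_extends (atlas S) (bundle_A S) (spX S) (spA S) (lieAD S) \<and>
     is_diamond S"

text \<open>\<open>ad\<^sup>*\<^sub>u m\<close> and \<open>\<pounds>\<^sub>u a\<close> as elements of \<open>\<XX>\<^sup>\<or>\<close> and \<open>\<AA>\<close>, meaningful when the distributions lie there.\<close>

definition adstar :: "('m, 'd, 'x, 'xv, 'a, 'av) setting \<Rightarrow> 'x \<Rightarrow> 'xv \<Rightarrow> 'xv" where
  "adstar S u m = elem (spXV S) (adstarD S u m)"

definition lieA :: "('m, 'd, 'x, 'xv, 'a, 'av) setting \<Rightarrow> 'x \<Rightarrow> 'a \<Rightarrow> 'a" where
  "lieA S u a = elem (spA S) (lieAD S u a)"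

section \<open>Functional derivatives and the Lie--Poisson bracket\<close>

definition has_lag_deriv ::
  "('m, 'd, 'x::real_vector, 'xv, 'a::real_vector, 'av) setting \<Rightarrow> ('x \<times> 'a \<Rightarrow> real) \<Rightarrow>
   'x \<Rightarrow> 'a \<Rightarrow> 'xv \<Rightarrow> 'av \<Rightarrow> bool" where
  "has_lag_deriv S L u a \<mu> \<phi> \<longleftrightarrow>
     (\<forall>du da. ((\<lambda>\<epsilon>. L (u + \<epsilon> *\<^sub>R du, a + \<epsilon> *\<^sub>R da)) has_real_derivative
        (pairX S \<mu> du + pairA S \<phi> da)) (at 0))"

definition dL_du ::
  "('m, 'd, 'x::real_vector, 'xv, 'a::real_vector, 'av) setting \<Rightarrow> ('x \<times> 'a \<Rightarrow> real) \<Rightarrow> 'x \<Rightarrow> 'a \<Rightarrow> 'xv" where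
  "dL_du S L u a = (THE \<mu>. \<exists>\<phi>. has_lag_deriv S L u a \<mu> \<phi>)"

definition dL_da ::
  "('m, 'd, 'x::real_vector, 'xv, 'a::real_vector, 'av) setting \<Rightarrow> ('x \<times> 'a \<Rightarrow> real) \<Rightarrow> 'x \<Rightarrow> 'a \<Rightarrow> 'av" where
  "dL_da S L u a = (THE \<phi>. \<exists>\<mu>. has_lag_deriv S L u a \<mu> \<phi>)"

definition has_ham_deriv ::
  "('m, 'd, 'x, 'xv::real_vector, 'a::real_vector, 'av) setting \<Rightarrow> ('xv \<times> 'a \<Rightarrow> real) \<Rightarrow>
   'xv \<Rightarrow> 'a \<Rightarrow> 'x \<Rightarrow> 'av \<Rightarrow> bool" where
  "has_ham_deriv S f m a x \<phi> \<longleftrightarrow>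
     (\<forall>dm da. ((\<lambda>\<epsilon>. f (m + \<epsilon> *\<^sub>R dm, a + \<epsilon> *\<^sub>R da)) has_real_derivative
        (pairX S dm x + pairA S \<phi> da)) (at 0))"

definition df_dm ::
  "('m, 'd, 'x, 'xv::real_vector, 'a::real_vector, 'av) setting \<Rightarrow> ('xv \<times> 'a \<Rightarrow> real) \<Rightarrow> 'xv \<Rightarrow> 'a \<Rightarrow> 'x" where
  "df_dm S f m a = (THE x. \<exists>\<phi>. has_ham_deriv S f m a x \<phi>)"

definition df_da ::
  "('m, 'd, 'x, 'xv::real_vector, 'a::real_vector, 'av) setting \<Rightarrow> ('xv \<times> 'a \<Rightarrow> real) \<Rightarrow> 'xv \<Rightarrow> 'a \<Rightarrow> 'av" where
  "df_da S f m a = (THE \<phi>. \<exists>x. has_ham_deriv S f m a x \<phi>)"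

definition LP_bracket ::
  "('m, 'd, 'x, 'xv::real_vector, 'a::real_vector, 'av) setting \<Rightarrow> ('xv \<times> 'a \<Rightarrow> real) \<Rightarrow>
   ('xv \<times> 'a \<Rightarrow> real) \<Rightarrow> 'xv \<times> 'a \<Rightarrow> real" where
  "LP_bracket S f k = (\<lambda>(m, a).
     - pairX S (adstar S (df_dm S k m a) m + diamond S (df_da S k m a) a) (df_dm S f m a)
     - pairA S (df_da S f m a) (lieA S (df_dm S k m a) a))"

text \<open>\<open>velocity S L m a\<close> is the \<open>u\<close> with \<open>m = \<delta>L/\<delta>u(u, a)\<close>.\<close>

definition velocity ::
  "('m, 'd, 'x::real_vector, 'xv, 'a::real_vector, 'av) setting \<Rightarrow> ('x \<times> 'a \<Rightarrow> real) \<Rightarrow> 'xv \<Rightarrow> 'a \<Rightarrow> 'x" where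
  "velocity S L m a = inv (\<lambda>u. dL_du S L u a) m"

definition Ham ::
  "('m, 'd, 'x::real_vector, 'xv, 'a::real_vector, 'av) setting \<Rightarrow> ('x \<times> 'a \<Rightarrow> real) \<Rightarrow> 'xv \<times> 'a \<Rightarrow> real" where
  "Ham S L = (\<lambda>(m, a). pairX S m (velocity S L m a) - L (velocity S L m a, a))"

definition Gham ::
  "('m, 'd, 'x, 'xv, 'a, 'av) setting \<Rightarrow> ('k \<Rightarrow> 'x) \<Rightarrow> 'k \<Rightarrow> 'xv \<times> 'a \<Rightarrow> real" where
  "Gham S \<xi> k = (\<lambda>(m, a). pairX S m (\<xi> k))"

text \<open>The Legendre transform is regular: the functional derivatives of \<open>H\<close> are the ones obtained by formally
  differentiating its definition.\<close>

definition legendre_regular ::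
  "('m, 'd, 'x::real_vector, 'xv::real_vector, 'a::real_vector, 'av::real_vector) setting \<Rightarrow>
   ('x \<times> 'a \<Rightarrow> real) \<Rightarrow> bool" where
  "legendre_regular S L \<longleftrightarrow>
     (\<forall>m a. has_ham_deriv S (Ham S L) m a (velocity S L m a) (- dL_da S L (velocity S L m a) a))"

section \<open>Euler--Poincare and Lie--Poisson equations\<close>

text \<open>For the rough Hamiltonian \<open>dh = H(m, a) dt + G(m, a) dZ\<close>, the differentials of its functional
  derivatives along \<open>(m, a)\<close>.\<close>

definition d_dh_dm ::
  "('m, 'd, 'x, 'xv::real_vector, 'a::real_vector, 'av) setting \<Rightarrow> ('xv \<times> 'a \<Rightarrow> real) \<Rightarrow>
   ('k \<Rightarrow> 'xv \<times> 'a \<Rightarrow> real) \<Rightarrow> (real \<Rightarrow> 'xv) \<Rightarrow> (real \<Rightarrow> 'a) \<Rightarrow> ('x, 'k) rdiff" where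
  "d_dh_dm S H G m a = (\<lambda>t. df_dm S H (m t) (a t), \<lambda>k t. df_dm S (G k) (m t) (a t))"

definition d_dh_da ::
  "('m, 'd, 'x, 'xv::real_vector, 'a::real_vector, 'av) setting \<Rightarrow> ('xv \<times> 'a \<Rightarrow> real) \<Rightarrow>
   ('k \<Rightarrow> 'xv \<times> 'a \<Rightarrow> real) \<Rightarrow> (real \<Rightarrow> 'xv) \<Rightarrow> (real \<Rightarrow> 'a) \<Rightarrow> ('av, 'k) rdiff" where
  "d_dh_da S H G m a = (\<lambda>t. df_da S H (m t) (a t), \<lambda>k t. df_da S (G k) (m t) (a t))"

text \<open>In the following two definitions \<open>M'\<close> and \<open>A'\<close> are the Gubinelli derivatives of the rough integrands
  of the equations for \<open>m\<close> and for \<open>a\<close>.\<close>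

definition euler_poincare ::
  "('m, 'd, 'x::real_vector, 'xv::real_vector, 'a::real_vector, 'av::real_vector) setting \<Rightarrow>
   real \<Rightarrow> real \<Rightarrow> (real \<Rightarrow> real ^ 'k) \<Rightarrow> (real \<Rightarrow> real \<Rightarrow> real ^ 'k ^ 'k) \<Rightarrow>
   ('x \<times> 'a \<Rightarrow> real) \<Rightarrow> (real \<Rightarrow> 'x) \<Rightarrow> ('x, 'k) rdiff \<Rightarrow> (real \<Rightarrow> 'xv) \<Rightarrow> (real \<Rightarrow> 'a) \<Rightarrow>
   ('k \<Rightarrow> 'k \<Rightarrow> real \<Rightarrow> 'xv) \<Rightarrow> ('k \<Rightarrow> 'k \<Rightarrow> real \<Rightarrow> 'a) \<Rightarrow> bool" where
  "euler_poincare S \<alpha> T Z ZZ L u dx m a M' A' \<longleftrightarrow>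
     (\<forall>t\<in>{0..T}.
        (\<exists>I J. has_rdiff_integral \<alpha> Z ZZ (sn (spXV S))
                 (\<lambda>s. adstar S (fst dx s) (m s), \<lambda>k s. adstar S (snd dx k s) (m s)) M' t I \<and>
               has_dt_integral (sn (spXV S)) (\<lambda>s. diamond S (dL_da S L (u s) (a s)) (a s)) 0 t J \<and>
               m t + I = m 0 + J) \<and>
        (\<exists>I. has_rdiff_integral \<alpha> Z ZZ (sn (spA S))
                 (\<lambda>s. lieA S (fst dx s) (a s), \<lambda>k s. lieA S (snd dx k s) (a s)) A' t I \<and>
             a t + I = a 0))"

definition lie_poisson ::
  "('m, 'd, 'x::real_vector, 'xv::real_vector, 'a::real_vector, 'av::real_vector) setting \<Rightarrow>
   real \<Rightarrow> real \<Rightarrow> (real \<Rightarrow> real ^ 'k) \<Rightarrow> (real \<Rightarrow> real \<Rightarrow> real ^ 'k ^ 'k) \<Rightarrow>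
   ('x, 'k) rdiff \<Rightarrow> ('av, 'k) rdiff \<Rightarrow> (real \<Rightarrow> 'xv) \<Rightarrow> (real \<Rightarrow> 'a) \<Rightarrow>
   ('k \<Rightarrow> 'k \<Rightarrow> real \<Rightarrow> 'xv) \<Rightarrow> ('k \<Rightarrow> 'k \<Rightarrow> real \<Rightarrow> 'a) \<Rightarrow> bool" where
  "lie_poisson S \<alpha> T Z ZZ dhm dha m a M' A' \<longleftrightarrow>
     (\<forall>t\<in>{0..T}.
        (\<exists>I. has_rdiff_integral \<alpha> Z ZZ (sn (spXV S))
               (\<lambda>s. adstar S (fst dhm s) (m s) + diamond S (fst dha s) (a s),
                \<lambda>k s. adstar S (snd dhm k s) (m s) + diamond S (snd dha k s) (a s)) M' t I \<and>
             m t = m 0 - I) \<and>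
        (\<exists>I. has_rdiff_integral \<alpha> Z ZZ (sn (spA S))
               (\<lambda>s. lieA S (fst dhm s) (a s), \<lambda>k s. lieA S (snd dhm k s) (a s)) A' t I \<and>
             a t = a 0 - I))"

end

theory Submission
  imports Defs
begin

text \<open>
  The bracket with a Hamiltonian \<open>k\<close> is the derivative of \<open>f\<close> along the Hamiltonian vector field of \<open>k\<close>
  (\<open>LP_bracket_eq_Ddir\<close>). Hence, once the Euler--Poincare equations are read as one equation
  \<open>dX = b dt + V dZ\<close> for \<open>X = (m, a)\<close> in \<open>\<XX>\<^sup>\<or> \<times> \<AA>\<close>, the evolution of observables is the chain rule
  \<open>df(X) = Df(X) b dt + Df(X) V dZ\<close> (\<open>rough_chain_rule\<close>).

  The chain rule follows from an expansion of \<open>f(X\<^sub>t) - f(X\<^sub>s)\<close> by the germ of the right-hand side, with an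
  error that is \<open>o(t - s)\<close> uniformly in \<open>s < t\<close> (\<open>observable_expansion\<close>). Summed over the intervals of a
  partition, the left-hand sides telescope and the errors vanish with the mesh. The sums of the
  \<open>dt\<close>-terms are Riemann sums of a continuous function, so the sums of the rough terms converge as well,
  and to the right value.

  The expansion has two ingredients. First, the increment \<open>X\<^sub>t - X\<^sub>s\<close> is given by its own germ up to
  \<open>o(t - s)\<close> in each of the defining seminorms: for the \<open>dt\<close>-part by uniform continuity of \<open>b\<close>, for the rough
  part by the sewing bound (\<open>rough_germ_sewing\<close>), which for \<open>\<alpha> \<le> 1/2\<close> rests on Chen's relation. Secondly, Taylor's
  formula for \<open>f\<close>, of an order that depends on \<open>\<alpha>\<close>. If \<open>\<alpha> \<le> 1/2\<close>, the quadratic term counts, and for a geometric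
  rough path it is absorbed by the second level: the symmetric part of the second level is half the square of
  the increment (\<open>geometric_shuffle\<close>, \<open>quadratic_term\<close>). Chen's relation and this identity hold for
  Lipschitz paths by partial summation and pass to the limit. If \<open>1/2 < \<alpha> < 1\<close>, the quadratic term is already
  negligible. If \<open>\<alpha> = 1\<close>, only one continuous derivative is at hand, and compactness of the set of
  directions \<open>b\<^sub>s + c \<cdot> V\<^sub>s\<close>, with \<open>c\<close> bounded by a Lipschitz constant of \<open>Z\<close>, replaces a Taylor bound.

  The Lie--Poisson form is the Euler--Poincare system itself: as the pairings are nondegenerate, functional
  derivatives are unique, and inserting those of \<open>H\<close> and \<open>G\<close> gives the same integrands. The two
  systems differ in the side on which the integral of the diamond term stands; this integral exists
  separately because its integrand is continuous (\<open>has_dt_integral_exists\<close>).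
\<close>

section \<open>Seminorms and the topology of a Frechet space\<close>

lemma seminorm_triangle: "seminorm q \<Longrightarrow> q (x + y) \<le> q x + q y"
  by (simp add: seminorm_def)

lemma seminorm_scale: "seminorm q \<Longrightarrow> q (c *\<^sub>R x) = \<bar>c\<bar> * q x"
  by (simp add: seminorm_def)

lemma seminorm_0: "seminorm q \<Longrightarrow> q 0 = 0"
  using seminorm_scale[of q 0 0] by simp

lemma seminorm_minus: "seminorm q \<Longrightarrow> q (- x) = q x"
  using seminorm_scale[of q "-1" x] by simp

lemma seminorm_diff_commute: "seminorm q \<Longrightarrow> q (x - y) = q (y - x)"
  using seminorm_minus[of q "x - y"] by simp

lemma seminorm_nonneg: "seminorm q \<Longrightarrow> 0 \<le> q x"
  using seminorm_triangle[of q x "- x"] by (simp add: seminorm_minus seminorm_0)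

lemma seminorm_diff: "seminorm q \<Longrightarrow> q (x - y) \<le> q x + q y"
  using seminorm_triangle[of q x "- y"] by (simp add: seminorm_minus)

lemma seminorm_diff_triangle: "seminorm q \<Longrightarrow> q (x - z) \<le> q (x - y) + q (y - z)"
  using seminorm_triangle[of q "x - y" "y - z"] by simp

lemma seminorm_reverse_triangle: "seminorm q \<Longrightarrow> \<bar>q x - q y\<bar> \<le> q (x - y)"
  using seminorm_triangle[of q "x - y" y] seminorm_triangle[of q "y - x" x]
    seminorm_diff_commute[of q x y]
  by simp

lemma seminorm_sum:
  assumes "seminorm q" shows "q (sum f A) \<le> (\<Sum>i\<in>A. q (f i))"
proof (induction A rule: infinite_finite_induct)
  case (insert i A)
  then show ?case using seminorm_triangle[OF assms, of "f i" "sum f A"] by simp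
qed (simp_all add: seminorm_0[OF assms])

lemma seminorm_finite_sum:
  assumes "\<And>i. seminorm (p i)" shows "seminorm (\<lambda>x. \<Sum>i\<le>(N::nat). p i x)"
  using assms by (auto simp: seminorm_def sum_distrib_left simp flip: sum.distrib intro!: sum_mono)

lemma seminorm_real_sn: "seminorm (real_sn n)"
  by (auto simp: seminorm_def real_sn_def abs_mult)

lemma frechet_seminorm: "frechet_space p \<Longrightarrow> seminorm (p n)"
  by (simp add: frechet_space_def)

lemma seminorm_prod_sn:
  assumes "\<And>i. seminorm (p i)" "\<And>i. seminorm (q i)" shows "seminorm (prod_sn p q n)"
  unfolding seminorm_def prod_sn_def
proof (intro conjI allI)
  fix x y :: "'a \<times> 'b"
  show "p n (fst (x + y)) + q n (snd (x + y)) \<le> p n (fst x) + q n (snd x) + (p n (fst y) + q n (snd y))"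
    using seminorm_triangle[OF assms(1), of n "fst x" "fst y"] seminorm_triangle[OF assms(2), of n "snd x" "snd y"]
    by simp
qed (simp add: seminorm_scale[OF assms(1)] seminorm_scale[OF assms(2)] distrib_left)

lemma topspace_ftop:
  assumes "\<And>n. seminorm (p n)" shows "topspace (ftop p) = UNIV"
proof -
  have "x \<in> \<Union>{{y. p n (y - x) < e} | n x e. e > 0}" for x
  proof (rule UnionI)
    show "x \<in> {y. p 0 (y - x) < 1}" using seminorm_0[OF assms, of 0] by simp
    show "{y. p 0 (y - x) < 1} \<in> {{y. p n (y - x) < e} | n x e. e > 0}"
      by (intro CollectI exI conjI) (rule refl, simp)
  qed
  then show ?thesis
    unfolding ftop_def topology_generated_by_topspace by blast
qed

text \<open>Continuity into \<open>ftop p\<close> may be tested with one seminorm at a time and only on balls centred at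
  the value: a point of a subbasic ball has a smaller ball around it inside that ball.\<close>

lemma continuous_map_ftop_iff:
  assumes p: "\<And>n. seminorm (p n)"
  shows "continuous_map X (ftop p) F \<longleftrightarrow>
    (\<forall>x\<in>topspace X. \<forall>n. \<forall>e>0. \<exists>U. openin X U \<and> x \<in> U \<and> (\<forall>y\<in>U. p n (F y - F x) < e))"
proof
  assume L: "continuous_map X (ftop p) F"
  show "\<forall>x\<in>topspace X. \<forall>n. \<forall>e>0. \<exists>U. openin X U \<and> x \<in> U \<and> (\<forall>y\<in>U. p n (F y - F x) < e)"
  proof (intro ballI allI impI)
    fix x n and e :: real assume x: "x \<in> topspace X" and e: "e > 0"
    have "openin (ftop p) {y. p n (y - F x) < e}"
      unfolding ftop_def using e by (intro topology_generated_by_Basis) blast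
    then have "openin X {y \<in> topspace X. F y \<in> {y. p n (y - F x) < e}}"
      by (rule openin_continuous_map_preimage[OF L])
    then show "\<exists>U. openin X U \<and> x \<in> U \<and> (\<forall>y\<in>U. p n (F y - F x) < e)"
      using x e seminorm_0[OF p, of n]
      by (intro exI[of _ "{y \<in> topspace X. F y \<in> {y. p n (y - F x) < e}}"]) auto
  qed
next
  assume R: "\<forall>x\<in>topspace X. \<forall>n. \<forall>e>0. \<exists>U. openin X U \<and> x \<in> U \<and> (\<forall>y\<in>U. p n (F y - F x) < e)"
  show "continuous_map X (ftop p) F"
    unfolding ftop_def
  proof (rule continuous_on_generated_topo)
    fix V assume "V \<in> {{y. p n (y - x) < e} | n x e. e > 0}"
    then obtain n z e where V: "V = {y. p n (y - z) < e}" by blast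
    show "openin X (F -` V \<inter> topspace X)"
    proof (subst openin_subopen, intro ballI)
      fix x assume x: "x \<in> F -` V \<inter> topspace X"
      then have "0 < e - p n (F x - z)" by (simp add: V)
      then obtain U where U: "openin X U" "x \<in> U" "\<And>y. y \<in> U \<Longrightarrow> p n (F y - F x) < e - p n (F x - z)"
        using R x by (metis IntD2)
      have "U \<subseteq> F -` V \<inter> topspace X"
      proof
        fix y assume y: "y \<in> U"
        have "p n (F y - z) < e"
          using U(3)[OF y] seminorm_diff_triangle[OF p, of n "F y" z "F x"] by linarith
        then show "y \<in> F -` V \<inter> topspace X"
          using openin_subset[OF U(1)] y by (auto simp: V)
      qed
      then show "\<exists>U. openin X U \<and> x \<in> U \<and> U \<subseteq> F -` V \<inter> topspace X"
        using U by blast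
    qed
  next
    show "F ` topspace X \<subseteq> \<Union>{{y. p n (y - x) < e} | n x e. e > 0}"
      using topspace_ftop[of p, OF p] unfolding ftop_def topology_generated_by_topspace by simp
  qed
qed

lemma continuous_map_ftopD:
  assumes "\<And>n. seminorm (p n)" "continuous_map X (ftop p) F" "x \<in> topspace X" "0 < e"
  obtains U where "openin X U" "x \<in> U" "\<And>y. y \<in> U \<Longrightarrow> p n (F y - F x) < e"
  using assms(2)[unfolded continuous_map_ftop_iff[of p, OF assms(1)], rule_format, OF assms(3,4), of n] that
  by metis

lemma continuous_map_ftop_seminorm:
  assumes p: "\<And>n. seminorm (p n)" and F: "continuous_map X (ftop p) F"
  shows "continuous_map X euclideanreal (\<lambda>x. p n (F x - z))"
  unfolding continuous_map_atin limitin_canonical_iff tendsto_iff eventually_atin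
proof (intro ballI allI impI disjI2)
  fix x and e :: real assume "x \<in> topspace X" "e > 0"
  then obtain U where "openin X U" "x \<in> U" "\<And>y. y \<in> U \<Longrightarrow> p n (F y - F x) < e"
    using continuous_map_ftopD[of p, OF p F] by metis
  moreover have "\<bar>p n (F y - z) - p n (F x - z)\<bar> \<le> p n (F y - F x)" for y
    using seminorm_reverse_triangle[OF p, of n "F y - z" "F x - z"] by simp
  ultimately show "\<exists>U. openin X U \<and> x \<in> U \<and> (\<forall>y\<in>U - {x}. dist (p n (F y - z)) (p n (F x - z)) < e)"
    by (intro exI[of _ U]) (auto simp: dist_real_def intro: le_less_trans)
qed

lemma cont_seminorm_sn:
  assumes p: "\<And>n. seminorm (p n)" shows "cont_seminorm p (p n)"
  using continuous_map_ftop_seminorm[of p "ftop p" id n 0] p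
  by (simp add: cont_seminorm_def id_def)

lemma cont_seminorm_finite_sum:
  assumes p: "\<And>n. seminorm (p n)" shows "cont_seminorm p (\<lambda>x. \<Sum>i\<le>(N::nat). p i x)"
  using cont_seminorm_sn[of p, OF p] seminorm_finite_sum[of p, OF p]
  by (auto simp: cont_seminorm_def intro!: continuous_map_sum)

lemma continuous_map_ftop_add_scale:
  assumes p: "\<And>n. seminorm (p n)"
    and F: "continuous_map X (ftop p) F" and G: "continuous_map X (ftop p) G"
    and c: "continuous_map X euclideanreal c"
  shows "continuous_map X (ftop p) (\<lambda>x. F x + c x *\<^sub>R G x)"
  unfolding continuous_map_ftop_iff[of p, OF p]
proof (intro ballI allI impI)
  fix x n and e :: real assume x: "x \<in> topspace X" and e: "e > 0"
  let ?g = "\<lambda>y. p n (F y - F x) + (\<bar>c y\<bar> * p n (G y - G x) + \<bar>c y - c x\<bar> * p n (G x))"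
  have "continuous_map X euclideanreal ?g"
    using continuous_map_ftop_seminorm[of p, OF p F] continuous_map_ftop_seminorm[of p, OF p G] c
    by (intro continuous_map_add continuous_map_real_mult continuous_map_real_abs continuous_map_diff) auto
  from openin_continuous_map_preimage[OF this, of "{..<e}"]
  have "openin X {y \<in> topspace X. ?g y < e}" by simp
  moreover have "p n ((F y + c y *\<^sub>R G y) - (F x + c x *\<^sub>R G x)) \<le> ?g y" for y
  proof -
    have "(F y + c y *\<^sub>R G y) - (F x + c x *\<^sub>R G x)
        = (F y - F x) + (c y *\<^sub>R (G y - G x) + (c y - c x) *\<^sub>R G x)"
      by (simp add: algebra_simps)
    then show ?thesis
      using seminorm_triangle[OF p, of n "F y - F x" "c y *\<^sub>R (G y - G x) + (c y - c x) *\<^sub>R G x"]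
        seminorm_triangle[OF p, of n "c y *\<^sub>R (G y - G x)" "(c y - c x) *\<^sub>R G x"]
      by (simp only: seminorm_scale[OF p])
  qed
  ultimately show "\<exists>U. openin X U \<and> x \<in> U \<and> (\<forall>y\<in>U. p n ((F y + c y *\<^sub>R G y) - (F x + c x *\<^sub>R G x)) < e)"
    using x e seminorm_0[OF p, of n]
    by (intro exI[of _ "{y \<in> topspace X. ?g y < e}"]) (auto intro: le_less_trans)
qed

lemma continuous_map_ftop_const:
  assumes p: "\<And>n. seminorm (p n)" shows "continuous_map X (ftop p) (\<lambda>x. v)"
  by (simp add: topspace_ftop[of p, OF p])

lemma continuous_map_ftop_sum:
  assumes p: "\<And>n. seminorm (p n)" and "\<And>k. k \<in> K \<Longrightarrow> continuous_map X (ftop p) (G k)"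
    and "\<And>k. k \<in> K \<Longrightarrow> continuous_map X euclideanreal (c k)"
  shows "continuous_map X (ftop p) (\<lambda>x. \<Sum>k\<in>K. c k x *\<^sub>R G k x)"
  using assms(2,3)
proof (induction K rule: infinite_finite_induct)
  case (insert k K)
  then have "continuous_map X (ftop p) (\<lambda>x. (\<Sum>k\<in>K. c k x *\<^sub>R G k x) + c k x *\<^sub>R G k x)"
    by (intro continuous_map_ftop_add_scale p) auto
  then show ?case using insert by (simp add: add.commute)
qed (simp_all add: topspace_ftop[of p, OF p])

lemma continuous_map_ftop_prod:
  assumes p: "\<And>n. seminorm (p n)" and q: "\<And>n. seminorm (q n)"
    and F: "continuous_map X (ftop p) F" and G: "continuous_map X (ftop q) G"
  shows "continuous_map X (ftop (prod_sn p q)) (\<lambda>x. (F x, G x))"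
proof -
  have pq: "seminorm (prod_sn p q n)" for n by (intro seminorm_prod_sn p q)
  show ?thesis
    unfolding continuous_map_ftop_iff[of "prod_sn p q", OF pq]
  proof (intro ballI allI impI)
    fix x n and e :: real assume x: "x \<in> topspace X" and "e > 0"
    then have e: "e / 2 > 0" by simp
    obtain U where U: "openin X U" "x \<in> U" "\<And>y. y \<in> U \<Longrightarrow> p n (F y - F x) < e / 2"
      using continuous_map_ftopD[of p, OF p F x e] by metis
    obtain V where V: "openin X V" "x \<in> V" "\<And>y. y \<in> V \<Longrightarrow> q n (G y - G x) < e / 2"
      using continuous_map_ftopD[of q, OF q G x e] by metis
    have "prod_sn p q n ((F y, G y) - (F x, G x)) < e" if "y \<in> U \<inter> V" for y
      using U(3)[of y] V(3)[of y] that by (simp add: prod_sn_def)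
    then show "\<exists>U. openin X U \<and> x \<in> U \<and> (\<forall>y\<in>U. prod_sn p q n ((F y, G y) - (F x, G x)) < e)"
      using U V by blast
  qed
qed

section \<open>Hoelder regularity in two parameters\<close>

lemma holder2_real:
  assumes "\<And>s t. 0 \<le> s \<Longrightarrow> s < t \<Longrightarrow> t \<le> T \<Longrightarrow> \<bar>\<Xi> s t\<bar> \<le> C * (t - s) powr \<beta>"
  shows "holder2 real_sn T \<beta> \<Xi>"
  unfolding holder2_def
proof (intro allI impI)
  fix q :: "real \<Rightarrow> real" assume "cont_seminorm real_sn q"
  then have q: "seminorm q" by (simp add: cont_seminorm_def)
  have "q (\<Xi> s t) \<le> (q 1 * C) * (t - s) powr \<beta>" if "0 \<le> s \<and> s < t \<and> t \<le> T" for s t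
    using seminorm_scale[OF q, of "\<Xi> s t" 1] mult_left_mono[OF assms[of s t] seminorm_nonneg[OF q, of 1]] that
    by (simp add: mult.commute mult.left_commute)
  then show "\<exists>C. \<forall>s t. 0 \<le> s \<and> s < t \<and> t \<le> T \<longrightarrow> q (\<Xi> s t) \<le> C * (t - s) powr \<beta>" by blast
qed

text \<open>A continuous seminorm on a product is bounded by the sum of its restrictions to the two
  coordinate subspaces, which are continuous seminorms on the factors.\<close>

lemma holder2_prod:
  assumes p: "\<And>n. seminorm (p n)" and q: "\<And>n. seminorm (q n)"
    and A: "holder2 p T \<beta> \<Xi>" and B: "holder2 q T \<beta> \<Theta>"
  shows "holder2 (prod_sn p q) T \<beta> (\<lambda>s t. (\<Xi> s t, \<Theta> s t))"
  unfolding holder2_def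
proof (intro allI impI)
  fix r assume r: "cont_seminorm (prod_sn p q) r"
  then have sr: "seminorm r" and cr: "continuous_map (ftop (prod_sn p q)) euclideanreal r"
    by (auto simp: cont_seminorm_def)
  have "continuous_map (ftop p) euclideanreal (r \<circ> (\<lambda>x. (x, 0)))"
    "continuous_map (ftop q) euclideanreal (r \<circ> (\<lambda>y. (0, y)))"
    by (intro continuous_map_compose[OF _ cr] continuous_map_ftop_prod p q continuous_map_ftop_const;
        simp add: continuous_map_id[unfolded id_def])+
  moreover have "seminorm (r \<circ> (\<lambda>x. (x, 0)))" "seminorm (r \<circ> (\<lambda>y. (0, y)))"
    using seminorm_triangle[OF sr, of "(_, 0)" "(_, 0)"] seminorm_triangle[OF sr, of "(0, _)" "(0, _)"]
      seminorm_scale[OF sr, of _ "(_, 0)"] seminorm_scale[OF sr, of _ "(0, _)"]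
    by (auto simp: seminorm_def)
  ultimately obtain C D
    where "\<And>s t. 0 \<le> s \<and> s < t \<and> t \<le> T \<Longrightarrow> r (\<Xi> s t, 0) \<le> C * (t - s) powr \<beta>"
      and "\<And>s t. 0 \<le> s \<and> s < t \<and> t \<le> T \<Longrightarrow> r (0, \<Theta> s t) \<le> D * (t - s) powr \<beta>"
    using A B unfolding holder2_def cont_seminorm_def by (fastforce simp: o_def)
  then have "r (\<Xi> s t, \<Theta> s t) \<le> (C + D) * (t - s) powr \<beta>" if "0 \<le> s \<and> s < t \<and> t \<le> T" for s t
    using seminorm_triangle[OF sr, of "(\<Xi> s t, 0)" "(0, \<Theta> s t)"] that by (fastforce simp: distrib_right)
  then show "\<exists>C. \<forall>s t. 0 \<le> s \<and> s < t \<and> t \<le> T \<longrightarrow> r (\<Xi> s t, \<Theta> s t) \<le> C * (t - s) powr \<beta>" by blast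
qed

lemma holder2_minus:
  "holder2 p T \<beta> (\<lambda>s t. - \<Xi> s t) \<longleftrightarrow> holder2 p T \<beta> \<Xi>"
  unfolding holder2_def cont_seminorm_def by (auto simp: seminorm_minus)

lemma holder_cont_path:
  assumes p: "\<And>n. seminorm (p n)" and "0 < \<alpha>" and Y: "holder p T \<alpha> Y"
  shows "cont_path p T Y"
  unfolding cont_path_def continuous_map_ftop_iff[of p, OF p]
proof (intro ballI allI impI)
  fix x n and e :: real assume x: "x \<in> topspace (top_of_set {0..T})" and e: "e > 0"
  obtain C where C: "\<And>s t. 0 \<le> s \<Longrightarrow> s < t \<Longrightarrow> t \<le> T \<Longrightarrow> p n (Y t - Y s) \<le> C * (t - s) powr \<alpha>"
    using Y cont_seminorm_sn[of p n, OF p] unfolding holder_def holder2_def by meson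
  have "((\<lambda>y. C * \<bar>y - x\<bar> powr \<alpha>) \<longlongrightarrow> C * \<bar>x - x\<bar> powr \<alpha>) (at x)"
    using \<open>0 < \<alpha>\<close> by (intro tendsto_intros) auto
  then have "\<forall>\<^sub>F y in at x. C * \<bar>y - x\<bar> powr \<alpha> < e"
    using e by (intro order_tendstoD) auto
  then obtain d where d: "d > 0" "\<And>y. y \<noteq> x \<Longrightarrow> dist y x < d \<Longrightarrow> C * \<bar>y - x\<bar> powr \<alpha> < e"
    unfolding eventually_at by auto
  have "p n (Y y - Y x) < e" if "y \<in> {0..T} \<inter> ball x d" for y
  proof (cases y x rule: linorder_cases)
    case less
    then show ?thesis using C[of y x] d(2)[of y] that x seminorm_diff_commute[OF p, of n "Y y" "Y x"]
      by (auto simp: dist_commute)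
  next
    case greater
    then show ?thesis using C[of x y] d(2)[of y] that x by (auto simp: dist_commute)
  qed (use e seminorm_0[OF p, of n] in simp)
  then show "\<exists>U. openin (top_of_set {0..T}) U \<and> x \<in> U \<and> (\<forall>y\<in>U. p n (Y y - Y x) < e)"
    using x d(1) by (intro exI[of _ "{0..T} \<inter> ball x d"]) (auto intro: openin_open_Int)
qed

section \<open>Partitions and mesh limits\<close>

text \<open>The sum of a germ over consecutive points, and the mesh condition, in the indexed form in which
  mesh limits are defined; the recursive equations below are the ones used in proofs.\<close>

definition psum :: "(real \<Rightarrow> real \<Rightarrow> 'e::real_vector) \<Rightarrow> real list \<Rightarrow> 'e" where
  "psum \<Xi> ts = (\<Sum>i<length ts - 1. \<Xi> (ts ! i) (ts ! Suc i))"

definition finer :: "real \<Rightarrow> real list \<Rightarrow> bool" where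
  "finer \<delta> ts \<longleftrightarrow> (\<forall>i. Suc i < length ts \<longrightarrow> ts ! Suc i - ts ! i < \<delta>)"

lemma psum_simps [simp]:
  "psum \<Xi> [] = 0" "psum \<Xi> [x] = 0" "psum \<Xi> (x # y # ts) = \<Xi> x y + psum \<Xi> (y # ts)"
  by (simp_all add: psum_def sum.lessThan_Suc_shift del: sum.lessThan_Suc)

lemma finer_simps [simp]:
  "finer \<delta> []" "finer \<delta> [x]" "finer \<delta> (x # y # ts) \<longleftrightarrow> y - x < \<delta> \<and> finer \<delta> (y # ts)"
  by (auto simp: finer_def nth_Cons split: nat.splits)

lemma finer_mono: "finer \<delta> ts \<Longrightarrow> \<delta> \<le> \<delta>' \<Longrightarrow> finer \<delta>' ts"
  unfolding finer_def by (meson less_le_trans)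

lemma psum_append: "xs \<noteq> [] \<Longrightarrow> ys \<noteq> [] \<Longrightarrow> last xs = hd ys \<Longrightarrow> psum \<Xi> (xs @ tl ys) = psum \<Xi> xs + psum \<Xi> ys"
proof (induction xs rule: induct_list012)
  case (2 x)
  then show ?case by (cases ys) auto
qed (auto simp: add.assoc)

lemma finer_append: "xs \<noteq> [] \<Longrightarrow> ys \<noteq> [] \<Longrightarrow> last xs = hd ys \<Longrightarrow> finer \<delta> (xs @ tl ys) \<longleftrightarrow> finer \<delta> xs \<and> finer \<delta> ys"
proof (induction xs rule: induct_list012)
  case (2 x)
  then show ?case by (cases ys) auto
qed auto

lemma partition_of_single [simp]: "partition_of s t [x] \<longleftrightarrow> x = s \<and> x = t"
  by (auto simp: partition_of_def)

lemma partition_of_Cons [simp]: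
  "partition_of s t (x # y # ts) \<longleftrightarrow> x = s \<and> s < y \<and> partition_of y t (y # ts)"
  by (auto simp: partition_of_def)

lemma partition_of_le: "partition_of s t ts \<Longrightarrow> s \<le> t"
proof (induction ts arbitrary: s rule: induct_list012)
  case (3 x y zs)
  then have "s < y" "y \<le> t" by auto
  then show ?case by simp
qed (auto simp: partition_of_def)

lemma partition_of_degenerate: "partition_of s s ts \<Longrightarrow> ts = [s]"
proof (induction ts rule: induct_list012)
  case (3 x y zs)
  then have "s < y" "partition_of y s (y # zs)" by auto
  then show ?case using partition_of_le[of y s "y # zs"] by simp
qed (auto simp: partition_of_def)

lemma partition_of_append:
  "partition_of s u xs \<Longrightarrow> partition_of u t ys \<Longrightarrow> partition_of s t (xs @ tl ys)"
proof (induction xs arbitrary: s rule: induct_list012)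
  case (2 x)
  then show ?case by (cases ys) (auto simp: partition_of_def)
next
  case (3 x y zs)
  then have "partition_of y t ((y # zs) @ tl ys)" by auto
  then show ?case using 3 by simp
qed (auto simp: partition_of_def)

lemma psum_telescope: "ts \<noteq> [] \<Longrightarrow> psum (\<lambda>v w. g w - g v) ts = g (last ts) - g (hd ts)"
  by (induction ts rule: induct_list012) auto

lemma psum_telescope_partition: "partition_of s t ts \<Longrightarrow> psum (\<lambda>v w. g w - g v) ts = g t - g s"
  using psum_telescope[of ts g] by (auto simp: partition_of_def)

lemma psum_add: "psum (\<lambda>v w. \<Xi> v w + \<Theta> v w) ts = psum \<Xi> ts + psum \<Theta> ts"
  by (simp add: psum_def sum.distrib)

lemma psum_diff: "psum (\<lambda>v w. \<Xi> v w - \<Theta> v w) ts = psum \<Xi> ts - psum \<Theta> ts"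
  by (simp add: psum_def sum_subtractf)

lemma psum_minus: "psum (\<lambda>v w. - \<Xi> v w) ts = - psum \<Xi> ts"
  by (simp add: psum_def sum_negf)

lemma psum_cong:
  assumes "partition_of s t ts" "\<And>v w. s \<le> v \<Longrightarrow> v < w \<Longrightarrow> w \<le> t \<Longrightarrow> \<Xi> v w = \<Theta> v w"
  shows "psum \<Xi> ts = psum \<Theta> ts"
  using assms
proof (induction ts arbitrary: s rule: induct_list012)
  case (3 x y zs)
  then show ?case using "3.IH"(2)[of y] partition_of_le[of y t "y # zs"] by auto
qed auto

text \<open>Bounds that are linear in the length of the interval add up over a partition.\<close>

lemma psum_bound:
  assumes q: "seminorm q" and "partition_of s t ts" "finer \<delta> ts"
    and "\<And>v w. s \<le> v \<Longrightarrow> v < w \<Longrightarrow> w \<le> t \<Longrightarrow> w - v < \<delta> \<Longrightarrow> q (\<Xi> v w) \<le> e * (w - v)"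
  shows "q (psum \<Xi> ts) \<le> e * (t - s)"
  using assms(2-)
proof (induction ts arbitrary: s rule: induct_list012)
  case (3 x y zs)
  then have "q (psum \<Xi> (y # zs)) \<le> e * (t - y)" "q (\<Xi> s y) \<le> e * (y - s)"
    using "3.IH"(2)[of y] partition_of_le[of y t "y # zs"] by auto
  then show ?case
    using 3 seminorm_triangle[OF q, of "\<Xi> s y" "psum \<Xi> (y # zs)"] by (auto simp: algebra_simps)
qed (auto simp: partition_of_def seminorm_0[OF q])

lemma partition_finer: "partition_of s t ts \<Longrightarrow> t - s < \<delta> \<Longrightarrow> finer \<delta> ts"
proof (induction ts arbitrary: s rule: induct_list012)
  case (3 x y zs)
  then show ?case using "3.IH"(2)[of y] partition_of_le[of y t "y # zs"] by auto
qed auto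

text \<open>Repeated halving provides arbitrarily fine partitions, and its recursive form is the one in which the
  sewing estimate proceeds.\<close>

fun bisect :: "nat \<Rightarrow> real \<Rightarrow> real \<Rightarrow> real list" where
  "bisect 0 s t = [s, t]"
| "bisect (Suc n) s t = bisect n s ((s + t) / 2) @ tl (bisect n ((s + t) / 2) t)"

lemma partition_of_bisect: "s < t \<Longrightarrow> partition_of s t (bisect n s t)"
proof (induction n arbitrary: s t)
  case (Suc n)
  then show ?case by (auto intro!: partition_of_append[of s "(s + t) / 2"])
qed simp

lemma last_hd_bisect:
  assumes "s < t"
  shows "bisect n s ((s + t) / 2) \<noteq> []" "bisect n ((s + t) / 2) t \<noteq> []"
    "last (bisect n s ((s + t) / 2)) = hd (bisect n ((s + t) / 2) t)"
  using partition_of_bisect[of s "(s + t) / 2" n] partition_of_bisect[of "(s + t) / 2" t n] assms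
  by (auto simp: partition_of_def)

lemma finer_bisect: "s < t \<Longrightarrow> (t - s) / 2 ^ n < \<delta> \<Longrightarrow> finer \<delta> (bisect n s t)"
proof (induction n arbitrary: s t)
  case (Suc n)
  have "((s + t) / 2 - s) / 2 ^ n < \<delta>" "(t - (s + t) / 2) / 2 ^ n < \<delta>"
    using Suc.prems by (simp_all add: field_simps)
  then show ?case using Suc.IH[of s "(s + t) / 2"] Suc.IH[of "(s + t) / 2" t] Suc.prems
    by (simp add: finer_append last_hd_bisect)
qed simp

definition meshes :: "real \<Rightarrow> real \<Rightarrow> real list filter" where
  "meshes s t = (INF \<delta>\<in>{0<..}. principal {ts. partition_of s t ts \<and> finer \<delta> ts})"

lemma eventually_meshes:
  "eventually P (meshes s t) \<longleftrightarrow> (\<exists>\<delta>>0. \<forall>ts. partition_of s t ts \<longrightarrow> finer \<delta> ts \<longrightarrow> P ts)"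
proof -
  have "eventually P (meshes s t) \<longleftrightarrow>
    (\<exists>\<delta>\<in>{0<..}. eventually P (principal {ts. partition_of s t ts \<and> finer \<delta> ts}))"
    unfolding meshes_def
  proof (rule eventually_INF_base)
    fix a b :: real assume "a \<in> {0<..}" "b \<in> {0<..}"
    then show "\<exists>x\<in>{0<..}. principal {ts. partition_of s t ts \<and> finer x ts}
      \<le> inf (principal {ts. partition_of s t ts \<and> finer a ts}) (principal {ts. partition_of s t ts \<and> finer b ts})"
      by (intro bexI[of _ "min a b"]) (auto intro: finer_mono)
  qed auto
  then show ?thesis by (auto simp: eventually_principal Bex_def)
qed

lemma eventually_meshes_partition: "\<forall>\<^sub>F ts in meshes s t. partition_of s t ts"
  unfolding eventually_meshes by (auto intro: exI[of _ 1])

lemma filterlim_bisect: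
  assumes "s < t" shows "filterlim (\<lambda>n. bisect n s t) (meshes s t) sequentially"
  unfolding filterlim_iff eventually_meshes
proof (intro allI impI, elim exE conjE)
  fix P and \<delta> :: real assume \<delta>: "\<delta> > 0" and P: "\<forall>ts. partition_of s t ts \<longrightarrow> finer \<delta> ts \<longrightarrow> P ts"
  have "(\<lambda>n. (t - s) / 2 ^ n) \<longlonglongrightarrow> 0"
    by (rule LIMSEQ_divide_realpow_zero) simp
  then have "\<forall>\<^sub>F n in sequentially. (t - s) / 2 ^ n < \<delta>"
    using \<delta> by (rule order_tendstoD)
  then show "\<forall>\<^sub>F n in sequentially. P (bisect n s t)"
    by eventually_elim (use P assms finer_bisect partition_of_bisect in blast)
qed

lemma meshes_neq_bot:
  assumes "s \<le> t" shows "meshes s t \<noteq> bot"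
proof (cases "s = t")
  case True
  have "\<not> eventually (\<lambda>_. False) (meshes s t)"
    unfolding eventually_meshes by (auto simp: True intro!: exI[of _ "[t]"])
  then show ?thesis by (simp add: trivial_limit_def)
next
  case False
  then show ?thesis
    using filterlim_bisect[of s t, unfolded filterlim_iff, rule_format, of "\<lambda>_. False"] assms
    by (auto simp: trivial_limit_def)
qed

text \<open>Convergence of the sums as the mesh tends to \<open>0\<close>, measured by a single seminorm \<open>q\<close>. Estimates are made
  for one seminorm at a time, and \<open>q\<close> may be a finite sum of the defining ones.\<close>

definition lim_q :: "('e::real_vector \<Rightarrow> real) \<Rightarrow> (real \<Rightarrow> real \<Rightarrow> 'e) \<Rightarrow> real \<Rightarrow> real \<Rightarrow> 'e \<Rightarrow> bool" where
  "lim_q q \<Xi> s t I \<longleftrightarrow> ((\<lambda>ts. q (psum \<Xi> ts - I)) \<longlongrightarrow> 0) (meshes s t)"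

lemma lim_q_iff:
  assumes "seminorm q"
  shows "lim_q q \<Xi> s t I \<longleftrightarrow>
    (\<forall>e>0. \<exists>\<delta>>0. \<forall>ts. partition_of s t ts \<longrightarrow> finer \<delta> ts \<longrightarrow> q (psum \<Xi> ts - I) < e)"
  unfolding lim_q_def tendsto_iff eventually_meshes
  by (simp add: seminorm_nonneg[OF assms])

lemma has_mesh_limit_iff_lim_q:
  assumes "\<And>n. seminorm (p n)"
  shows "has_mesh_limit p \<Xi> s t I \<longleftrightarrow> (\<forall>n. lim_q (p n) \<Xi> s t I)"
  unfolding has_mesh_limit_def lim_q_iff[OF assms]
  by (simp add: psum_def finer_def imp_conjL)

lemma lim_q_real: "lim_q (real_sn n) \<Xi> s t I \<longleftrightarrow> (psum \<Xi> \<longlongrightarrow> I) (meshes s t)"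
  unfolding lim_q_def real_sn_def by (simp add: tendsto_rabs_zero_iff LIM_zero_iff)

lemma has_mesh_limit_real: "has_mesh_limit real_sn \<Xi> s t I \<longleftrightarrow> (psum \<Xi> \<longlongrightarrow> I) (meshes s t)"
  unfolding has_mesh_limit_iff_lim_q[of real_sn, OF seminorm_real_sn] lim_q_real by simp

lemma lim_q_finite_sum:
  assumes "\<And>n. lim_q (p n) \<Xi> s t I"
  shows "lim_q (\<lambda>x. \<Sum>i\<le>(N::nat). p i x) \<Xi> s t I"
  using assms unfolding lim_q_def by (intro tendsto_null_sum)

lemma lim_q_add:
  assumes q: "seminorm q" and "lim_q q \<Xi> s t I" "lim_q q \<Theta> s t J"
  shows "lim_q q (\<lambda>v w. \<Xi> v w + \<Theta> v w) s t (I + J)"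
  unfolding lim_q_def
proof (rule Lim_null_comparison)
  show "((\<lambda>ts. q (psum \<Xi> ts - I) + q (psum \<Theta> ts - J)) \<longlongrightarrow> 0) (meshes s t)"
    using assms tendsto_add_zero unfolding lim_q_def by blast
  show "\<forall>\<^sub>F ts in meshes s t. norm (q (psum (\<lambda>v w. \<Xi> v w + \<Theta> v w) ts - (I + J)))
      \<le> q (psum \<Xi> ts - I) + q (psum \<Theta> ts - J)"
  proof (intro always_eventually allI)
    fix ts
    have eq: "psum (\<lambda>v w. \<Xi> v w + \<Theta> v w) ts - (I + J) = (psum \<Xi> ts - I) + (psum \<Theta> ts - J)"
      by (simp add: psum_add)
    show "norm (q (psum (\<lambda>v w. \<Xi> v w + \<Theta> v w) ts - (I + J))) \<le> q (psum \<Xi> ts - I) + q (psum \<Theta> ts - J)"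
      unfolding eq using seminorm_triangle[OF q] by (simp add: seminorm_nonneg[OF q])
  qed
qed

lemma lim_q_minus:
  assumes q: "seminorm q" and "lim_q q \<Xi> s t I"
  shows "lim_q q (\<lambda>v w. - \<Xi> v w) s t (- I)"
proof -
  have "q (psum (\<lambda>v w. - \<Xi> v w) ts - (- I)) = q (psum \<Xi> ts - I)" for ts
    using seminorm_minus[OF q, of "psum \<Xi> ts - I"] by (simp add: psum_minus)
  then show ?thesis using assms unfolding lim_q_def by simp
qed

lemma lim_q_cong:
  assumes "\<And>v w. s \<le> v \<Longrightarrow> v < w \<Longrightarrow> w \<le> t \<Longrightarrow> \<Xi> v w = \<Theta> v w"
  shows "lim_q q \<Xi> s t I \<longleftrightarrow> lim_q q \<Theta> s t I"
  unfolding lim_q_def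
proof (rule tendsto_cong)
  show "\<forall>\<^sub>F ts in meshes s t. q (psum \<Xi> ts - I) = q (psum \<Theta> ts - I)"
    using eventually_meshes_partition[of s t] by eventually_elim (simp add: psum_cong[OF _ assms])
qed

text \<open>Prepending one fine partition of the initial interval to a fine partition of the remaining
  interval shows that mesh limits over initial intervals determine those over subintervals.\<close>

lemma lim_q_subinterval:
  assumes q: "seminorm q" and "s \<le> u" and A: "lim_q q \<Xi> s u I" and B: "lim_q q \<Xi> s t J"
  shows "lim_q q \<Xi> u t (J - I)"
  unfolding lim_q_iff[OF q]
proof (intro allI impI)
  fix e :: real assume "e > 0"
  then have e: "e / 2 > 0" by simp
  obtain a where a: "a > 0" "\<And>ts. partition_of s u ts \<Longrightarrow> finer a ts \<Longrightarrow> q (psum \<Xi> ts - I) < e / 2"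
    using A e unfolding lim_q_iff[OF q] by meson
  obtain b where b: "b > 0" "\<And>ts. partition_of s t ts \<Longrightarrow> finer b ts \<Longrightarrow> q (psum \<Xi> ts - J) < e / 2"
    using B e unfolding lim_q_iff[OF q] by meson
  have "\<forall>\<^sub>F ts in meshes s u. partition_of s u ts \<and> finer (min a b) ts"
    unfolding eventually_meshes using a b by (intro exI[of _ "min a b"]) auto
  then obtain us where us: "partition_of s u us" "finer (min a b) us"
    using eventually_happens'[OF meshes_neq_bot[OF \<open>s \<le> u\<close>]] by blast
  have "q (psum \<Xi> ts - (J - I)) < e" if ts: "partition_of u t ts" "finer (min a b) ts" for ts
  proof -
    have ne: "us \<noteq> []" "ts \<noteq> []" "last us = hd ts"
      using us ts by (auto simp: partition_of_def)
    have "q (psum \<Xi> (us @ tl ts) - J) < e / 2"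
      using us ts ne finer_mono[of "min a b" _ b]
      by (intro b(2) partition_of_append[of s u]) (auto simp: finer_append)
    moreover have "q (psum \<Xi> us - I) < e / 2"
      using us finer_mono[of "min a b" us a] by (intro a(2)) auto
    moreover have "psum \<Xi> ts - (J - I) = (psum \<Xi> (us @ tl ts) - J) - (psum \<Xi> us - I)"
      by (simp add: psum_append[OF ne])
    ultimately show ?thesis
      using seminorm_diff[OF q, of "psum \<Xi> (us @ tl ts) - J" "psum \<Xi> us - I"] by (simp only:)
  qed
  then show "\<exists>\<delta>>0. \<forall>ts. partition_of u t ts \<longrightarrow> finer \<delta> ts \<longrightarrow> q (psum \<Xi> ts - (J - I)) < e"
    using a b by (intro exI[of _ "min a b"]) auto
qed

lemma lim_q_le:
  assumes q: "seminorm q" and "s \<le> t" and lim: "lim_q q \<Xi> s t I"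
    and "\<And>ts. partition_of s t ts \<Longrightarrow> q (psum \<Xi> ts - c) \<le> B"
  shows "q (I - c) \<le> B"
proof (rule tendsto_lowerbound)
  show "((\<lambda>ts. q (psum \<Xi> ts - I) + B) \<longlongrightarrow> B) (meshes s t)"
    using tendsto_add[OF lim[unfolded lim_q_def] tendsto_const, of B] by simp
  show "\<forall>\<^sub>F ts in meshes s t. q (I - c) \<le> q (psum \<Xi> ts - I) + B"
    using eventually_meshes_partition[of s t]
  proof eventually_elim
    case (elim ts)
    then show ?case
      using assms(4)[OF elim] seminorm_diff_triangle[OF q, of I c "psum \<Xi> ts"]
        seminorm_diff_commute[OF q, of I "psum \<Xi> ts"] by simp
  qed
  show "meshes s t \<noteq> bot" by (rule meshes_neq_bot) fact
qed

text \<open>Halving the interval \<open>n\<close> times changes the sum of the germ by at most a geometric series, whose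
  ratio \<open>2\<^sup>1\<^sup>-\<^sup>\<theta>\<close> is less than \<open>1\<close>, and these sums converge to the mesh limit.\<close>

lemma sewing_bound:
  assumes q: "seminorm q" and "\<theta> > 1" and "0 \<le> C"
    and defect: "\<And>s u t. a \<le> s \<Longrightarrow> s < u \<Longrightarrow> u < t \<Longrightarrow> t \<le> b \<Longrightarrow>
      q (\<Xi> s t - \<Xi> s u - \<Xi> u t) \<le> C * (t - s) powr \<theta>"
    and st: "a \<le> s" "s < t" "t \<le> b" and lim: "lim_q q \<Xi> s t I"
  shows "q (I - \<Xi> s t) \<le> C / (1 - 2 powr (1 - \<theta>)) * (t - s) powr \<theta>"
proof -
  define r where "r = 2 powr (1 - \<theta>)"
  define K where "K = 1 / (1 - r)"
  have "r < 2 powr 0" unfolding r_def by (intro powr_less_mono) (use \<open>\<theta> > 1\<close> in auto)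
  then have r: "r < 1" by simp
  \<comment> \<open>with this \<open>K\<close> the bound \<open>C K (t - s)\<^sup>\<theta>\<close> reproduces itself when the intervals are halved once more\<close>
  have K: "K = K * r + 1" unfolding K_def using r by (simp add: field_simps)
  have bound: "q (psum \<Xi> (bisect n s t) - \<Xi> s t) \<le> C * K * (t - s) powr \<theta>"
    if "a \<le> s" "s < t" "t \<le> b" for n s t
    using that
  proof (induction n arbitrary: s t)
    case 0
    have "0 < K" unfolding K_def using r by simp
    then show ?case using \<open>0 \<le> C\<close> seminorm_0[OF q] by simp
  next
    case (Suc n)
    define u where "u = (s + t) / 2"
    have u: "s < u" "u < t" "u - s = (t - s) / 2" "t - u = (t - s) / 2"
      using Suc.prems by (auto simp: u_def field_simps)
    let ?A = "psum \<Xi> (bisect n s u)" and ?B = "psum \<Xi> (bisect n u t)"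
    have half: "2 * ((t - s) / 2) powr \<theta> = r * (t - s) powr \<theta>"
      using Suc.prems by (simp add: powr_divide r_def powr_diff)
    have "psum \<Xi> (bisect (Suc n) s t) = ?A + ?B"
      unfolding u_def bisect.simps by (intro psum_append last_hd_bisect Suc.prems)
    then have "psum \<Xi> (bisect (Suc n) s t) - \<Xi> s t
        = (?A - \<Xi> s u) + ((?B - \<Xi> u t) - (\<Xi> s t - \<Xi> s u - \<Xi> u t))" by simp
    then have "q (psum \<Xi> (bisect (Suc n) s t) - \<Xi> s t)
        \<le> q (?A - \<Xi> s u) + (q (?B - \<Xi> u t) + q (\<Xi> s t - \<Xi> s u - \<Xi> u t))"
      using seminorm_triangle[OF q, of "?A - \<Xi> s u" "(?B - \<Xi> u t) - (\<Xi> s t - \<Xi> s u - \<Xi> u t)"]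
        seminorm_diff[OF q, of "?B - \<Xi> u t" "\<Xi> s t - \<Xi> s u - \<Xi> u t"] by (smt (verit))
    also have "\<dots> \<le> C * K * ((t - s) / 2) powr \<theta> + (C * K * ((t - s) / 2) powr \<theta> + C * (t - s) powr \<theta>)"
      using Suc.IH[of s u] Suc.IH[of u t] defect[of s u t] Suc.prems u by (intro add_mono) auto
    also have "\<dots> = C * K * (2 * ((t - s) / 2) powr \<theta>) + C * (t - s) powr \<theta>" by simp
    also have "\<dots> = C * (K * r + 1) * (t - s) powr \<theta>" unfolding half by (simp add: algebra_simps)
    finally show ?case using K by simp
  qed
  have "(\<lambda>n. q (psum \<Xi> (bisect n s t) - I)) \<longlonglongrightarrow> 0"
    using filterlim_compose[OF lim[unfolded lim_q_def] filterlim_bisect[OF st(2)]] by simp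
  then have "(\<lambda>n. q (psum \<Xi> (bisect n s t) - I) + C * K * (t - s) powr \<theta>) \<longlonglongrightarrow> 0 + C * K * (t - s) powr \<theta>"
    by (intro tendsto_intros)
  moreover have "q (I - \<Xi> s t) \<le> q (psum \<Xi> (bisect n s t) - I) + C * K * (t - s) powr \<theta>" for n
    using bound[OF st, of n] seminorm_diff_triangle[OF q, of I "\<Xi> s t" "psum \<Xi> (bisect n s t)"]
      seminorm_diff_commute[OF q, of I "psum \<Xi> (bisect n s t)"] by simp
  ultimately have "q (I - \<Xi> s t) \<le> 0 + C * K * (t - s) powr \<theta>"
    by (intro tendsto_lowerbound[OF _ always_eventually]) auto
  then show ?thesis by (simp add: K_def r_def)
qed

section \<open>Riemann integrals of continuous paths\<close>

lemma cont_path_seminorm_diff: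
  assumes p: "\<And>n. seminorm (p n)" and q: "cont_seminorm p q" and F: "cont_path p T F"
  shows "continuous_on ({0..T} \<times> {0..T}) (\<lambda>(s, t). q (F t - F s))"
proof -
  let ?X = "top_of_set ({0..T} \<times> {0..T})"
  have "continuous_map ?X (ftop p) (F \<circ> fst)" "continuous_map ?X (ftop p) (F \<circ> snd)"
    using F unfolding cont_path_def
    by (intro continuous_map_compose[of _ "top_of_set {0..T}"];
        auto simp: continuous_map_in_subtopology intro!: continuous_intros)+
  then have "continuous_map ?X (ftop p) (\<lambda>z. (F \<circ> snd) z + (- 1) *\<^sub>R (F \<circ> fst) z)"
    by (intro continuous_map_ftop_add_scale p) (simp_all add: o_def)
  then have "continuous_map ?X euclideanreal (q \<circ> (\<lambda>z. (F \<circ> snd) z + (- 1) *\<^sub>R (F \<circ> fst) z))"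
    using q unfolding cont_seminorm_def by (intro continuous_map_compose) auto
  then show ?thesis
    by (simp add: o_def case_prod_unfold)
qed

lemma cont_path_uniform:
  assumes p: "\<And>n. seminorm (p n)" and q: "cont_seminorm p q" and F: "cont_path p T F" and "e > 0"
  shows "\<exists>\<delta>>0. \<forall>s\<in>{0..T}. \<forall>t\<in>{0..T}. \<bar>t - s\<bar> < \<delta> \<longrightarrow> q (F t - F s) < e"
proof -
  let ?g = "\<lambda>(s, t). q (F t - F s)"
  have "uniformly_continuous_on ({0..T} \<times> {0..T}) ?g"
    by (intro compact_uniformly_continuous cont_path_seminorm_diff[of p, OF p q F] compact_Times) auto
  then obtain d where d: "d > 0" "\<And>z z'. z \<in> {0..T} \<times> {0..T} \<Longrightarrow> z' \<in> {0..T} \<times> {0..T} \<Longrightarrow>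
      dist z' z < d \<Longrightarrow> dist (?g z') (?g z) < e"
    using \<open>e > 0\<close> unfolding uniformly_continuous_on_def by meson
  have q0: "seminorm q" using q by (simp add: cont_seminorm_def)
  have "q (F t - F s) < e" if "s \<in> {0..T}" "t \<in> {0..T}" "\<bar>t - s\<bar> < d" for s t
    using d(2)[of "(s, s)" "(s, t)"] that
    by (simp add: dist_Pair_Pair dist_real_def seminorm_0[OF q0] seminorm_nonneg[OF q0])
  then show ?thesis using d(1) by blast
qed

lemma cont_path_bounded:
  assumes p: "\<And>n. seminorm (p n)" and q: "cont_seminorm p q" and F: "cont_path p T F"
  shows "\<exists>B\<ge>0. \<forall>t\<in>{0..T}. q (F t) \<le> B"
proof -
  have "continuous_map (top_of_set {0..T}) euclideanreal (q \<circ> F)"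
    using q F unfolding cont_seminorm_def cont_path_def by (intro continuous_map_compose) auto
  then have "compact ((q \<circ> F) ` {0..T})"
    by (intro compact_continuous_image) auto
  then obtain B where "\<And>x. x \<in> (q \<circ> F) ` {0..T} \<Longrightarrow> \<bar>x\<bar> \<le> B"
    using compact_imp_bounded bounded_real by metis
  then show ?thesis by (intro exI[of _ "max B 0"]) fastforce
qed

text \<open>A Riemann sum with a prescribed value \<open>c\<close> on the first interval. It makes two sums comparable by
  advancing to the nearest point of either partition.\<close>

fun riemann_from :: "(real \<Rightarrow> 'e::real_vector) \<Rightarrow> 'e \<Rightarrow> real \<Rightarrow> real list \<Rightarrow> 'e" where
  "riemann_from F c x [] = 0"
| "riemann_from F c x (y # ys) = (y - x) *\<^sub>R c + riemann_from F (F y) y ys"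

lemma psum_riemann: "psum (\<lambda>v w. (w - v) *\<^sub>R F v) (x # ys) = riemann_from F (F x) x ys"
  by (induction ys arbitrary: x) auto

text \<open>Both sums carry values of \<open>F\<close> at earlier points \<open>c\<close> and \<open>d\<close>, which stay within \<open>\<delta>\<close> of each other
  whichever of the two partitions advances.\<close>

lemma riemann_from_compare:
  assumes q: "seminorm q"
    and osc: "\<And>s t. a \<le> s \<Longrightarrow> s \<le> t \<Longrightarrow> t \<le> b \<Longrightarrow> t - s < \<delta> \<Longrightarrow> q (F t - F s) \<le> e"
    and "partition_of x b (x # ys)" "partition_of x b (x # zs)" "finer \<delta> (c # ys)" "finer \<delta> (d # zs)"
    and "a \<le> c" "c \<le> x" "a \<le> d" "d \<le> x"
  shows "q (riemann_from F (F c) x ys - riemann_from F (F d) x zs) \<le> e * (b - x)"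
  using assms(3-)
proof (induction "length ys + length zs" arbitrary: x c d ys zs rule: less_induct)
  case less
  show ?case
  proof (cases ys)
    case Nil
    then show ?thesis using less.prems partition_of_degenerate[of b "x # zs"] by (simp add: seminorm_0[OF q])
  next
    case y: (Cons y ys')
    show ?thesis
    proof (cases zs)
      case Nil
      then show ?thesis using less.prems partition_of_degenerate[of b "x # ys"] by (simp add: seminorm_0[OF q])
    next
      case z: (Cons z zs')
      define w where "w = min y z"
      have yb: "y \<le> b" "z \<le> b" "x < y" "x < z" using less.prems y z partition_of_le by auto
      have osc': "q (F c - F d) \<le> e"
      proof (cases "c \<le> d")
        case True
        then show ?thesis using osc[of c d] less.prems y yb seminorm_diff_commute[OF q, of "F c" "F d"] by simp
      next
        case False
        then show ?thesis using osc[of d c] less.prems z yb by simp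
      qed
      obtain R where step: "riemann_from F (F c) x ys - riemann_from F (F d) x zs = (w - x) *\<^sub>R (F c - F d) + R"
        and R: "q R \<le> e * (b - w)"
      proof (cases y z rule: linorder_cases)
        case less
        have "q (riemann_from F (F y) y ys' - riemann_from F (F d) y zs) \<le> e * (b - y)"
          using less less.prems y z yb by (intro less.hyps) auto
        moreover have "riemann_from F (F c) x ys - riemann_from F (F d) x zs
            = (w - x) *\<^sub>R (F c - F d) + (riemann_from F (F y) y ys' - riemann_from F (F d) y zs)"
          using less by (simp add: y z w_def algebra_simps)
        ultimately show ?thesis using that less by (simp add: w_def)
      next
        case equal
        have "q (riemann_from F (F y) y ys' - riemann_from F (F y) y zs') \<le> e * (b - y)"
          using equal less.prems y z yb by (intro less.hyps) auto
        moreover have "riemann_from F (F c) x ys - riemann_from F (F d) x zs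
            = (w - x) *\<^sub>R (F c - F d) + (riemann_from F (F y) y ys' - riemann_from F (F y) y zs')"
          using equal by (simp add: y z w_def algebra_simps)
        ultimately show ?thesis using that equal by (simp add: w_def)
      next
        case greater
        have "q (riemann_from F (F c) z ys - riemann_from F (F z) z zs') \<le> e * (b - z)"
          using greater less.prems y z yb by (intro less.hyps) auto
        moreover have "riemann_from F (F c) x ys - riemann_from F (F d) x zs
            = (w - x) *\<^sub>R (F c - F d) + (riemann_from F (F c) z ys - riemann_from F (F z) z zs')"
          using greater by (simp add: y z w_def algebra_simps)
        ultimately show ?thesis using that greater by (simp add: w_def)
      qed
      have "q ((w - x) *\<^sub>R (F c - F d) + R) \<le> (w - x) * q (F c - F d) + q R"
        using seminorm_triangle[OF q, of "(w - x) *\<^sub>R (F c - F d)" R] yb by (simp add: seminorm_scale[OF q] w_def)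
      also have "\<dots> \<le> (w - x) * e + e * (b - w)"
        using osc' R yb by (intro add_mono mult_left_mono) (auto simp: w_def)
      finally show ?thesis unfolding step by (simp add: algebra_simps)
    qed
  qed
qed

lemma riemann_sums_close:
  assumes p: "\<And>n. seminorm (p n)" and q: "cont_seminorm p q" and F: "cont_path p T F"
    and "0 \<le> s" "s \<le> t" "t \<le> T" "e > 0"
  shows "\<exists>\<delta>>0. \<forall>ts us. partition_of s t ts \<and> finer \<delta> ts \<and> partition_of s t us \<and> finer \<delta> us \<longrightarrow>
      q (psum (\<lambda>v w. (w - v) *\<^sub>R F v) ts - psum (\<lambda>v w. (w - v) *\<^sub>R F v) us) < e"
proof -
  \<comment> \<open>the summand \<open>1\<close> keeps the denominator positive when \<open>s = t\<close>\<close>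
  define e' where "e' = e / (t - s + 1)"
  have "e' > 0" using assms(5,7) by (simp add: e'_def)
  then obtain \<delta> where \<delta>: "\<delta> > 0" "\<forall>s\<in>{0..T}. \<forall>t\<in>{0..T}. \<bar>t - s\<bar> < \<delta> \<longrightarrow> q (F t - F s) < e'"
    using cont_path_uniform[of p, OF p q F \<open>e' > 0\<close>] by blast
  show ?thesis
  proof (intro exI[of _ \<delta>] conjI allI impI; (elim conjE)?)
    fix ts us assume A: "partition_of s t ts" "finer \<delta> ts" "partition_of s t us" "finer \<delta> us"
    obtain xs ys where eq: "ts = s # xs" "us = s # ys"
      using A by (cases ts; cases us) (auto simp: partition_of_def)
    have "q (psum (\<lambda>v w. (w - v) *\<^sub>R F v) ts - psum (\<lambda>v w. (w - v) *\<^sub>R F v) us) \<le> e' * (t - s)"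
      unfolding eq psum_riemann
    proof (rule riemann_from_compare)
      show "q (F v - F u) \<le> e'" if "s \<le> u" "u \<le> v" "v \<le> t" "v - u < \<delta>" for u v
        using \<delta>(2)[rule_format, of u v] that assms(4-6) by simp
    qed (use A eq q in \<open>simp_all add: cont_seminorm_def\<close>)
    also have "\<dots> < e' * (t - s + 1)" using \<open>e' > 0\<close> by (simp add: distrib_left)
    also have "\<dots> = e" using assms(5) by (simp add: e'_def)
    finally show "q (psum (\<lambda>v w. (w - v) *\<^sub>R F v) ts - psum (\<lambda>v w. (w - v) *\<^sub>R F v) us) < e" .
  qed fact
qed

text \<open>The sums over repeatedly halved intervals are Cauchy, and all fine sums are close to them.\<close>

lemma has_dt_integral_exists:
  assumes p: "frechet_space p" and F: "cont_path p T F" and t: "0 \<le> t" "t \<le> T"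
  obtains I where "has_dt_integral p F 0 t I"
proof (cases "t = 0")
  case True
  have "has_dt_integral p F 0 t 0"
    unfolding has_dt_integral_def has_mesh_limit_iff_lim_q[of p, OF frechet_seminorm[OF p]]
      lim_q_iff[OF frechet_seminorm[OF p]]
  proof (intro allI impI exI[of _ 1] conjI)
    fix n ts and e :: real assume "0 < e" "partition_of 0 t ts"
    then show "p n (psum (\<lambda>v w. (w - v) *\<^sub>R F v) ts - 0) < e"
      using True partition_of_degenerate[of 0 ts] seminorm_0[OF frechet_seminorm[OF p], of n] by simp
  qed simp
  then show ?thesis by (rule that)
next
  case False
  then have "0 < t" using t by simp
  have sp: "seminorm (p n)" for n by (rule frechet_seminorm[OF p])
  let ?S = "psum (\<lambda>v w. (w - v) *\<^sub>R F v)"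
  have ev: "\<forall>\<^sub>F n in sequentially. partition_of 0 t (bisect n 0 t) \<and> finer \<delta> (bisect n 0 t)" if "\<delta> > 0" for \<delta>
  proof (rule eventually_compose_filterlim[OF _ filterlim_bisect[OF \<open>0 < t\<close>]])
    show "\<forall>\<^sub>F ts in meshes 0 t. partition_of 0 t ts \<and> finer \<delta> ts"
      unfolding eventually_meshes using that by (intro exI[of _ \<delta>]) simp
  qed
  have "\<forall>n. \<forall>e>0. \<exists>N. \<forall>i\<ge>N. \<forall>j\<ge>N. p n (?S (bisect i 0 t) - ?S (bisect j 0 t)) < e"
  proof (intro allI impI)
    fix n and e :: real assume "e > 0"
    obtain \<delta> where \<delta>: "\<delta> > 0" "\<forall>ts us. partition_of 0 t ts \<and> finer \<delta> ts \<and> partition_of 0 t us \<and>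
        finer \<delta> us \<longrightarrow> p n (?S ts - ?S us) < e"
      using riemann_sums_close[of p, OF sp cont_seminorm_sn[of p n, OF sp] F order_refl t \<open>e > 0\<close>] by blast
    show "\<exists>N. \<forall>i\<ge>N. \<forall>j\<ge>N. p n (?S (bisect i 0 t) - ?S (bisect j 0 t)) < e"
      using ev[OF \<delta>(1)] \<delta>(2) unfolding eventually_sequentially by meson
  qed
  moreover have "\<forall>X :: nat \<Rightarrow> 'a. (\<forall>n. \<forall>e>0. \<exists>N. \<forall>i\<ge>N. \<forall>j\<ge>N. p n (X i - X j) < e) \<longrightarrow>
        (\<exists>x. \<forall>n. (\<lambda>i. p n (X i - x)) \<longlonglongrightarrow> 0)"
    using p unfolding frechet_space_def by blast
  ultimately obtain I where I: "\<And>n. (\<lambda>i. p n (?S (bisect i 0 t) - I)) \<longlonglongrightarrow> 0"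
    by meson
  have "lim_q (p n) (\<lambda>v w. (w - v) *\<^sub>R F v) 0 t I" for n
    unfolding lim_q_iff[OF sp]
  proof (intro allI impI)
    fix e :: real assume "e > 0"
    then have e: "e / 2 > 0" by simp
    obtain \<delta> where \<delta>: "\<delta> > 0" "\<forall>ts us. partition_of 0 t ts \<and> finer \<delta> ts \<and> partition_of 0 t us \<and>
        finer \<delta> us \<longrightarrow> p n (?S ts - ?S us) < e / 2"
      using riemann_sums_close[of p, OF sp cont_seminorm_sn[of p n, OF sp] F order_refl t e] by blast
    obtain i where i: "partition_of 0 t (bisect i 0 t)" "finer \<delta> (bisect i 0 t)" "p n (?S (bisect i 0 t) - I) < e / 2"
      using eventually_happens'[OF sequentially_bot eventually_conj[OF ev[OF \<delta>(1)] order_tendstoD(2)[OF I e, of n]]]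
      by blast
    have "p n (?S ts - I) < e" if "partition_of 0 t ts" "finer \<delta> ts" for ts
      using \<delta>(2)[rule_format, of ts "bisect i 0 t"] that i(1,2) i(3) seminorm_diff_triangle[OF sp, of n "?S ts" I "?S (bisect i 0 t)"] by simp
    then show "\<exists>\<delta>>0. \<forall>ts. partition_of 0 t ts \<longrightarrow> finer \<delta> ts \<longrightarrow> p n (?S ts - I) < e"
      using \<delta>(1) by blast
  qed
  then show ?thesis
    using that unfolding has_dt_integral_def has_mesh_limit_iff_lim_q[of p, OF sp] by blast
qed

lemma dt_integral_bound:
  assumes q: "seminorm q" and "s < t" and lim: "lim_q q (\<lambda>v w. (w - v) *\<^sub>R F v) s t I"
    and osc: "\<And>r. s \<le> r \<Longrightarrow> r \<le> t \<Longrightarrow> q (F r - c) \<le> e"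
  shows "q (I - (t - s) *\<^sub>R c) \<le> e * (t - s)"
proof (rule lim_q_le[OF q _ lim])
  fix ts assume ts: "partition_of s t ts"
  have "(t - s) *\<^sub>R c = psum (\<lambda>v w. w *\<^sub>R c - v *\<^sub>R c) ts"
    unfolding psum_telescope_partition[OF ts, of "\<lambda>v. v *\<^sub>R c"] by (simp add: algebra_simps)
  then have eq: "psum (\<lambda>v w. (w - v) *\<^sub>R F v) ts - (t - s) *\<^sub>R c = psum (\<lambda>v w. (w - v) *\<^sub>R (F v - c)) ts"
    by (simp add: algebra_simps flip: psum_diff)
  show "q (psum (\<lambda>v w. (w - v) *\<^sub>R F v) ts - (t - s) *\<^sub>R c) \<le> e * (t - s)"
    unfolding eq
  proof (rule psum_bound[OF q ts, of "t - s + 1"])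
    fix v w assume "s \<le> v" "v < w" "w \<le> t"
    then show "q ((w - v) *\<^sub>R (F v - c)) \<le> e * (w - v)"
      using osc[of v] by (simp add: seminorm_scale[OF q] mult.commute)
  qed (use partition_finer[OF ts] in simp)
qed (use \<open>s < t\<close> in simp)

lemma frechet_space_real_sn: "frechet_space real_sn"
  unfolding frechet_space_def
proof (intro conjI allI impI)
  fix X :: "nat \<Rightarrow> real"
  assume "\<forall>n. \<forall>e>0. \<exists>N. \<forall>i\<ge>N. \<forall>j\<ge>N. real_sn n (X i - X j) < e"
  then have "Cauchy X" by (auto simp: Cauchy_def real_sn_def dist_real_def)
  then obtain x where "X \<longlonglongrightarrow> x" using Cauchy_convergent convergent_def by blast
  then have "(\<lambda>i. real_sn n (X i - x)) \<longlonglongrightarrow> 0" for n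
    unfolding real_sn_def by (simp add: tendsto_rabs_zero_iff LIM_zero)
  then show "\<exists>x. \<forall>n. (\<lambda>i. real_sn n (X i - x)) \<longlonglongrightarrow> 0" by blast
qed (auto simp: seminorm_real_sn real_sn_def)

lemma cont_path_real:
  assumes F: "continuous_on {0..T} F"
  shows "cont_path real_sn T F"
  unfolding cont_path_def continuous_map_ftop_iff[of real_sn, OF seminorm_real_sn]
proof (intro ballI allI impI)
  fix x n and e :: real
  assume x: "x \<in> topspace (top_of_set {0..T})" and e: "0 < e"
  then obtain d where "d > 0" "\<And>y. y \<in> {0..T} \<Longrightarrow> dist y x < d \<Longrightarrow> dist (F y) (F x) < e"
    using F unfolding continuous_on_iff by (metis topspace_euclidean_subtopology)
  then show "\<exists>U. openin (top_of_set {0..T}) U \<and> x \<in> U \<and> (\<forall>y\<in>U. real_sn n (F y - F x) < e)"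
    using x by (intro exI[of _ "{0..T} \<inter> ball x d"])
      (auto simp: openin_open_Int real_sn_def dist_real_def abs_minus_commute)
qed

section \<open>Orders of magnitude of increments\<close>

text \<open>Functions of two times are compared with powers of the length of the interval: \<open>inc_O T \<beta>\<close> means
  \<open>O((t - s)\<^sup>\<beta>)\<close> on all intervals, \<open>inc_o T\<close> means \<open>o(t - s)\<close> uniformly on short ones. The first is the form of Hoelder
  conditions, the second is what makes sums over partitions vanish.\<close>

definition inc_O :: "real \<Rightarrow> real \<Rightarrow> (real \<Rightarrow> real \<Rightarrow> real) \<Rightarrow> bool" where
  "inc_O T \<beta> r \<longleftrightarrow> (\<exists>C\<ge>0. \<forall>s t. 0 \<le> s \<and> s < t \<and> t \<le> T \<longrightarrow> \<bar>r s t\<bar> \<le> C * (t - s) powr \<beta>)"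

definition inc_o :: "real \<Rightarrow> (real \<Rightarrow> real \<Rightarrow> real) \<Rightarrow> bool" where
  "inc_o T r \<longleftrightarrow> (\<forall>e>0. \<exists>\<delta>>0. \<forall>s t. 0 \<le> s \<and> s < t \<and> t \<le> T \<and> t - s < \<delta> \<longrightarrow> \<bar>r s t\<bar> \<le> e * (t - s))"

lemma inc_O_I:
  assumes "\<And>s t. 0 \<le> s \<Longrightarrow> s < t \<Longrightarrow> t \<le> T \<Longrightarrow> \<bar>r s t\<bar> \<le> C * (t - s) powr \<beta>"
  shows "inc_O T \<beta> r"
  unfolding inc_O_def
proof (intro exI[of _ "max 0 C"] conjI allI impI)
  fix s t assume "0 \<le> s \<and> s < t \<and> t \<le> T"
  then show "\<bar>r s t\<bar> \<le> max 0 C * (t - s) powr \<beta>"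
    using assms[of s t] mult_right_mono[of C "max 0 C" "(t - s) powr \<beta>", OF max.cobounded2 powr_ge_zero] by linarith
qed simp

lemma inc_O_choice:
  assumes "\<And>k. inc_O T \<beta> (r k)"
  shows "\<exists>C. (\<forall>k. 0 \<le> C k) \<and> (\<forall>k s t. 0 \<le> s \<and> s < t \<and> t \<le> T \<longrightarrow> \<bar>r k s t\<bar> \<le> C k * (t - s) powr \<beta>)"
proof -
  have "\<forall>k. \<exists>C\<ge>0. \<forall>s t. 0 \<le> s \<and> s < t \<and> t \<le> T \<longrightarrow> \<bar>r k s t\<bar> \<le> C * (t - s) powr \<beta>"
    using assms unfolding inc_O_def by blast
  then show ?thesis by metis
qed

lemma inc_O_le:
  assumes "inc_O T \<beta> r" "\<And>s t. 0 \<le> s \<Longrightarrow> s < t \<Longrightarrow> t \<le> T \<Longrightarrow> \<bar>r' s t\<bar> \<le> K * \<bar>r s t\<bar>"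
  shows "inc_O T \<beta> r'"
proof -
  obtain C where C: "0 \<le> C" "\<And>s t. 0 \<le> s \<Longrightarrow> s < t \<Longrightarrow> t \<le> T \<Longrightarrow> \<bar>r s t\<bar> \<le> C * (t - s) powr \<beta>"
    using assms(1) unfolding inc_O_def by blast
  show ?thesis
  proof (rule inc_O_I)
    fix s t assume st: "0 \<le> s" "s < t" "t \<le> T"
    have "\<bar>r' s t\<bar> \<le> \<bar>K\<bar> * \<bar>r s t\<bar>"
      using assms(2)[OF st] mult_right_mono[of K "\<bar>K\<bar>" "\<bar>r s t\<bar>", OF abs_ge_self abs_ge_zero] by linarith
    also have "\<dots> \<le> \<bar>K\<bar> * (C * (t - s) powr \<beta>)" using C(2)[OF st] by (intro mult_left_mono) auto
    finally show "\<bar>r' s t\<bar> \<le> (\<bar>K\<bar> * C) * (t - s) powr \<beta>" by (simp add: mult.assoc)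
  qed
qed

lemma inc_O_add:
  assumes "inc_O T \<beta> r" "inc_O T \<beta> r'" shows "inc_O T \<beta> (\<lambda>s t. r s t + r' s t)"
proof -
  obtain C where C: "0 \<le> C" "\<And>s t. 0 \<le> s \<Longrightarrow> s < t \<Longrightarrow> t \<le> T \<Longrightarrow> \<bar>r s t\<bar> \<le> C * (t - s) powr \<beta>"
    using assms(1) unfolding inc_O_def by blast
  obtain D where D: "0 \<le> D" "\<And>s t. 0 \<le> s \<Longrightarrow> s < t \<Longrightarrow> t \<le> T \<Longrightarrow> \<bar>r' s t\<bar> \<le> D * (t - s) powr \<beta>"
    using assms(2) unfolding inc_O_def by blast
  show ?thesis
    by (rule inc_O_I[where C = "C + D"]) (use C(2) D(2) in \<open>fastforce simp: distrib_right intro: order_trans[OF abs_triangle_ineq]\<close>)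
qed

lemma inc_O_sum:
  assumes "\<And>k. k \<in> K \<Longrightarrow> inc_O T \<beta> (r k)" shows "inc_O T \<beta> (\<lambda>s t. \<Sum>k\<in>K. r k s t)"
  using assms
proof (induction K rule: infinite_finite_induct)
  case (insert k K)
  then show ?case by (simp add: inc_O_add)
qed (auto intro!: inc_O_I[where C = 0])

lemma inc_O_mult:
  assumes "inc_O T \<beta> r" "inc_O T \<gamma> r'" shows "inc_O T (\<beta> + \<gamma>) (\<lambda>s t. r s t * r' s t)"
proof -
  obtain C where C: "0 \<le> C" "\<And>s t. 0 \<le> s \<Longrightarrow> s < t \<Longrightarrow> t \<le> T \<Longrightarrow> \<bar>r s t\<bar> \<le> C * (t - s) powr \<beta>"
    using assms(1) unfolding inc_O_def by blast
  obtain D where D: "0 \<le> D" "\<And>s t. 0 \<le> s \<Longrightarrow> s < t \<Longrightarrow> t \<le> T \<Longrightarrow> \<bar>r' s t\<bar> \<le> D * (t - s) powr \<gamma>"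
    using assms(2) unfolding inc_O_def by blast
  show ?thesis
  proof (rule inc_O_I)
    fix s t assume st: "0 \<le> s" "s < t" "t \<le> T"
    have "\<bar>r s t * r' s t\<bar> \<le> (C * (t - s) powr \<beta>) * (D * (t - s) powr \<gamma>)"
      unfolding abs_mult using C D st by (intro mult_mono) auto
    then show "\<bar>r s t * r' s t\<bar> \<le> (C * D) * (t - s) powr (\<beta> + \<gamma>)"
      by (simp add: powr_add mult_ac)
  qed
qed

lemma inc_O_mono:
  assumes "inc_O T \<beta> r" "\<gamma> \<le> \<beta>" shows "inc_O T \<gamma> r"
proof -
  obtain C where C: "0 \<le> C" "\<And>s t. 0 \<le> s \<Longrightarrow> s < t \<Longrightarrow> t \<le> T \<Longrightarrow> \<bar>r s t\<bar> \<le> C * (t - s) powr \<beta>"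
    using assms(1) unfolding inc_O_def by blast
  show ?thesis
  proof (rule inc_O_I)
    fix s t assume st: "0 \<le> s" "s < t" "t \<le> T"
    have "(t - s) powr \<beta> = (t - s) powr (\<beta> - \<gamma>) * (t - s) powr \<gamma>" by (simp flip: powr_add)
    also have "\<dots> \<le> T powr (\<beta> - \<gamma>) * (t - s) powr \<gamma>"
      using st assms(2) by (intro mult_right_mono powr_mono2) auto
    finally show "\<bar>r s t\<bar> \<le> (C * T powr (\<beta> - \<gamma>)) * (t - s) powr \<gamma>"
      using C(2)[OF st] mult_left_mono[OF _ C(1)] by (fastforce simp: mult.assoc)
  qed
qed

lemma inc_O_bounded:
  assumes "\<And>s t. 0 \<le> s \<Longrightarrow> s < t \<Longrightarrow> t \<le> T \<Longrightarrow> \<bar>r s t\<bar> \<le> B" shows "inc_O T 0 r"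
  by (rule inc_O_I[where C = B]) (use assms in auto)

lemma inc_O_imp_o:
  assumes "inc_O T \<beta> r" "1 < \<beta>" shows "inc_o T r"
  unfolding inc_o_def
proof (intro allI impI)
  obtain C where C: "0 \<le> C" "\<And>s t. 0 \<le> s \<Longrightarrow> s < t \<Longrightarrow> t \<le> T \<Longrightarrow> \<bar>r s t\<bar> \<le> C * (t - s) powr \<beta>"
    using assms(1) unfolding inc_O_def by blast
  fix e :: real assume e: "e > 0"
  have "((\<lambda>x. C * x powr (\<beta> - 1)) \<longlongrightarrow> C * 0 powr (\<beta> - 1)) (at_right 0)"
    using assms(2) by (intro tendsto_intros tendsto_powr'[OF tendsto_ident_at]) (auto simp: eventually_at intro: exI[of _ 1])
  then have "\<forall>\<^sub>F x in at_right 0. C * x powr (\<beta> - 1) < e"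
    using e assms(2) by (intro order_tendstoD) auto
  then obtain \<delta> where \<delta>: "\<delta> > 0" "\<And>x. 0 < x \<Longrightarrow> x < \<delta> \<Longrightarrow> C * x powr (\<beta> - 1) < e"
    unfolding eventually_at_right_field by auto
  have "\<bar>r s t\<bar> \<le> e * (t - s)" if st: "0 \<le> s" "s < t" "t \<le> T" "t - s < \<delta>" for s t
  proof -
    have "\<bar>r s t\<bar> \<le> C * (t - s) powr (\<beta> - 1) * (t - s)"
      using C(2)[OF st(1-3)] st(2) by (simp add: powr_diff)
    also have "\<dots> \<le> e * (t - s)"
      using \<delta>(2)[of "t - s"] st by (intro mult_right_mono) auto
    finally show ?thesis .
  qed
  then show "\<exists>\<delta>>0. \<forall>s t. 0 \<le> s \<and> s < t \<and> t \<le> T \<and> t - s < \<delta> \<longrightarrow> \<bar>r s t\<bar> \<le> e * (t - s)"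
    using \<delta>(1) by blast
qed

lemma inc_o_add:
  assumes "inc_o T r" "inc_o T r'" shows "inc_o T (\<lambda>s t. r s t + r' s t)"
  unfolding inc_o_def
proof (intro allI impI)
  fix e :: real assume "e > 0"
  then have e: "e / 2 > 0" by simp
  obtain a where a: "a > 0" "\<And>s t. 0 \<le> s \<and> s < t \<and> t \<le> T \<and> t - s < a \<Longrightarrow> \<bar>r s t\<bar> \<le> e / 2 * (t - s)"
    using assms(1) e unfolding inc_o_def by meson
  obtain b where b: "b > 0" "\<And>s t. 0 \<le> s \<and> s < t \<and> t \<le> T \<and> t - s < b \<Longrightarrow> \<bar>r' s t\<bar> \<le> e / 2 * (t - s)"
    using assms(2) e unfolding inc_o_def by meson
  have "\<bar>r s t + r' s t\<bar> \<le> e * (t - s)" if "0 \<le> s \<and> s < t \<and> t \<le> T \<and> t - s < min a b" for s t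
    using a(2)[of s t] b(2)[of s t] that by (simp add: field_simps)
  then show "\<exists>\<delta>>0. \<forall>s t. 0 \<le> s \<and> s < t \<and> t \<le> T \<and> t - s < \<delta> \<longrightarrow> \<bar>r s t + r' s t\<bar> \<le> e * (t - s)"
    using a(1) b(1) by (intro exI[of _ "min a b"]) auto
qed

lemma inc_o_le:
  assumes "inc_o T r" "0 \<le> K" "\<And>s t. 0 \<le> s \<Longrightarrow> s < t \<Longrightarrow> t \<le> T \<Longrightarrow> \<bar>r' s t\<bar> \<le> K * \<bar>r s t\<bar>"
  shows "inc_o T r'"
  unfolding inc_o_def
proof (intro allI impI)
  fix e :: real assume "e > 0"
  then have e: "e / (K + 1) > 0" using assms(2) by simp
  obtain a where a: "a > 0" "\<And>s t. 0 \<le> s \<and> s < t \<and> t \<le> T \<and> t - s < a \<Longrightarrow> \<bar>r s t\<bar> \<le> e / (K + 1) * (t - s)"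
    using assms(1) e unfolding inc_o_def by meson
  have "\<bar>r' s t\<bar> \<le> e * (t - s)" if st: "0 \<le> s \<and> s < t \<and> t \<le> T \<and> t - s < a" for s t
  proof -
    have "\<bar>r' s t\<bar> \<le> (K + 1) * \<bar>r s t\<bar>" using assms(3)[of s t] st by (simp add: distrib_right)
    also have "\<dots> \<le> (K + 1) * (e / (K + 1) * (t - s))"
      using a(2)[OF st] assms(2) by (intro mult_left_mono) auto
    finally show ?thesis using assms(2) by simp
  qed
  then show "\<exists>\<delta>>0. \<forall>s t. 0 \<le> s \<and> s < t \<and> t \<le> T \<and> t - s < \<delta> \<longrightarrow> \<bar>r' s t\<bar> \<le> e * (t - s)"
    using a(1) by blast
qed

lemma inc_O_holder2:
  assumes "\<And>n. seminorm (p n)" "holder2 p T \<beta> \<Xi>"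
  shows "inc_O T \<beta> (\<lambda>s t. \<Sum>i\<le>(N::nat). p i (\<Xi> s t))"
proof -
  obtain C where "\<And>s t. 0 \<le> s \<Longrightarrow> s < t \<Longrightarrow> t \<le> T \<Longrightarrow> (\<Sum>i\<le>N. p i (\<Xi> s t)) \<le> C * (t - s) powr \<beta>"
    using assms(2) cont_seminorm_finite_sum[of p N, OF assms(1)] unfolding holder2_def by meson
  then show ?thesis
    by (intro inc_O_I[of _ _ C]) (simp add: abs_of_nonneg sum_nonneg seminorm_nonneg[OF assms(1)])
qed

lemma holder2_real_inc_O: "inc_O T \<beta> r \<Longrightarrow> holder2 real_sn T \<beta> r"
  unfolding inc_O_def by (blast intro: holder2_real)

section \<open>Geometric rough paths\<close>

lemma lipschitz_lift_limit:
  assumes "lipschitz_lift T W WW" "0 \<le> s" "s \<le> t" "t \<le> T"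
  shows "((psum (\<lambda>v w. (W v - W s) $ l * (W w - W v) $ k)) \<longlongrightarrow> WW s t $ l $ k) (meshes s t)"
  using assms unfolding lipschitz_lift_def has_mesh_limit_real by blast

lemma lipschitz_lift_bound:
  assumes W: "lipschitz_lift T W WW"
  obtains C where "0 \<le> C" "\<And>s t k. 0 \<le> s \<Longrightarrow> s \<le> t \<Longrightarrow> t \<le> T \<Longrightarrow> \<bar>(W t - W s) $ k\<bar> \<le> C * (t - s)"
    "\<And>s t l k. 0 \<le> s \<Longrightarrow> s < t \<Longrightarrow> t \<le> T \<Longrightarrow> \<bar>WW s t $ l $ k\<bar> \<le> C\<^sup>2 * (t - s)\<^sup>2"
proof -
  obtain C where L: "C-lipschitz_on {0..T} W" using W unfolding lipschitz_lift_def by blast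
  have C: "0 \<le> C" using L by (rule lipschitz_on_nonneg)
  have d: "\<bar>(W t - W s) $ k\<bar> \<le> C * (t - s)" if "0 \<le> s" "s \<le> t" "t \<le> T" for s t k
    using lipschitz_onD[OF L, of t s] component_le_norm_cart[of "W t - W s" k] that
    by (simp add: dist_norm)
  have "\<bar>WW s t $ l $ k\<bar> \<le> C\<^sup>2 * (t - s)\<^sup>2" if st: "0 \<le> s" "s < t" "t \<le> T" for s t l k
  proof -
    let ?\<Xi> = "\<lambda>v w. (W v - W s) $ l * (W w - W v) $ k"
    have "lim_q (real_sn 0) ?\<Xi> s t (WW s t $ l $ k)"
      using lipschitz_lift_limit[OF W, of s t l k] st unfolding lim_q_real by simp
    then have "real_sn 0 (WW s t $ l $ k - 0) \<le> C\<^sup>2 * (t - s) * (t - s)"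
    proof (rule lim_q_le[OF seminorm_real_sn less_imp_le[OF st(2)]])
      fix ts assume ts: "partition_of s t ts"
      show "real_sn 0 (psum ?\<Xi> ts - 0) \<le> C\<^sup>2 * (t - s) * (t - s)"
        unfolding diff_0_right
      proof (rule psum_bound[OF seminorm_real_sn ts partition_finer[OF ts, of "t - s + 1"]])
        fix v w assume vw: "s \<le> v" "v < w" "w \<le> t"
        have "\<bar>?\<Xi> v w\<bar> \<le> (C * (t - s)) * (C * (w - v))"
          unfolding abs_mult
        proof (rule mult_mono)
          show "\<bar>(W v - W s) $ l\<bar> \<le> C * (t - s)"
            using d[of s v l] vw st C mult_left_mono[of "v - s" "t - s" C] by simp
        qed (use d[of v w k] vw st C in auto)
        then show "real_sn 0 (?\<Xi> v w) \<le> C\<^sup>2 * (t - s) * (w - v)"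
          by (simp add: real_sn_def power2_eq_square mult_ac)
      qed simp
    qed
    then show ?thesis by (simp add: real_sn_def power2_eq_square mult_ac)
  qed
  then show thesis using that C d by blast
qed

text \<open>Moving the base point of the germ from \<open>s\<close> to \<open>u\<close> changes it by a multiple of the increment of \<open>W\<close>,
  which telescopes.\<close>

lemma lipschitz_lift_chen:
  assumes W: "lipschitz_lift T W WW" and "0 \<le> s" "s \<le> u" "u \<le> t" "t \<le> T"
  shows "WW s t $ l $ k = WW s u $ l $ k + WW u t $ l $ k + (W u - W s) $ l * (W t - W u) $ k"
proof -
  let ?\<Xi> = "\<lambda>a v w. (W v - W a) $ l * (W w - W v) $ k"
  have "(psum (?\<Xi> s) \<longlongrightarrow> WW s t $ l $ k - WW s u $ l $ k) (meshes u t)"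
    using lipschitz_lift_limit[OF W, of s u l k] lipschitz_lift_limit[OF W, of s t l k] assms
    unfolding lim_q_real[of 0, symmetric] by (intro lim_q_subinterval[OF seminorm_real_sn, of s u]) auto
  moreover have "(psum (?\<Xi> s) \<longlongrightarrow> WW u t $ l $ k + (W u - W s) $ l * (W t - W u) $ k) (meshes u t)"
  proof (rule Lim_transform_eventually)
    show "((\<lambda>ts. psum (?\<Xi> u) ts + (W u - W s) $ l * (W t - W u) $ k)
        \<longlongrightarrow> WW u t $ l $ k + (W u - W s) $ l * (W t - W u) $ k) (meshes u t)"
      using lipschitz_lift_limit[OF W, of u t l k] assms by (intro tendsto_add tendsto_const) auto
    show "\<forall>\<^sub>F ts in meshes u t. psum (?\<Xi> u) ts + (W u - W s) $ l * (W t - W u) $ k = psum (?\<Xi> s) ts"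
      using eventually_meshes_partition[of u t]
    proof eventually_elim
      case (elim ts)
      have "psum (?\<Xi> s) ts = psum (\<lambda>v w. ?\<Xi> u v w + ((W u - W s) $ l * W w $ k - (W u - W s) $ l * W v $ k)) ts"
        by (simp add: algebra_simps)
      then show ?case
        using psum_telescope_partition[OF elim, of "\<lambda>v. (W u - W s) $ l * W v $ k"]
        by (simp add: psum_add right_diff_distrib)
    qed
  qed
  ultimately show ?thesis
    using tendsto_unique[OF meshes_neq_bot[OF \<open>u \<le> t\<close>]] by fastforce
qed

text \<open>Summation by parts: the two iterated sums differ from the product of the increments by the
  quadratic variation sum, which vanishes for a Lipschitz path.\<close>

lemma lipschitz_lift_shuffle:
  assumes W: "lipschitz_lift T W WW" and st: "0 \<le> s" "s \<le> t" "t \<le> T"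
  shows "WW s t $ l $ k + WW s t $ k $ l = (W t - W s) $ l * (W t - W s) $ k"
proof -
  obtain C where C: "0 \<le> C" "\<And>s t k. 0 \<le> s \<Longrightarrow> s \<le> t \<Longrightarrow> t \<le> T \<Longrightarrow> \<bar>(W t - W s) $ k\<bar> \<le> C * (t - s)"
    using lipschitz_lift_bound[OF W] by metis
  let ?Q = "\<lambda>v w. (W w - W v) $ l * (W w - W v) $ k"
  let ?\<Xi> = "\<lambda>l k v w. (W v - W s) $ l * (W w - W v) $ k"
  have "lim_q (real_sn 0) ?Q s t 0"
    unfolding lim_q_iff[OF seminorm_real_sn]
  proof (intro allI impI)
    fix e :: real assume e: "e > 0"
    define \<delta> where "\<delta> = e / (C\<^sup>2 * (t - s) + 1)"
    have pos: "C\<^sup>2 * (t - s) + 1 > 0" using st by (simp add: add_nonneg_pos)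
    then have \<delta>: "\<delta> > 0" using e by (simp add: \<delta>_def)
    have "real_sn 0 (psum ?Q ts - 0) < e" if ts: "partition_of s t ts" "finer \<delta> ts" for ts
    proof -
      have "real_sn 0 (psum ?Q ts) \<le> (C\<^sup>2 * \<delta>) * (t - s)"
      proof (rule psum_bound[OF seminorm_real_sn ts])
        fix v w assume vw: "s \<le> v" "v < w" "w \<le> t" "w - v < \<delta>"
        have "\<bar>?Q v w\<bar> \<le> (C * \<delta>) * (C * (w - v))"
          unfolding abs_mult
        proof (rule mult_mono)
          show "\<bar>(W w - W v) $ l\<bar> \<le> C * \<delta>"
            using C(2)[of v w l] vw st C(1) mult_left_mono[of "w - v" \<delta> C] by simp
        qed (use C(2)[of v w k] vw st C(1) \<delta> in auto)
        then show "real_sn 0 (?Q v w) \<le> C\<^sup>2 * \<delta> * (w - v)"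
          by (simp add: real_sn_def power2_eq_square mult_ac)
      qed
      also have "\<dots> < \<delta> * (C\<^sup>2 * (t - s) + 1)" using \<delta> by (simp add: algebra_simps)
      also have "\<dots> = e" using pos by (simp add: \<delta>_def)
      finally show ?thesis by simp
    qed
    then show "\<exists>\<delta>>0. \<forall>ts. partition_of s t ts \<longrightarrow> finer \<delta> ts \<longrightarrow> real_sn 0 (psum ?Q ts - 0) < e"
      using \<delta> by blast
  qed
  then have "(psum ?Q \<longlongrightarrow> 0) (meshes s t)" unfolding lim_q_real .
  then have "((\<lambda>ts. psum (?\<Xi> l k) ts + psum (?\<Xi> k l) ts + psum ?Q ts)
      \<longlongrightarrow> WW s t $ l $ k + WW s t $ k $ l + 0) (meshes s t)"
    using lipschitz_lift_limit[OF W st] by (intro tendsto_add)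
  moreover have "((\<lambda>ts. psum (?\<Xi> l k) ts + psum (?\<Xi> k l) ts + psum ?Q ts)
      \<longlongrightarrow> (W t - W s) $ l * (W t - W s) $ k) (meshes s t)"
  proof (rule Lim_transform_eventually[OF tendsto_const])
    show "\<forall>\<^sub>F ts in meshes s t. (W t - W s) $ l * (W t - W s) $ k
        = psum (?\<Xi> l k) ts + psum (?\<Xi> k l) ts + psum ?Q ts"
      using eventually_meshes_partition[of s t]
    proof eventually_elim
      case (elim ts)
      have "psum (?\<Xi> l k) ts + psum (?\<Xi> k l) ts + psum ?Q ts
          = psum (\<lambda>v w. (W w - W s) $ l * (W w - W s) $ k - (W v - W s) $ l * (W v - W s) $ k) ts"
        unfolding psum_add[symmetric] by (simp add: algebra_simps)
      then show ?case
        using psum_telescope_partition[OF elim, of "\<lambda>v. (W v - W s) $ l * (W v - W s) $ k"] by simp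
    qed
  qed
  ultimately show ?thesis
    using tendsto_unique[OF meshes_neq_bot[OF st(2)]] by fastforce
qed

lemma geometric_approximation:
  assumes "geometric_rough_path \<alpha> T Z ZZ" "\<alpha> \<le> 1/2"
  obtains W WW where "\<And>n. lipschitz_lift T (W n) (WW n)"
    "\<And>s t. 0 \<le> s \<Longrightarrow> s < t \<Longrightarrow> t \<le> T \<Longrightarrow> (\<lambda>n. W n t - W n s) \<longlonglongrightarrow> Z t - Z s"
    "\<And>s t. 0 \<le> s \<Longrightarrow> s < t \<Longrightarrow> t \<le> T \<Longrightarrow> (\<lambda>n. WW n s t) \<longlonglongrightarrow> ZZ s t"
proof -
  have "\<forall>n::nat. \<exists>W WW. lipschitz_lift T W WW \<and>
             (\<forall>s t. 0 \<le> s \<and> s < t \<and> t \<le> T \<longrightarrow>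
                norm ((Z t - Z s) - (W t - W s)) \<le> 1 / real (Suc n) * (t - s) powr \<alpha> \<and>
                norm (ZZ s t - WW s t) \<le> 1 / real (Suc n) * (t - s) powr (2 * \<alpha>))" (is "\<forall>n. ?P n")
  proof
    fix n :: nat
    show "?P n"
      using assms(1)[unfolded geometric_rough_path_def if_P[OF assms(2)], rule_format, of "1 / real (Suc n)"]
      by simp
  qed
  then obtain W WW where W: "\<And>n. lipschitz_lift T (W n) (WW n)"
    "\<And>n s t. 0 \<le> s \<and> s < t \<and> t \<le> T \<Longrightarrow>
       norm ((Z t - Z s) - (W n t - W n s)) \<le> 1 / real (Suc n) * (t - s) powr \<alpha> \<and>
       norm (ZZ s t - WW n s t) \<le> 1 / real (Suc n) * (t - s) powr (2 * \<alpha>)"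
    by metis
  have lim: "X \<longlonglongrightarrow> x" if "\<And>n. norm (x - X n) \<le> 1 / real (Suc n) * c" for X :: "nat \<Rightarrow> 'z::real_normed_vector" and x c
  proof (rule LIM_zero_cancel, rule Lim_null_comparison)
    show "\<forall>\<^sub>F n in sequentially. norm (X n - x) \<le> 1 / real (Suc n) * c"
      using that by (simp add: norm_minus_commute)
    show "(\<lambda>n. 1 / real (Suc n) * c) \<longlonglongrightarrow> 0"
      using tendsto_mult_left_zero[OF LIMSEQ_Suc[OF lim_1_over_n]] by simp
  qed
  show thesis
  proof (rule that[OF W(1)])
    fix s t assume st: "0 \<le> s" "s < t" "t \<le> T"
    show "(\<lambda>n. W n t - W n s) \<longlonglongrightarrow> Z t - Z s"
      by (rule lim[of _ _ "(t - s) powr \<alpha>"]) (use W(2)[of s t] st in blast)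
    show "(\<lambda>n. WW n s t) \<longlonglongrightarrow> ZZ s t"
      by (rule lim[of _ _ "(t - s) powr (2 * \<alpha>)"]) (use W(2)[of s t] st in blast)
  qed
qed

lemma geometric_chen:
  assumes Z: "geometric_rough_path \<alpha> T Z ZZ" "\<alpha> \<le> 1/2" and "0 \<le> s" "s < u" "u < t" "t \<le> T"
  shows "ZZ s t $ l $ k = ZZ s u $ l $ k + ZZ u t $ l $ k + (Z u - Z s) $ l * (Z t - Z u) $ k"
proof -
  obtain W WW where W: "\<And>n. lipschitz_lift T (W n) (WW n)"
    "\<And>s t. 0 \<le> s \<Longrightarrow> s < t \<Longrightarrow> t \<le> T \<Longrightarrow> (\<lambda>n. W n t - W n s) \<longlonglongrightarrow> Z t - Z s"
    "\<And>s t. 0 \<le> s \<Longrightarrow> s < t \<Longrightarrow> t \<le> T \<Longrightarrow> (\<lambda>n. WW n s t) \<longlonglongrightarrow> ZZ s t"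
    using geometric_approximation[OF Z] by blast
  have "(\<lambda>n. WW n s u $ l $ k + WW n u t $ l $ k + (W n u - W n s) $ l * (W n t - W n u) $ k)
      \<longlonglongrightarrow> ZZ s u $ l $ k + ZZ u t $ l $ k + (Z u - Z s) $ l * (Z t - Z u) $ k"
    using assms W by (intro tendsto_add tendsto_mult tendsto_vec_nth) auto
  moreover have "(\<lambda>n. WW n s u $ l $ k + WW n u t $ l $ k + (W n u - W n s) $ l * (W n t - W n u) $ k)
      = (\<lambda>n. WW n s t $ l $ k)"
    using lipschitz_lift_chen[OF W(1), of s u t] assms by auto
  moreover have "(\<lambda>n. WW n s t $ l $ k) \<longlonglongrightarrow> ZZ s t $ l $ k"
    using assms W by (intro tendsto_add tendsto_mult tendsto_vec_nth) auto
  ultimately show ?thesis by (simp add: LIMSEQ_unique)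
qed

lemma geometric_shuffle:
  assumes Z: "geometric_rough_path \<alpha> T Z ZZ" "\<alpha> \<le> 1/2" and "0 \<le> s" "s < t" "t \<le> T"
  shows "ZZ s t $ l $ k + ZZ s t $ k $ l = (Z t - Z s) $ l * (Z t - Z s) $ k"
proof -
  obtain W WW where W: "\<And>n. lipschitz_lift T (W n) (WW n)"
    "\<And>s t. 0 \<le> s \<Longrightarrow> s < t \<Longrightarrow> t \<le> T \<Longrightarrow> (\<lambda>n. W n t - W n s) \<longlonglongrightarrow> Z t - Z s"
    "\<And>s t. 0 \<le> s \<Longrightarrow> s < t \<Longrightarrow> t \<le> T \<Longrightarrow> (\<lambda>n. WW n s t) \<longlonglongrightarrow> ZZ s t"
    using geometric_approximation[OF Z] by blast
  have "(\<lambda>n. (W n t - W n s) $ l * (W n t - W n s) $ k) \<longlonglongrightarrow> (Z t - Z s) $ l * (Z t - Z s) $ k"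
    using assms W by (intro tendsto_add tendsto_mult tendsto_vec_nth) auto
  moreover have "(\<lambda>n. (W n t - W n s) $ l * (W n t - W n s) $ k) = (\<lambda>n. WW n s t $ l $ k + WW n s t $ k $ l)"
    using lipschitz_lift_shuffle[OF W(1), of s t] assms by auto
  moreover have "(\<lambda>n. WW n s t $ l $ k + WW n s t $ k $ l) \<longlonglongrightarrow> ZZ s t $ l $ k + ZZ s t $ k $ l"
    using assms W by (intro tendsto_add tendsto_mult tendsto_vec_nth) auto
  ultimately show ?thesis by (simp add: LIMSEQ_unique)
qed

lemma geometric_holder_level1:
  assumes Z: "geometric_rough_path \<alpha> T Z ZZ" and \<alpha>: "\<alpha> \<le> 1"
  shows "inc_O T \<alpha> (\<lambda>s t. (Z t - Z s) $ k)"
proof (cases "\<alpha> \<le> 1/2")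
  case True
  obtain W WW where W: "lipschitz_lift T W WW"
    "\<And>s t. 0 \<le> s \<and> s < t \<and> t \<le> T \<Longrightarrow> norm ((Z t - Z s) - (W t - W s)) \<le> 1 * (t - s) powr \<alpha>"
    using Z True unfolding geometric_rough_path_def by (metis zero_less_one)
  obtain C where C: "\<And>s t k. 0 \<le> s \<Longrightarrow> s \<le> t \<Longrightarrow> t \<le> T \<Longrightarrow> \<bar>(W t - W s) $ k\<bar> \<le> C * (t - s)"
    using lipschitz_lift_bound[OF W(1)] by metis
  have "inc_O T 1 (\<lambda>s t. (W t - W s) $ k)"
    by (rule inc_O_I[of _ _ C]) (use C in auto)
  moreover have "inc_O T \<alpha> (\<lambda>s t. ((Z t - Z s) - (W t - W s)) $ k)"
  proof (rule inc_O_I[of _ _ 1])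
    fix s t assume "0 \<le> s" "s < t" "t \<le> T"
    then show "\<bar>((Z t - Z s) - (W t - W s)) $ k\<bar> \<le> 1 * (t - s) powr \<alpha>"
      using W(2)[of s t] component_le_norm_cart[of "(Z t - Z s) - (W t - W s)" k] by linarith
  qed
  ultimately have "inc_O T \<alpha> (\<lambda>s t. (W t - W s) $ k + ((Z t - Z s) - (W t - W s)) $ k)"
    using \<alpha> by (intro inc_O_add) (auto intro: inc_O_mono)
  then show ?thesis by simp
next
  case False
  then have "holder2 (\<lambda>_. norm) T \<alpha> (\<lambda>s t. Z t - Z s)"
    using Z by (simp add: geometric_rough_path_def holder_def)
  then have "inc_O T \<alpha> (\<lambda>s t. \<Sum>i\<le>(0::nat). norm (Z t - Z s))"
    by (intro inc_O_holder2[where p = "\<lambda>_. norm"]) (auto simp: seminorm_def norm_triangle_ineq)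
  then show ?thesis
    by (rule inc_O_le[where K = 1]) (use component_le_norm_cart[of "_ - _" k] in simp)
qed

lemma geometric_holder_level2:
  assumes Z: "geometric_rough_path \<alpha> T Z ZZ" and \<alpha>: "\<alpha> \<le> 1/2"
  shows "inc_O T (2 * \<alpha>) (\<lambda>s t. ZZ s t $ l $ k)"
proof -
  obtain W WW where W: "lipschitz_lift T W WW"
    "\<And>s t. 0 \<le> s \<and> s < t \<and> t \<le> T \<Longrightarrow> norm (ZZ s t - WW s t) \<le> 1 * (t - s) powr (2 * \<alpha>)"
    using Z \<alpha> unfolding geometric_rough_path_def by (metis zero_less_one)
  obtain C where C: "\<And>s t l k. 0 \<le> s \<Longrightarrow> s < t \<Longrightarrow> t \<le> T \<Longrightarrow> \<bar>WW s t $ l $ k\<bar> \<le> C\<^sup>2 * (t - s)\<^sup>2"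
    using lipschitz_lift_bound[OF W(1)] by metis
  have "inc_O T 2 (\<lambda>s t. WW s t $ l $ k)"
    by (rule inc_O_I[of _ _ "C\<^sup>2"]) (use C in auto)
  moreover have "inc_O T (2 * \<alpha>) (\<lambda>s t. (ZZ s t - WW s t) $ l $ k)"
  proof (rule inc_O_I[of _ _ 1])
    fix s t assume "0 \<le> s" "s < t" "t \<le> T"
    then show "\<bar>(ZZ s t - WW s t) $ l $ k\<bar> \<le> 1 * (t - s) powr (2 * \<alpha>)"
      using W(2)[of s t] component_le_norm_cart[of "(ZZ s t - WW s t) $ l" k]
        Finite_Cartesian_Product.norm_nth_le[of "ZZ s t - WW s t" l] by linarith
  qed
  ultimately have "inc_O T (2 * \<alpha>) (\<lambda>s t. WW s t $ l $ k + (ZZ s t - WW s t) $ l $ k)"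
    using \<alpha> by (intro inc_O_add) (auto intro: inc_O_mono)
  then show ?thesis by simp
qed

section \<open>Local expansion of rough integrals\<close>

definition rough_germ ::
  "real \<Rightarrow> (real \<Rightarrow> real ^ 'k) \<Rightarrow> (real \<Rightarrow> real \<Rightarrow> real ^ 'k ^ 'k) \<Rightarrow>
   ('k \<Rightarrow> real \<Rightarrow> 'e::real_vector) \<Rightarrow> ('k \<Rightarrow> 'k \<Rightarrow> real \<Rightarrow> 'e) \<Rightarrow> real \<Rightarrow> real \<Rightarrow> 'e" where
  "rough_germ \<alpha> Z ZZ Y Y' v w = (\<Sum>k\<in>UNIV. (Z w - Z v) $ k *\<^sub>R Y k v) +
     (if \<alpha> \<le> 1/2 then \<Sum>k\<in>UNIV. \<Sum>l\<in>UNIV. ZZ v w $ l $ k *\<^sub>R Y' k l v else 0)"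

lemma has_rough_integral_germ:
  "has_rough_integral \<alpha> Z ZZ p Y Y' s t I \<longleftrightarrow> has_mesh_limit p (rough_germ \<alpha> Z ZZ Y Y') s t I"
  by (simp add: has_rough_integral_def rough_germ_def[abs_def])

text \<open>By Chen's relation the defect of additivity only involves the remainder of the controlled path and the
  increment of its Gubinelli derivative, so it is of order \<open>3\<alpha>\<close>.\<close>

lemma rough_germ_defect:
  assumes Z: "geometric_rough_path \<alpha> T Z ZZ" and \<alpha>: "\<alpha> \<le> 1/2" and "0 \<le> s" "s < u" "u < t" "t \<le> T"
  shows "rough_germ \<alpha> Z ZZ V V' s t - rough_germ \<alpha> Z ZZ V V' s u - rough_germ \<alpha> Z ZZ V V' u t =
    - (\<Sum>k\<in>UNIV. (Z t - Z u) $ k *\<^sub>R (V k u - V k s - (\<Sum>l\<in>UNIV. (Z u - Z s) $ l *\<^sub>R V' k l s))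
       + (\<Sum>l\<in>UNIV. ZZ u t $ l $ k *\<^sub>R (V' k l u - V' k l s)))"
proof -
  have eq: "(Z t - Z s) $ k *\<^sub>R V k s + (\<Sum>l\<in>UNIV. ZZ s t $ l $ k *\<^sub>R V' k l s)
      - ((Z u - Z s) $ k *\<^sub>R V k s + (\<Sum>l\<in>UNIV. ZZ s u $ l $ k *\<^sub>R V' k l s))
      - ((Z t - Z u) $ k *\<^sub>R V k u + (\<Sum>l\<in>UNIV. ZZ u t $ l $ k *\<^sub>R V' k l u))
    = - ((Z t - Z u) $ k *\<^sub>R (V k u - V k s - (\<Sum>l\<in>UNIV. (Z u - Z s) $ l *\<^sub>R V' k l s))
       + (\<Sum>l\<in>UNIV. ZZ u t $ l $ k *\<^sub>R (V' k l u - V' k l s)))" for k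
  proof -
    have "(\<Sum>l\<in>UNIV. ZZ s t $ l $ k *\<^sub>R V' k l s) = (\<Sum>l\<in>UNIV. ZZ s u $ l $ k *\<^sub>R V' k l s)
        + (\<Sum>l\<in>UNIV. ZZ u t $ l $ k *\<^sub>R V' k l s)
        + (Z t - Z u) $ k *\<^sub>R (\<Sum>l\<in>UNIV. (Z u - Z s) $ l *\<^sub>R V' k l s)"
      unfolding geometric_chen[OF Z \<alpha> assms(3-)]
      by (simp only: scaleR_left_distrib sum.distrib scaleR_sum_right scaleR_scaleR mult.commute)
    moreover have "(Z t - Z s) $ k *\<^sub>R V k s = (Z t - Z u) $ k *\<^sub>R V k s + (Z u - Z s) $ k *\<^sub>R V k s"
      by (simp add: algebra_simps)
    moreover have "(\<Sum>l\<in>UNIV. ZZ u t $ l $ k *\<^sub>R (V' k l u - V' k l s))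
        = (\<Sum>l\<in>UNIV. ZZ u t $ l $ k *\<^sub>R V' k l u) - (\<Sum>l\<in>UNIV. ZZ u t $ l $ k *\<^sub>R V' k l s)"
      by (simp only: scaleR_right_diff_distrib sum_subtractf)
    ultimately show ?thesis by (simp add: scaleR_right_diff_distrib)
  qed
  show ?thesis
    unfolding sum_negf[symmetric] eq[symmetric]
    using \<alpha> by (simp add: rough_germ_def sum.distrib sum_subtractf)
qed

lemma rough_germ_defect_young:
  assumes "\<not> \<alpha> \<le> 1/2"
  shows "rough_germ \<alpha> Z ZZ V V' s t - rough_germ \<alpha> Z ZZ V V' s u - rough_germ \<alpha> Z ZZ V V' u t =
    - (\<Sum>k\<in>UNIV. (Z t - Z u) $ k *\<^sub>R (V k u - V k s))"
  using assms by (simp add: rough_germ_def algebra_simps sum.distrib sum_subtractf)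

definition sewing_exponent :: "real \<Rightarrow> real" where
  "sewing_exponent \<alpha> = (if \<alpha> \<le> 1/2 then 3 * \<alpha> else 2 * \<alpha>)"

text \<open>The sewing bound applies because \<open>3\<alpha> > 1\<close> if \<open>\<alpha> > 1/3\<close>, and \<open>2\<alpha> > 1\<close> if \<open>\<alpha> > 1/2\<close>.\<close>

lemma rough_germ_sewing:
  fixes Z :: "real \<Rightarrow> real ^ 'k::finite" and p :: "nat \<Rightarrow> 'e::real_vector \<Rightarrow> real" and N :: nat
  assumes p: "\<And>n. seminorm (p n)" and Z: "geometric_rough_path \<alpha> T Z ZZ" and \<alpha>: "1/3 < \<alpha>" "\<alpha> \<le> 1"
    and V: "\<And>k. controlled \<alpha> T Z p (V k) (V' k)"
  defines "q \<equiv> \<lambda>x. \<Sum>i\<le>N. p i x"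
  shows "\<exists>C. \<forall>s t I. 0 \<le> s \<and> s < t \<and> t \<le> T \<and> lim_q q (rough_germ \<alpha> Z ZZ V V') s t I \<longrightarrow>
    q (I - rough_germ \<alpha> Z ZZ V V' s t) \<le> C * (t - s) powr sewing_exponent \<alpha>"
proof -
  let ?\<Xi> = "rough_germ \<alpha> Z ZZ V V'"
  have q: "seminorm q" unfolding q_def by (rule seminorm_finite_sum[OF p])
  have sup: "inc_O T \<beta> (\<lambda>s t. q (\<Theta> s t))" if "holder2 p T \<beta> \<Theta>" for \<beta> \<Theta>
    unfolding q_def by (rule inc_O_holder2[of p, OF p that])
  from inc_O_choice[of T \<alpha> "\<lambda>k s t. (Z t - Z s) $ k", OF geometric_holder_level1[OF Z \<alpha>(2)]]
  obtain A where A: "\<And>k. A k \<ge> 0"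
    "\<And>k s t. 0 \<le> s \<and> s < t \<and> t \<le> T \<Longrightarrow> \<bar>(Z t - Z s) $ k\<bar> \<le> A k * (t - s) powr \<alpha>" by blast
  have prod: "\<bar>a\<bar> * q x \<le> (C * D) * (t - s) powr (\<beta> + \<gamma>)"
    if "\<bar>a\<bar> \<le> C * (t - u) powr \<beta>" "q x \<le> D * (u - s) powr \<gamma>" "s < u" "u < t" "0 \<le> C" "0 \<le> D" "0 \<le> \<beta>" "0 \<le> \<gamma>"
    for a x C D \<beta> \<gamma> s t u
  proof -
    have "\<bar>a\<bar> * q x \<le> (C * (t - u) powr \<beta>) * (D * (u - s) powr \<gamma>)"
      using that seminorm_nonneg[OF q] by (intro mult_mono) auto
    also have "\<dots> \<le> (C * (t - s) powr \<beta>) * (D * (t - s) powr \<gamma>)"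
      using that by (intro mult_mono mult_left_mono powr_mono2) auto
    finally show ?thesis by (simp add: powr_add mult_ac)
  qed
  have "\<exists>D\<ge>0. \<forall>s u t. 0 \<le> s \<and> s < u \<and> u < t \<and> t \<le> T \<longrightarrow>
      q (?\<Xi> s t - ?\<Xi> s u - ?\<Xi> u t) \<le> D * (t - s) powr sewing_exponent \<alpha>"
  proof (cases "\<alpha> \<le> 1/2")
    case True
    let ?R = "\<lambda>k s u. V k u - V k s - (\<Sum>l\<in>UNIV. (Z u - Z s) $ l *\<^sub>R V' k l s)"
    have "inc_O T (2 * \<alpha>) (\<lambda>s t. q (?R k s t))" for k
      using V[of k] True by (intro sup) (simp add: controlled_def)
    from inc_O_choice[of T "2 * \<alpha>" "\<lambda>k s t. q (?R k s t)", OF this]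
    obtain B where B: "\<And>k. B k \<ge> 0" "\<And>k s t. 0 \<le> s \<and> s < t \<and> t \<le> T \<Longrightarrow>
        \<bar>q (?R k s t)\<bar> \<le> B k * (t - s) powr (2 * \<alpha>)" by blast
    have "inc_O T \<alpha> (\<lambda>s t. q (V' (fst k) (snd k) t - V' (fst k) (snd k) s))" for k
      using V[of "fst k"] True by (intro sup) (simp add: controlled_def holder_def)
    from inc_O_choice[of T \<alpha> "\<lambda>k s t. q (V' (fst k) (snd k) t - V' (fst k) (snd k) s)", OF this]
    obtain B' where B': "\<And>k. B' k \<ge> 0" "\<And>k s t. 0 \<le> s \<and> s < t \<and> t \<le> T \<Longrightarrow>
        \<bar>q (V' (fst k) (snd k) t - V' (fst k) (snd k) s)\<bar> \<le> B' k * (t - s) powr \<alpha>" by blast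
    from inc_O_choice[of T "2 * \<alpha>" "\<lambda>k s t. ZZ s t $ snd k $ fst k", OF geometric_holder_level2[OF Z True]]
    obtain A' where A': "\<And>k. A' k \<ge> 0"
      "\<And>k s t. 0 \<le> s \<and> s < t \<and> t \<le> T \<Longrightarrow> \<bar>ZZ s t $ snd k $ fst k\<bar> \<le> A' k * (t - s) powr (2 * \<alpha>)" by blast
    define D where "D = (\<Sum>k\<in>UNIV. A k * B k + (\<Sum>l\<in>UNIV. A' (k, l) * B' (k, l)))"
    have "q (?\<Xi> s t - ?\<Xi> s u - ?\<Xi> u t) \<le> D * (t - s) powr (3 * \<alpha>)"
      if sut: "0 \<le> s" "s < u" "u < t" "t \<le> T" for s u t
    proof -
      let ?W = "\<lambda>k. \<Sum>l\<in>UNIV. ZZ u t $ l $ k *\<^sub>R (V' k l u - V' k l s)"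
      have "q ((Z t - Z u) $ k *\<^sub>R ?R k s u + ?W k)
          \<le> (A k * B k + (\<Sum>l\<in>UNIV. A' (k, l) * B' (k, l))) * (t - s) powr (3 * \<alpha>)" for k
      proof -
        have "\<bar>(Z t - Z u) $ k\<bar> * q (?R k s u) \<le> (A k * B k) * (t - s) powr (\<alpha> + 2 * \<alpha>)"
          by (rule prod[OF A(2)[of u t k] abs_le_D1[OF B(2)[of s u k]]])
            (use A(1)[of k] B(1)[of k] sut \<alpha> in auto)
        moreover have "\<bar>ZZ u t $ l $ k\<bar> * q (V' k l u - V' k l s)
            \<le> (A' (k, l) * B' (k, l)) * (t - s) powr (2 * \<alpha> + \<alpha>)" for l
          by (rule prod[OF A'(2)[of u t "(k, l)", unfolded fst_conv snd_conv]
                abs_le_D1[OF B'(2)[of s u "(k, l)", unfolded fst_conv snd_conv]]])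
            (use A'(1)[of "(k, l)"] B'(1)[of "(k, l)"] sut \<alpha> in auto)
        then have "q (?W k) \<le> (\<Sum>l\<in>UNIV. (A' (k, l) * B' (k, l)) * (t - s) powr (3 * \<alpha>))"
          by (intro order_trans[OF seminorm_sum[OF q] sum_mono]) (simp add: seminorm_scale[OF q])
        ultimately show ?thesis
          using seminorm_triangle[OF q, of "(Z t - Z u) $ k *\<^sub>R ?R k s u" "?W k"]
          by (simp add: seminorm_scale[OF q] distrib_right sum_distrib_right)
      qed
      then show ?thesis
        unfolding rough_germ_defect[OF Z True sut] seminorm_minus[OF q] D_def sum_distrib_right
        by (intro order_trans[OF seminorm_sum[OF q] sum_mono]) simp
    qed
    moreover have "0 \<le> D" unfolding D_def using A(1) B(1) A'(1) B'(1)
      by (intro sum_nonneg add_nonneg_nonneg mult_nonneg_nonneg) auto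
    ultimately show ?thesis using True by (auto simp: sewing_exponent_def)
  next
    case False
    have "inc_O T \<alpha> (\<lambda>s t. q (V k t - V k s))" for k
      using V[of k] by (intro sup) (simp add: controlled_def holder_def)
    from inc_O_choice[of T \<alpha> "\<lambda>k s t. q (V k t - V k s)", OF this]
    obtain B where B: "\<And>k. B k \<ge> 0" "\<And>k s t. 0 \<le> s \<and> s < t \<and> t \<le> T \<Longrightarrow>
        \<bar>q (V k t - V k s)\<bar> \<le> B k * (t - s) powr \<alpha>" by blast
    define D where "D = (\<Sum>k\<in>UNIV. A k * B k)"
    have "q (?\<Xi> s t - ?\<Xi> s u - ?\<Xi> u t) \<le> D * (t - s) powr (2 * \<alpha>)"
      if sut: "0 \<le> s" "s < u" "u < t" "t \<le> T" for s u t
    proof -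
      have "\<bar>(Z t - Z u) $ k\<bar> * q (V k u - V k s) \<le> (A k * B k) * (t - s) powr (\<alpha> + \<alpha>)" for k
        by (rule prod[OF A(2)[of u t k] abs_le_D1[OF B(2)[of s u k]]])
          (use A(1)[of k] B(1)[of k] sut \<alpha> in auto)
      then show ?thesis
        unfolding rough_germ_defect_young[OF False] seminorm_minus[OF q] D_def sum_distrib_right
        by (intro order_trans[OF seminorm_sum[OF q] sum_mono]) (simp add: seminorm_scale[OF q])
    qed
    moreover have "0 \<le> D" unfolding D_def using A(1) B(1)
      by (intro sum_nonneg mult_nonneg_nonneg) auto
    ultimately show ?thesis using False by (auto simp: sewing_exponent_def)
  qed
  then obtain D where D: "0 \<le> D" "\<And>s u t. 0 \<le> s \<Longrightarrow> s < u \<Longrightarrow> u < t \<Longrightarrow> t \<le> T \<Longrightarrow>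
      q (?\<Xi> s t - ?\<Xi> s u - ?\<Xi> u t) \<le> D * (t - s) powr sewing_exponent \<alpha>"
    by blast
  have "1 < sewing_exponent \<alpha>" using \<alpha> by (auto simp: sewing_exponent_def)
  from sewing_bound[OF q this D] show ?thesis by blast
qed

section \<open>Iterated directional derivatives\<close>

lemma Cb_has_derivative:
  assumes "Cb p n f" "length vs < n"
  shows "((\<lambda>\<epsilon>. Ddir f vs (x + \<epsilon> *\<^sub>R v)) has_real_derivative Ddir f (v # vs) (x + \<epsilon>\<^sub>0 *\<^sub>R v)) (at \<epsilon>\<^sub>0)"
proof -
  have "(\<lambda>\<epsilon>. Ddir f vs ((x + \<epsilon>\<^sub>0 *\<^sub>R v) + \<epsilon> *\<^sub>R v)) field_differentiable (at 0)"
    using assms unfolding Cb_def by blast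
  then have "((\<lambda>\<epsilon>. Ddir f vs ((x + \<epsilon>\<^sub>0 *\<^sub>R v) + \<epsilon> *\<^sub>R v)) has_real_derivative Ddir f (v # vs) (x + \<epsilon>\<^sub>0 *\<^sub>R v)) (at 0)"
    unfolding Ddir.simps by (rule field_differentiable_derivI)
  moreover have "(\<lambda>\<epsilon>. Ddir f vs ((x + \<epsilon>\<^sub>0 *\<^sub>R v) + \<epsilon> *\<^sub>R v)) = (\<lambda>\<epsilon>. Ddir f vs (x + (\<epsilon> + \<epsilon>\<^sub>0) *\<^sub>R v))"
    by (simp add: algebra_simps)
  ultimately show ?thesis
    using DERIV_shift[of "\<lambda>\<epsilon>. Ddir f vs (x + \<epsilon> *\<^sub>R v)" _ 0 \<epsilon>\<^sub>0] by simp
qed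

text \<open>Joint continuity in the base point and all directions, transported along arbitrary continuous maps.\<close>

lemma Cb_continuous_map:
  assumes p: "\<And>n. seminorm (p n)" and "Cb p n f" "j \<le> n"
    and F: "continuous_map X (ftop p) F" and G: "\<And>i. i < j \<Longrightarrow> continuous_map X (ftop p) (G i)"
  shows "continuous_map X euclideanreal (\<lambda>z. Ddir f (map (\<lambda>i. G i z) [0..<j]) (F z))"
proof -
  define w where "w z = restrict (\<lambda>i. if i = 0 then F z else G (i - 1) z) {..j}" for z
  have "continuous_map X (product_topology (\<lambda>_. ftop p) {..j}) w"
    unfolding continuous_map_componentwise
  proof (intro conjI ballI)
    fix i assume "i \<in> {..j}"
    then show "continuous_map X (ftop p) (\<lambda>z. w z i)"
      using F G[of "i - 1"] by (cases "i = 0") (auto simp: w_def)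
  qed (auto simp: w_def)
  moreover have "continuous_map (product_topology (\<lambda>_. ftop p) {..j}) euclideanreal (\<lambda>w. Ddir f (map w [1..<Suc j]) (w 0))"
    using assms(2,3) unfolding Cb_def by blast
  ultimately have "continuous_map X euclideanreal ((\<lambda>w. Ddir f (map w [1..<Suc j]) (w 0)) \<circ> w)"
    by (rule continuous_map_compose)
  moreover have "map (w z) [1..<Suc j] = map (\<lambda>i. G i z) [0..<j]" for z
    by (rule nth_equalityI) (auto simp: w_def simp del: upt_Suc)
  moreover have "w z 0 = F z" for z by (simp add: w_def)
  ultimately show ?thesis by (simp add: o_def)
qed

lemma Cb_near:
  assumes p: "\<And>n. seminorm (p n)" and f: "Cb p n f" "length vs \<le> n" and "e > 0"
  obtains d where "d > 0" "\<And>s t. \<bar>s\<bar> < d \<Longrightarrow> \<bar>t\<bar> < d \<Longrightarrow>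
    \<bar>Ddir f vs (x + s *\<^sub>R v + t *\<^sub>R w) - Ddir f vs x\<bar> < e"
proof -
  let ?\<Phi> = "\<lambda>z::real \<times> real. Ddir f vs (x + fst z *\<^sub>R v + snd z *\<^sub>R w)"
  have "continuous_map euclidean (ftop p) (\<lambda>z::real \<times> real. x + fst z *\<^sub>R v + snd z *\<^sub>R w)"
    by (intro continuous_map_ftop_add_scale p continuous_map_ftop_const[of p, OF p])
      (auto intro!: continuous_intros)
  from Cb_continuous_map[of p n f "length vs", OF p f this, of "\<lambda>i z. vs ! i"]
  have "continuous_on UNIV ?\<Phi>"
    by (simp add: map_nth topspace_ftop[of p, OF p])
  then obtain d where d: "d > 0" "\<And>z. dist z (0, 0) < d \<Longrightarrow> dist (?\<Phi> z) (?\<Phi> (0, 0)) < e"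
    using \<open>e > 0\<close> unfolding continuous_on_iff by blast
  show thesis
  proof (rule that[of "d / 2"])
    fix s t :: real assume st: "\<bar>s\<bar> < d / 2" "\<bar>t\<bar> < d / 2"
    have "dist (s, t) (0, 0) \<le> \<bar>s\<bar> + \<bar>t\<bar>"
      using sqrt_sum_squares_le_sum_abs[of s t] by (simp add: dist_Pair_Pair dist_real_def)
    then show "\<bar>Ddir f vs (x + s *\<^sub>R v + t *\<^sub>R w) - Ddir f vs x\<bar> < e"
      using d(2)[of "(s, t)"] st by (simp add: dist_real_def)
  qed (use d in simp)
qed

text \<open>Additivity comes from continuity of the derivative: the mean value theorem expresses the increment
  along \<open>v\<close>, started at the nearby point \<open>x + h w\<close>, by the derivative at a point close to \<open>x\<close>.\<close>

lemma Ddir_add: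
  assumes p: "\<And>n. seminorm (p n)" and f: "Cb p n f" "length vs < n"
  shows "Ddir f ((v + w) # vs) x = Ddir f (v # vs) x + Ddir f (w # vs) x"
proof -
  let ?g = "Ddir f vs"
  have lim: "((\<lambda>h. (?g (x + h *\<^sub>R u) - ?g x) / h) \<longlongrightarrow> Ddir f (u # vs) x) (at_right 0)" for u
    using Cb_has_derivative[OF f, of x u 0]
    by (simp add: DERIV_def filterlim_at_split)
  \<comment> \<open>limits from the right suffice to identify the derivatives and spare the case \<open>h < 0\<close> of the mean value theorem\<close>
  have "((\<lambda>h. (?g (x + h *\<^sub>R w + h *\<^sub>R v) - ?g (x + h *\<^sub>R w)) / h) \<longlongrightarrow> Ddir f (v # vs) x) (at_right 0)"
  proof (rule tendstoI)
    fix e :: real assume "e > 0"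
    obtain d where d: "d > 0" "\<And>s t. \<bar>s\<bar> < d \<Longrightarrow> \<bar>t\<bar> < d \<Longrightarrow>
        \<bar>Ddir f (v # vs) (x + s *\<^sub>R w + t *\<^sub>R v) - Ddir f (v # vs) x\<bar> < e"
      using Cb_near[of p, OF p f(1), of "v # vs" e x w v] f(2) \<open>e > 0\<close> by auto
    have "dist ((?g (x + h *\<^sub>R w + h *\<^sub>R v) - ?g (x + h *\<^sub>R w)) / h) (Ddir f (v # vs) x) < e"
      if h: "0 < h" "h < d" for h
    proof -
      obtain z where z: "0 < z" "z < h" "?g (x + h *\<^sub>R w + h *\<^sub>R v) - ?g (x + h *\<^sub>R w + 0 *\<^sub>R v)
          = (h - 0) * Ddir f (v # vs) (x + h *\<^sub>R w + z *\<^sub>R v)"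
        using MVT2[OF h(1) Cb_has_derivative[OF f]] by blast
      then show ?thesis using d(2)[of h z] h by (simp add: dist_real_def)
    qed
    then show "\<forall>\<^sub>F h in at_right 0. dist ((?g (x + h *\<^sub>R w + h *\<^sub>R v) - ?g (x + h *\<^sub>R w)) / h) (Ddir f (v # vs) x) < e"
      unfolding eventually_at_right_field using d(1) by blast
  qed
  from tendsto_add[OF this lim[of w]]
  have "((\<lambda>h. (?g (x + h *\<^sub>R (v + w)) - ?g x) / h) \<longlongrightarrow> Ddir f (v # vs) x + Ddir f (w # vs) x) (at_right 0)"
    by (simp add: algebra_simps add_divide_distrib[symmetric])
  from tendsto_unique[OF _ lim[of "v + w"] this] show ?thesis by simp
qed

lemma Ddir_scale:
  assumes f: "Cb p n f" "length vs < n"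
  shows "Ddir f ((c *\<^sub>R v) # vs) x = c * Ddir f (v # vs) x"
proof -
  have "((\<lambda>\<epsilon>. Ddir f vs (x + (\<epsilon> * c) *\<^sub>R v)) has_real_derivative Ddir f (v # vs) (x + (0 * c) *\<^sub>R v) * c) (at 0)"
    by (rule DERIV_chain2[OF Cb_has_derivative[OF f]]) (auto intro!: derivative_eq_intros)
  then have "((\<lambda>\<epsilon>. Ddir f vs (x + \<epsilon> *\<^sub>R c *\<^sub>R v)) has_real_derivative c * Ddir f (v # vs) x) (at 0)"
    by (simp add: mult.commute)
  then show ?thesis by (simp add: DERIV_imp_deriv)
qed

lemma Ddir_linear:
  assumes p: "\<And>n. seminorm (p n)" and f: "Cb p n f" "length vs < n"
  shows "linear (\<lambda>v. Ddir f (v # vs) x)"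
  by (rule linearI) (simp_all only: Ddir_add[of p, OF p f] Ddir_scale[OF f] real_scaleR_def)

text \<open>Schwarz: the second difference over the parallelogram spanned by \<open>h v\<close> and \<open>h w\<close> is \<open>h\<^sup>2\<close> times either
  mixed derivative at a nearby point.\<close>

lemma second_difference:
  assumes f: "Cb p n f" "2 \<le> n" and "0 < h"
  obtains \<xi> \<eta> where "0 < \<xi>" "\<xi> < h" "0 < \<eta>" "\<eta> < h"
    "f (x + h *\<^sub>R v + h *\<^sub>R w) - f (x + h *\<^sub>R w) - f (x + h *\<^sub>R v) + f x
      = h\<^sup>2 * Ddir f [w, v] (x + \<xi> *\<^sub>R v + \<eta> *\<^sub>R w)"
proof -
  have n: "length [] < n" "length [v] < n" using f(2) by auto
  let ?\<phi> = "\<lambda>s. f (x + h *\<^sub>R w + s *\<^sub>R v) - f (x + s *\<^sub>R v)"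
  have "(?\<phi> has_real_derivative Ddir f [v] (x + h *\<^sub>R w + s *\<^sub>R v) - Ddir f [v] (x + s *\<^sub>R v)) (at s)" for s
    using DERIV_diff[OF Cb_has_derivative[OF f(1) n(1)] Cb_has_derivative[OF f(1) n(1)]] by simp
  from MVT2[OF \<open>0 < h\<close> this]
  obtain \<xi> where \<xi>: "0 < \<xi>" "\<xi> < h"
    "?\<phi> h - ?\<phi> 0 = (h - 0) * (Ddir f [v] (x + h *\<^sub>R w + \<xi> *\<^sub>R v) - Ddir f [v] (x + \<xi> *\<^sub>R v))" by blast
  obtain \<eta> where \<eta>: "0 < \<eta>" "\<eta> < h"
    "Ddir f [v] (x + \<xi> *\<^sub>R v + h *\<^sub>R w) - Ddir f [v] (x + \<xi> *\<^sub>R v + 0 *\<^sub>R w)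
      = (h - 0) * Ddir f [w, v] (x + \<xi> *\<^sub>R v + \<eta> *\<^sub>R w)"
    using MVT2[OF \<open>0 < h\<close> Cb_has_derivative[OF f(1) n(2), of "x + \<xi> *\<^sub>R v" w]] by blast
  have "f (x + h *\<^sub>R v + h *\<^sub>R w) - f (x + h *\<^sub>R w) - f (x + h *\<^sub>R v) + f x = ?\<phi> h - ?\<phi> 0"
    by (simp add: add_ac)
  also have "\<dots> = h * (Ddir f [v] (x + \<xi> *\<^sub>R v + h *\<^sub>R w) - Ddir f [v] (x + \<xi> *\<^sub>R v))"
    unfolding \<xi>(3) by (simp add: add_ac)
  also have "\<dots> = h\<^sup>2 * Ddir f [w, v] (x + \<xi> *\<^sub>R v + \<eta> *\<^sub>R w)"
    using \<eta>(3) by (simp add: power2_eq_square)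
  finally show thesis using that \<xi> \<eta> by blast
qed

lemma Ddir_symmetric:
  assumes p: "\<And>n. seminorm (p n)" and f: "Cb p n f" "2 \<le> n"
  shows "Ddir f [v, w] x = Ddir f [w, v] x"
proof -
  have "\<bar>Ddir f [v, w] x - Ddir f [w, v] x\<bar> \<le> e" if "e > 0" for e
  proof -
    from that have e: "e / 2 > 0" by simp
    obtain a where a: "a > 0" "\<And>s t. \<bar>s\<bar> < a \<Longrightarrow> \<bar>t\<bar> < a \<Longrightarrow>
        \<bar>Ddir f [v, w] (x + s *\<^sub>R w + t *\<^sub>R v) - Ddir f [v, w] x\<bar> < e / 2"
      using Cb_near[of p, OF p f(1), of "[v, w]" "e / 2" x w v] f(2) e by auto
    obtain b where b: "b > 0" "\<And>s t. \<bar>s\<bar> < b \<Longrightarrow> \<bar>t\<bar> < b \<Longrightarrow>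
        \<bar>Ddir f [w, v] (x + s *\<^sub>R v + t *\<^sub>R w) - Ddir f [w, v] x\<bar> < e / 2"
      using Cb_near[of p, OF p f(1), of "[w, v]" "e / 2" x v w] f(2) e by auto
    define h where "h = min a b / 2"
    have h: "0 < h" "h < a" "h < b" using a b by (auto simp: h_def)
    obtain \<xi> \<eta> where 1: "0 < \<xi>" "\<xi> < h" "0 < \<eta>" "\<eta> < h"
      "f (x + h *\<^sub>R v + h *\<^sub>R w) - f (x + h *\<^sub>R w) - f (x + h *\<^sub>R v) + f x
        = h\<^sup>2 * Ddir f [w, v] (x + \<xi> *\<^sub>R v + \<eta> *\<^sub>R w)"
      by (rule second_difference[OF f h(1)])
    obtain \<xi>' \<eta>' where 2: "0 < \<xi>'" "\<xi>' < h" "0 < \<eta>'" "\<eta>' < h"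
      "f (x + h *\<^sub>R w + h *\<^sub>R v) - f (x + h *\<^sub>R v) - f (x + h *\<^sub>R w) + f x
        = h\<^sup>2 * Ddir f [v, w] (x + \<xi>' *\<^sub>R w + \<eta>' *\<^sub>R v)"
      by (rule second_difference[OF f h(1)])
    have "h\<^sup>2 * Ddir f [w, v] (x + \<xi> *\<^sub>R v + \<eta> *\<^sub>R w) = h\<^sup>2 * Ddir f [v, w] (x + \<xi>' *\<^sub>R w + \<eta>' *\<^sub>R v)"
      unfolding 1(5)[symmetric] 2(5)[symmetric] by (simp add: add_ac)
    then have "Ddir f [w, v] (x + \<xi> *\<^sub>R v + \<eta> *\<^sub>R w) = Ddir f [v, w] (x + \<xi>' *\<^sub>R w + \<eta>' *\<^sub>R v)"
      using h by simp
    then show ?thesis using a(2)[of \<xi>' \<eta>'] b(2)[of \<xi> \<eta>] 1(1-4) 2(1-4) h by linarith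
  qed
  then show ?thesis using dense_eq0_I[of "Ddir f [v, w] x - Ddir f [w, v] x"] by simp
qed

lemma Ddir_bilinear:
  assumes p: "\<And>n. seminorm (p n)" and f: "Cb p n f" "2 \<le> n"
  shows "bilinear (\<lambda>v w. Ddir f [v, w] x)"
  unfolding bilinear_def
proof (intro conjI allI)
  fix y
  show "linear (\<lambda>v. Ddir f [v, y] x)" using f by (intro Ddir_linear[of p] p) auto
  then show "linear (\<lambda>v. Ddir f [y, v] x)" by (simp only: Ddir_symmetric[of p, OF p f, of y])
qed

definition deriv_bound :: "('e::real_vector \<Rightarrow> real) \<Rightarrow> real \<Rightarrow> nat \<Rightarrow> ('e \<Rightarrow> real) \<Rightarrow> bool" where
  "deriv_bound q C n f \<longleftrightarrow> (\<forall>vs x. length vs \<le> n \<longrightarrow> \<bar>Ddir f vs x\<bar> \<le> C * prod_list (map q vs))"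

lemma prod_list_map_mono:
  assumes "\<And>v. 0 \<le> q v" "\<And>v. q v \<le> (r v :: real)"
  shows "0 \<le> prod_list (map q vs)" "prod_list (map q vs) \<le> prod_list (map r vs)"
proof -
  show *: "0 \<le> prod_list (map q vs)" for vs by (induction vs) (auto simp: assms)
  show "prod_list (map q vs) \<le> prod_list (map r vs)"
    by (induction vs) (auto intro!: mult_mono * simp: assms order_trans[OF assms])
qed

text \<open>One sum of seminorms serves the derivatives of all orders, since enlarging the sum enlarges the bound.\<close>

lemma Cb_deriv_bound:
  assumes p: "\<And>n. seminorm (p n)" and f: "Cb p n f"
  shows "\<exists>N C. 0 \<le> C \<and> deriv_bound (\<lambda>v. \<Sum>i\<le>N. p i v) C n f"
proof -
  have "\<exists>N C. 0 \<le> C \<and> deriv_bound (\<lambda>v. \<Sum>i\<le>N. p i v) C m f" if "m \<le> n" for m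
    using that
  proof (induction m)
    case 0
    have "\<exists>N C. \<forall>x vs. length vs = 0 \<longrightarrow> \<bar>Ddir f vs x\<bar> \<le> C * prod_list (map (\<lambda>v. \<Sum>i\<le>N. p i v) vs)"
      using f unfolding Cb_def by blast
    then obtain C where "\<And>x. \<bar>f x\<bar> \<le> C" by auto
    then show ?case
      by (intro exI[of _ 0] exI[of _ "max 0 C"]) (auto simp: deriv_bound_def max.coboundedI2)
  next
    case (Suc m)
    then obtain N C where NC: "0 \<le> C" "deriv_bound (\<lambda>v. \<Sum>i\<le>N. p i v) C m f" by auto
    have "\<exists>N C. \<forall>x vs. length vs = Suc m \<longrightarrow> \<bar>Ddir f vs x\<bar> \<le> C * prod_list (map (\<lambda>v. \<Sum>i\<le>N. p i v) vs)"
      using f Suc.prems unfolding Cb_def by blast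
    then obtain M D where MD: "\<And>x vs. length vs = Suc m \<Longrightarrow> \<bar>Ddir f vs x\<bar> \<le> D * prod_list (map (\<lambda>v. \<Sum>i\<le>M. p i v) vs)"
      by blast
    let ?q = "\<lambda>K v. \<Sum>i\<le>(K::nat). p i v"
    have pos: "0 \<le> ?q K v" for K v using seminorm_nonneg[OF p] by (intro sum_nonneg) auto
    have mono: "?q N v \<le> ?q (max N M) v" "?q M v \<le> ?q (max N M) v" for v
      using seminorm_nonneg[OF p] by (auto intro!: sum_mono2)
    have "\<bar>Ddir f vs x\<bar> \<le> max C D * prod_list (map (?q (max N M)) vs)" if "length vs \<le> Suc m" for vs x
    proof (cases "length vs = Suc m")
      case True
      note MD[OF True, of x]
      also have "D * prod_list (map (?q M) vs) \<le> max C D * prod_list (map (?q (max N M)) vs)"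
        using NC(1) by (intro mult_mono prod_list_map_mono pos mono) auto
      finally show ?thesis .
    next
      case False
      then have "\<bar>Ddir f vs x\<bar> \<le> C * prod_list (map (?q N) vs)"
        using NC(2) that by (simp add: deriv_bound_def)
      also have "\<dots> \<le> max C D * prod_list (map (?q (max N M)) vs)"
        using NC(1) by (intro mult_mono prod_list_map_mono pos mono) auto
      finally show ?thesis .
    qed
    then show ?case
      using NC(1) by (intro exI[of _ "max N M"] exI[of _ "max C D"]) (auto simp: deriv_bound_def)
  qed
  then show ?thesis by blast
qed

lemma Ddir_taylor:
  assumes q: "seminorm q" "0 \<le> C" and f: "Cb p n f" "deriv_bound q C n f" and "0 < m" "m + length vs \<le> n"
  shows "\<bar>Ddir f vs (x + v) - (\<Sum>i<m. Ddir f (replicate i v @ vs) x / fact i)\<bar> \<le> C * (q v ^ m * prod_list (map q vs))"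
proof -
  let ?d = "\<lambda>i t. Ddir f (replicate i v @ vs) (x + t *\<^sub>R v)"
  have "\<forall>i t. i < m \<and> 0 \<le> t \<and> t \<le> 1 \<longrightarrow> DERIV (?d i) t :> ?d (Suc i) t"
    using assms(6) Cb_has_derivative[OF f(1)] by (auto simp del: Ddir.simps)
  from Maclaurin[of 1 m ?d "?d 0", OF _ \<open>0 < m\<close> refl this]
  obtain t where "?d 0 1 = (\<Sum>i<m. ?d i 0 / fact i) + ?d m t / fact m" by auto
  then have "\<bar>Ddir f vs (x + v) - (\<Sum>i<m. Ddir f (replicate i v @ vs) x / fact i)\<bar> = \<bar>?d m t\<bar> / fact m"
    by simp
  also have "\<dots> \<le> \<bar>?d m t\<bar>" by (simp add: divide_le_eq mult_left_mono[of 1 "fact m :: real"] mult_le_cancel_left1)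
  also have "\<dots> \<le> C * prod_list (map q (replicate m v @ vs))"
    using f(2)[unfolded deriv_bound_def, rule_format, of "replicate m v @ vs" "x + t *\<^sub>R v"] assms(6)
    by (simp del: map_append map_replicate)
  also have "prod_list (map q (replicate m v @ vs)) = q v ^ m * prod_list (map q vs)"
    by (simp add: prod_list_replicate)
  finally show ?thesis .
qed

section \<open>Solutions of rough equations\<close>

text \<open>The path \<open>X\<close> solves \<open>dX = b dt + V dZ\<close>.\<close>

locale rough_equation =
  fixes p :: "nat \<Rightarrow> 'e::real_vector \<Rightarrow> real" and \<alpha> T :: real
    and Z :: "real \<Rightarrow> real ^ 'k::finite" and ZZ :: "real \<Rightarrow> real \<Rightarrow> real ^ 'k ^ 'k"
    and X :: "real \<Rightarrow> 'e" and b :: "real \<Rightarrow> 'e" and V :: "'k \<Rightarrow> real \<Rightarrow> 'e" and V' :: "'k \<Rightarrow> 'k \<Rightarrow> real \<Rightarrow> 'e"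
  assumes p: "\<And>n. seminorm (p n)"
    and T: "0 < T" and \<alpha>: "1/3 < \<alpha>" "\<alpha> \<le> 1"
    and Z: "geometric_rough_path \<alpha> T Z ZZ"
    and X: "holder p T \<alpha> X" and b: "cont_path p T b"
    and V: "\<And>k. controlled \<alpha> T Z p (V k) (V' k)"
    and equation: "\<And>t. t \<in> {0..T} \<Longrightarrow> \<exists>I. has_rdiff_integral \<alpha> Z ZZ p (b, V) V' t I \<and> X t = X 0 + I"
begin

lemma sum_sn: "seminorm (\<lambda>x. \<Sum>i\<le>N. p i x)" "cont_seminorm p (\<lambda>x. \<Sum>i\<le>N. p i x)"
  using seminorm_finite_sum[of p, OF p] cont_seminorm_finite_sum[of p, OF p] by auto

lemma cont_X: "cont_path p T X"
  using \<alpha> by (intro holder_cont_path[of p, OF p _ X]) simp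

lemma cont_V: "cont_path p T (V k)"
  using V[of k] \<alpha> by (intro holder_cont_path[of p, OF p, of \<alpha>]) (auto simp: controlled_def)

lemma holder_V': "\<alpha> \<le> 1/2 \<Longrightarrow> holder p T \<alpha> (V' k l)"
  using V[of k] by (simp add: controlled_def)

lemma sn_bounded:
  assumes "cont_path p T Y"
  shows "inc_O T 0 (\<lambda>s t. \<Sum>i\<le>(N::nat). p i (Y s))" "inc_O T 0 (\<lambda>s t. \<Sum>i\<le>(N::nat). p i (Y t))"
proof -
  obtain B where "\<And>t. t \<in> {0..T} \<Longrightarrow> (\<Sum>i\<le>N. p i (Y t)) \<le> B"
    using cont_path_bounded[of p, OF p sum_sn(2) assms, of N] by blast
  then show "inc_O T 0 (\<lambda>s t. \<Sum>i\<le>N. p i (Y s))" "inc_O T 0 (\<lambda>s t. \<Sum>i\<le>N. p i (Y t))"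
    by (auto intro!: inc_O_bounded[where B = B] simp: abs_of_nonneg sum_nonneg seminorm_nonneg[OF p])
qed

lemma holder_inc_O: "holder p T \<beta> Y \<Longrightarrow> inc_O T \<beta> (\<lambda>s t. \<Sum>i\<le>(N::nat). p i (Y t - Y s))"
  unfolding holder_def by (rule inc_O_holder2[of p, OF p])

lemma seminorm_abs_le: "seminorm r \<Longrightarrow> r x \<le> B \<Longrightarrow> \<bar>r x\<bar> \<le> 1 * \<bar>B\<bar>"
  using seminorm_nonneg[of r x] by linarith

text \<open>Integrals from \<open>0\<close> determine those over \<open>[s, t]\<close>, to which the modulus of continuity of \<open>b\<close> and the sewing
  bound apply.\<close>

lemma integral_parts:
  "\<exists>I J. (\<forall>s t. 0 \<le> s \<and> s \<le> t \<and> t \<le> T \<longrightarrow> X t - X s = (I t - I s) + (J t - J s)) \<and>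
    (\<forall>N::nat. inc_o T (\<lambda>s t. \<Sum>i\<le>N. p i (I t - I s - (t - s) *\<^sub>R b s))) \<and>
    (\<forall>N::nat. inc_O T 1 (\<lambda>s t. \<Sum>i\<le>N. p i (I t - I s))) \<and>
    (\<forall>N::nat. inc_O T (sewing_exponent \<alpha>) (\<lambda>s t. \<Sum>i\<le>N. p i (J t - J s - rough_germ \<alpha> Z ZZ V V' s t)))"
proof -
  have "\<forall>t\<in>{0..T}. \<exists>I J. has_mesh_limit p (\<lambda>v w. (w - v) *\<^sub>R b v) 0 t I \<and>
      has_mesh_limit p (rough_germ \<alpha> Z ZZ V V') 0 t J \<and> X t = X 0 + (I + J)"
    using equation unfolding has_rdiff_integral_def has_dt_integral_def has_rough_integral_germ by fastforce
  from bchoice[OF this] obtain I where "\<forall>t\<in>{0..T}. \<exists>J. has_mesh_limit p (\<lambda>v w. (w - v) *\<^sub>R b v) 0 t (I t) \<and>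
      has_mesh_limit p (rough_germ \<alpha> Z ZZ V V') 0 t J \<and> X t = X 0 + (I t + J)" by blast
  from bchoice[OF this] obtain J where IJ: "\<And>t. t \<in> {0..T} \<Longrightarrow> has_mesh_limit p (\<lambda>v w. (w - v) *\<^sub>R b v) 0 t (I t)"
    "\<And>t. t \<in> {0..T} \<Longrightarrow> has_mesh_limit p (rough_germ \<alpha> Z ZZ V V') 0 t (J t)"
    "\<And>t. t \<in> {0..T} \<Longrightarrow> X t = X 0 + (I t + J t)"
    by blast
  have lim: "lim_q (\<lambda>x. \<Sum>i\<le>N. p i x) (\<lambda>v w. (w - v) *\<^sub>R b v) s t (I t - I s)"
    "lim_q (\<lambda>x. \<Sum>i\<le>N. p i x) (rough_germ \<alpha> Z ZZ V V') s t (J t - J s)"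
    if "0 \<le> s" "s \<le> t" "t \<le> T" for N s t
    using that IJ(1,2)[unfolded has_mesh_limit_iff_lim_q[of p, OF p]]
    by (intro lim_q_subinterval[OF sum_sn(1), of 0] lim_q_finite_sum; simp)+
  show ?thesis
  proof (rule exI[of _ I], rule exI[of _ J], intro conjI allI impI)
    fix s t assume "0 \<le> s \<and> s \<le> t \<and> t \<le> T"
    then show "X t - X s = (I t - I s) + (J t - J s)"
      using IJ(3)[of s] IJ(3)[of t] by simp
  next
    fix N
    let ?q = "\<lambda>x. \<Sum>i\<le>N. p i x"
    have pos: "0 \<le> ?q x" for x by (rule seminorm_nonneg[OF sum_sn(1)])
    show "inc_o T (\<lambda>s t. ?q (I t - I s - (t - s) *\<^sub>R b s))"
      unfolding inc_o_def
    proof (intro allI impI)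
      fix e :: real assume "e > 0"
      then obtain \<delta> where \<delta>: "\<delta> > 0" "\<forall>s\<in>{0..T}. \<forall>t\<in>{0..T}. \<bar>t - s\<bar> < \<delta> \<longrightarrow> ?q (b t - b s) < e"
        using cont_path_uniform[of p, OF p sum_sn(2) b, of e N] by blast
      have "\<bar>?q (I t - I s - (t - s) *\<^sub>R b s)\<bar> \<le> e * (t - s)" if st: "0 \<le> s \<and> s < t \<and> t \<le> T \<and> t - s < \<delta>" for s t
      proof -
        have "?q (I t - I s - (t - s) *\<^sub>R b s) \<le> e * (t - s)"
        proof (rule dt_integral_bound[OF sum_sn(1) _ lim(1)])
          fix r assume "s \<le> r" "r \<le> t"
          then show "?q (b r - b s) \<le> e" using \<delta>(2)[rule_format, of s r] st by simp
        qed (use st in auto)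
        then show ?thesis using pos by simp
      qed
      then show "\<exists>\<delta>>0. \<forall>s t. 0 \<le> s \<and> s < t \<and> t \<le> T \<and> t - s < \<delta> \<longrightarrow>
          \<bar>?q (I t - I s - (t - s) *\<^sub>R b s)\<bar> \<le> e * (t - s)"
        using \<delta>(1) by blast
    qed
  next
    fix N
    let ?q = "\<lambda>x. \<Sum>i\<le>N. p i x"
    have pos: "0 \<le> ?q x" for x by (rule seminorm_nonneg[OF sum_sn(1)])
    obtain B where B: "\<And>t. t \<in> {0..T} \<Longrightarrow> ?q (b t) \<le> B"
      using cont_path_bounded[of p, OF p sum_sn(2) b, of N] by blast
    show "inc_O T 1 (\<lambda>s t. ?q (I t - I s))"
    proof (rule inc_O_I)
      fix s t assume st: "0 \<le> s" "s < t" "t \<le> T"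
      have "?q (I t - I s - (t - s) *\<^sub>R 0) \<le> B * (t - s)"
        by (rule dt_integral_bound[OF sum_sn(1) st(2) lim(1)]) (use st B in auto)
      then show "\<bar>?q (I t - I s)\<bar> \<le> B * (t - s) powr 1" using pos st by simp
    qed
  next
    fix N
    let ?q = "\<lambda>x. \<Sum>i\<le>N. p i x"
    have pos: "0 \<le> ?q x" for x by (rule seminorm_nonneg[OF sum_sn(1)])
    obtain C where C: "\<And>s t I. 0 \<le> s \<and> s < t \<and> t \<le> T \<and> lim_q ?q (rough_germ \<alpha> Z ZZ V V') s t I \<Longrightarrow>
        ?q (I - rough_germ \<alpha> Z ZZ V V' s t) \<le> C * (t - s) powr sewing_exponent \<alpha>"
      using rough_germ_sewing[of p \<alpha> T Z ZZ V V' N, OF p Z \<alpha> V] by blast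
    show "inc_O T (sewing_exponent \<alpha>) (\<lambda>s t. ?q (J t - J s - rough_germ \<alpha> Z ZZ V V' s t))"
    proof (rule inc_O_I)
      fix s t assume st: "0 \<le> s" "s < t" "t \<le> T"
      then show "\<bar>?q (J t - J s - rough_germ \<alpha> Z ZZ V V' s t)\<bar> \<le> C * (t - s) powr sewing_exponent \<alpha>"
        using C[of s t "J t - J s"] lim(2)[of s t N] pos by simp
    qed
  qed
qed

lemma increment_first_order:
  "inc_o T (\<lambda>s t. \<Sum>i\<le>(N::nat). p i (X t - X s - ((t - s) *\<^sub>R b s + rough_germ \<alpha> Z ZZ V V' s t)))"
proof -
  obtain I J where IJ: "\<forall>s t. 0 \<le> s \<and> s \<le> t \<and> t \<le> T \<longrightarrow> X t - X s = (I t - I s) + (J t - J s)"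
    "inc_o T (\<lambda>s t. \<Sum>i\<le>N. p i (I t - I s - (t - s) *\<^sub>R b s))"
    "inc_O T (sewing_exponent \<alpha>) (\<lambda>s t. \<Sum>i\<le>N. p i (J t - J s - rough_germ \<alpha> Z ZZ V V' s t))"
    using integral_parts by blast
  have "1 < sewing_exponent \<alpha>" using \<alpha> by (auto simp: sewing_exponent_def)
  from inc_o_add[OF IJ(2) inc_O_imp_o[OF IJ(3) this]]
  show ?thesis
  proof (rule inc_o_le[of _ _ 1])
    fix s t assume "0 \<le> s" "s < t" "t \<le> T"
    then have eq: "X t - X s - ((t - s) *\<^sub>R b s + rough_germ \<alpha> Z ZZ V V' s t)
        = (I t - I s - (t - s) *\<^sub>R b s) + (J t - J s - rough_germ \<alpha> Z ZZ V V' s t)"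
      using IJ(1)[rule_format, of s t] by simp
    show "\<bar>\<Sum>i\<le>N. p i (X t - X s - ((t - s) *\<^sub>R b s + rough_germ \<alpha> Z ZZ V V' s t))\<bar>
        \<le> 1 * \<bar>(\<Sum>i\<le>N. p i (I t - I s - (t - s) *\<^sub>R b s)) + (\<Sum>i\<le>N. p i (J t - J s - rough_germ \<alpha> Z ZZ V V' s t))\<bar>"
      unfolding eq using seminorm_triangle[OF sum_sn(1)[of N]] seminorm_nonneg[OF sum_sn(1)[of N]] by simp
  qed simp
qed

text \<open>For \<open>\<alpha> \<le> 1/2\<close> the time integral and the second level are both \<open>O((t - s)\<^sup>2\<^sup>\<alpha>)\<close>, so \<open>V\<close> is a Gubinelli derivative of
  \<open>X\<close>.\<close>

lemma increment_controlled:
  assumes "\<alpha> \<le> 1/2"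
  shows "inc_O T (2 * \<alpha>) (\<lambda>s t. \<Sum>i\<le>(N::nat). p i (X t - X s - (\<Sum>k\<in>UNIV. (Z t - Z s) $ k *\<^sub>R V k s)))"
proof -
  let ?q = "\<lambda>x. \<Sum>i\<le>N. p i x"
  note q = sum_sn(1)[of N]
  obtain I J where IJ: "\<forall>s t. 0 \<le> s \<and> s \<le> t \<and> t \<le> T \<longrightarrow> X t - X s = (I t - I s) + (J t - J s)"
    "inc_O T 1 (\<lambda>s t. ?q (I t - I s))"
    "inc_O T (sewing_exponent \<alpha>) (\<lambda>s t. ?q (J t - J s - rough_germ \<alpha> Z ZZ V V' s t))"
    using integral_parts by blast
  let ?A = "\<lambda>s t. \<Sum>k\<in>UNIV. \<Sum>l\<in>UNIV. ZZ s t $ l $ k *\<^sub>R V' k l s"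
  let ?B = "\<lambda>s t. \<Sum>k\<in>UNIV. \<Sum>l\<in>UNIV. \<bar>ZZ s t $ l $ k\<bar> * ?q (V' k l s)"
  have V': "cont_path p T (V' k l)" for k l
    using assms \<alpha> by (intro holder_cont_path[of p, OF p, of \<alpha>] holder_V') auto
  have "inc_O T (2 * \<alpha> + 0) (\<lambda>s t. \<bar>ZZ s t $ l $ k\<bar> * ?q (V' k l s))" for k l
    by (intro inc_O_mult sn_bounded V' inc_O_le[OF geometric_holder_level2[OF Z assms, of l k], of _ 1]) simp
  then have "inc_O T (2 * \<alpha>) ?B" by (intro inc_O_sum) simp
  then have "inc_O T (2 * \<alpha>) (\<lambda>s t. ?q (I t - I s) + (?q (J t - J s - rough_germ \<alpha> Z ZZ V V' s t) + ?B s t))"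
    using IJ(2,3) assms \<alpha> by (intro inc_O_add) (auto simp: sewing_exponent_def intro: inc_O_mono)
  then show ?thesis
  proof (rule inc_O_le[of _ _ _ _ 1])
    fix s t assume "0 \<le> s" "s < t" "t \<le> T"
    then have eq: "X t - X s - (\<Sum>k\<in>UNIV. (Z t - Z s) $ k *\<^sub>R V k s)
        = (I t - I s) + ((J t - J s - rough_germ \<alpha> Z ZZ V V' s t) + ?A s t)"
      using IJ(1)[rule_format, of s t] assms by (simp add: rough_germ_def)
    have "?q (?A s t) \<le> ?B s t"
      by (intro order_trans[OF seminorm_sum[OF q] sum_mono])
        (simp add: seminorm_scale[OF q])
    then have "?q ((I t - I s) + ((J t - J s - rough_germ \<alpha> Z ZZ V V' s t) + ?A s t))
        \<le> ?q (I t - I s) + (?q (J t - J s - rough_germ \<alpha> Z ZZ V V' s t) + ?B s t)"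
      by (rule order_trans[OF seminorm_triangle[OF q] add_left_mono[OF order_trans[OF seminorm_triangle[OF q] add_left_mono]]])
    then show "\<bar>?q (X t - X s - (\<Sum>k\<in>UNIV. (Z t - Z s) $ k *\<^sub>R V k s))\<bar>
        \<le> 1 * \<bar>?q (I t - I s) + (?q (J t - J s - rough_germ \<alpha> Z ZZ V V' s t) + ?B s t)\<bar>"
      unfolding eq by (rule seminorm_abs_le[OF q])
  qed
qed

end

section \<open>The chain rule\<close>

locale rough_observable = rough_equation p \<alpha> T Z ZZ X b V V'
  for p :: "nat \<Rightarrow> 'e::real_vector \<Rightarrow> real" and \<alpha> T :: real
    and Z :: "real \<Rightarrow> real ^ 'k::finite" and ZZ :: "real \<Rightarrow> real \<Rightarrow> real ^ 'k ^ 'k"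
    and X :: "real \<Rightarrow> 'e" and b :: "real \<Rightarrow> 'e" and V :: "'k \<Rightarrow> real \<Rightarrow> 'e" and V' :: "'k \<Rightarrow> 'k \<Rightarrow> real \<Rightarrow> 'e" +
  fixes f :: "'e \<Rightarrow> real"
  assumes f: "Cb p (N_reg \<alpha> + 1) f"
begin

lemma N_reg_rough: "\<alpha> \<le> 1/2 \<Longrightarrow> N_reg \<alpha> + 1 = 3"
  and N_reg_ge: "\<alpha> < 1 \<Longrightarrow> 2 \<le> N_reg \<alpha> + 1"
  by (auto simp: N_reg_def)

lemma D_linear: "linear (\<lambda>v. Ddir f [v] x)"
  using f by (intro Ddir_linear[of p, OF p]) auto

lemma D2_bilinear: "\<alpha> < 1 \<Longrightarrow> bilinear (\<lambda>v w. Ddir f [v, w] x)"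
  using N_reg_ge by (intro Ddir_bilinear[of p, OF p f]) auto

lemma D2_symmetric: "\<alpha> < 1 \<Longrightarrow> Ddir f [v, w] x = Ddir f [w, v] x"
  using N_reg_ge by (intro Ddir_symmetric[of p, OF p f]) auto

text \<open>A sum \<open>q\<close> of seminorms and a constant \<open>C\<close> that bound all derivatives of \<open>f\<close> at once, chosen here so that
  the estimates below can share them.\<close>

definition bound_index :: nat where
  "bound_index = (SOME N. \<exists>C\<ge>0. deriv_bound (\<lambda>v. \<Sum>i\<le>N. p i v) C (N_reg \<alpha> + 1) f)"

definition q where "q x = (\<Sum>i\<le>bound_index. p i x)"

definition C where "C = (SOME C. 0 \<le> C \<and> deriv_bound q C (N_reg \<alpha> + 1) f)"

lemma C: "0 \<le> C" "deriv_bound q C (N_reg \<alpha> + 1) f"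
proof -
  have "\<exists>N. \<exists>C\<ge>0. deriv_bound (\<lambda>v. \<Sum>i\<le>N. p i v) C (N_reg \<alpha> + 1) f"
    using Cb_deriv_bound[of p, OF p f] by blast
  from someI_ex[OF this] have "\<exists>C. 0 \<le> C \<and> deriv_bound q C (N_reg \<alpha> + 1) f"
    unfolding q_def bound_index_def by blast
  from someI_ex[OF this] show "0 \<le> C" "deriv_bound q C (N_reg \<alpha> + 1) f"
    unfolding C_def by auto
qed

lemma q: "seminorm q" and q_nonneg: "0 \<le> q x"
  using sum_sn(1)[of bound_index] seminorm_nonneg[of q] by (simp_all add: q_def[abs_def])

lemma D_bound: "\<bar>Ddir f [v] x\<bar> \<le> C * q v"
  using C(2)[unfolded deriv_bound_def, rule_format, of "[v]" x] by (simp del: Ddir.simps)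

lemma D2_bound: "\<alpha> < 1 \<Longrightarrow> \<bar>Ddir f [v, w] x\<bar> \<le> C * (q v * q w)"
  using C(2)[unfolded deriv_bound_def, rule_format, of "[v, w]" x] N_reg_ge by (simp del: Ddir.simps)

lemma f_lipschitz: "\<bar>f (x + v) - f x\<bar> \<le> C * q v"
  using Ddir_taylor[OF q C(1) f C(2), of 1 "[]" x v] by simp

lemma D_lipschitz: "\<alpha> < 1 \<Longrightarrow> \<bar>Ddir f [w] (x + v) - Ddir f [w] x\<bar> \<le> C * (q v * q w)"
  using Ddir_taylor[OF q C(1) f C(2), of 1 "[w]" x v] N_reg_ge by (simp del: Ddir.simps(2))

lemma D2_lipschitz: "\<alpha> \<le> 1/2 \<Longrightarrow> \<bar>Ddir f [w, u] (x + v) - Ddir f [w, u] x\<bar> \<le> C * (q v * (q w * q u))"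
  using Ddir_taylor[OF q C(1) f C(2), of 1 "[w, u]" x v] N_reg_rough by (simp del: Ddir.simps(2))

lemma f_taylor2: "\<alpha> < 1 \<Longrightarrow> \<bar>f (x + v) - f x - Ddir f [v] x\<bar> \<le> C * (q v)\<^sup>2"
  using Ddir_taylor[OF q C(1) f C(2), of 2 "[]" x v] N_reg_ge
  by (simp del: Ddir.simps(2) add: numeral_2_eq_2 diff_diff_eq)

lemma D_taylor2: "\<alpha> \<le> 1/2 \<Longrightarrow> \<bar>Ddir f [w] (x + v) - Ddir f [w] x - Ddir f [v, w] x\<bar> \<le> C * ((q v)\<^sup>2 * q w)"
  using Ddir_taylor[OF q C(1) f C(2), of 2 "[w]" x v] N_reg_rough
  by (simp del: Ddir.simps(2) add: numeral_2_eq_2 diff_diff_eq)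

lemma f_taylor3: "\<alpha> \<le> 1/2 \<Longrightarrow> \<bar>f (x + v) - f x - Ddir f [v] x - Ddir f [v, v] x / 2\<bar> \<le> C * q v ^ 3"
  using Ddir_taylor[OF q C(1) f C(2), of 3 "[]" x v] N_reg_rough
  by (simp del: Ddir.simps(2) add: numeral_3_eq_3 numeral_2_eq_2 diff_diff_eq)

lemma q_bounded: "cont_path p T Y \<Longrightarrow> inc_O T 0 (\<lambda>s t. q (Y s))" "cont_path p T Y \<Longrightarrow> inc_O T 0 (\<lambda>s t. q (Y t))"
  unfolding q_def by (rule sn_bounded; assumption)+

lemma q_holder: "holder p T \<beta> Y \<Longrightarrow> inc_O T \<beta> (\<lambda>s t. q (Y t - Y s))"
  unfolding q_def by (rule holder_inc_O)

lemma q_increment_controlled: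
  "\<alpha> \<le> 1/2 \<Longrightarrow> inc_O T (2 * \<alpha>) (\<lambda>s t. q (X t - X s - (\<Sum>k\<in>UNIV. (Z t - Z s) $ k *\<^sub>R V k s)))"
  unfolding q_def by (rule increment_controlled)

text \<open>The germ of the integral equation for \<open>f (X t)\<close>.\<close>

definition observable_germ :: "real \<Rightarrow> real \<Rightarrow> real" where
  "observable_germ s t = (t - s) * Ddir f [b s] (X s)
     + rough_germ \<alpha> Z ZZ (\<lambda>k s. Ddir f [V k s] (X s)) (chain_gub f X V V') s t"

lemma D_remainder:
  "inc_o T (\<lambda>s t. Ddir f [X t - X s - ((t - s) *\<^sub>R b s + rough_germ \<alpha> Z ZZ V V' s t)] (X s))"
  using increment_first_order[of bound_index] C(1)
  by (rule inc_o_le) (use D_bound q_nonneg in \<open>simp add: q_def del: Ddir.simps\<close>)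

text \<open>For \<open>\<alpha> > 1/2\<close> the quadratic Taylor remainder is \<open>O((t - s)\<^sup>2\<^sup>\<alpha>)\<close> and thus negligible.\<close>

lemma observable_expansion_young:
  assumes "1/2 < \<alpha>" "\<alpha> < 1"
  shows "inc_o T (\<lambda>s t. f (X t) - f (X s) - observable_germ s t)"
proof -
  let ?R = "\<lambda>s t. X t - X s - ((t - s) *\<^sub>R b s + rough_germ \<alpha> Z ZZ V V' s t)"
  have "inc_O T (\<alpha> + \<alpha>) (\<lambda>s t. q (X t - X s) * q (X t - X s))"
    by (intro inc_O_mult q_holder X)
  then have "inc_O T (\<alpha> + \<alpha>) (\<lambda>s t. f (X t) - f (X s) - Ddir f [X t - X s] (X s))"
  proof (rule inc_O_le[where K = C])
    fix s t
    show "\<bar>f (X t) - f (X s) - Ddir f [X t - X s] (X s)\<bar> \<le> C * \<bar>q (X t - X s) * q (X t - X s)\<bar>"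
      using f_taylor2[OF assms(2), of "X s" "X t - X s"] by (simp add: power2_eq_square del: Ddir.simps)
  qed
  then have "inc_o T (\<lambda>s t. f (X t) - f (X s) - Ddir f [X t - X s] (X s))"
    by (rule inc_O_imp_o) (use assms in simp)
  from inc_o_add[OF this D_remainder]
  show ?thesis
  proof (rule inc_o_le[of _ _ 1])
    fix s t
    interpret D: linear "\<lambda>v. Ddir f [v] (X s)" by (rule D_linear)
    have "observable_germ s t = Ddir f [(t - s) *\<^sub>R b s + rough_germ \<alpha> Z ZZ V V' s t] (X s)"
      using assms by (simp add: observable_germ_def rough_germ_def D.add D.sum D.scale del: Ddir.simps)
    then show "\<bar>f (X t) - f (X s) - observable_germ s t\<bar>
        \<le> 1 * \<bar>f (X t) - f (X s) - Ddir f [X t - X s] (X s) + Ddir f [?R s t] (X s)\<bar>"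
      by (simp add: D.diff del: Ddir.simps)
  qed simp
qed

text \<open>For a geometric rough path the symmetric part of the second level is half the square of the
  increment, so the quadratic Taylor term is the part of the germ with the second derivative.\<close>

lemma quadratic_term:
  assumes "\<alpha> \<le> 1/2" "0 \<le> s" "s < t" "t \<le> T"
  shows "Ddir f [\<Sum>k\<in>UNIV. (Z t - Z s) $ k *\<^sub>R V k s, \<Sum>k\<in>UNIV. (Z t - Z s) $ k *\<^sub>R V k s] (X s) / 2
    = (\<Sum>k\<in>UNIV. \<Sum>l\<in>UNIV. ZZ s t $ l $ k * Ddir f [V l s, V k s] (X s))"
proof -
  have \<alpha>1: "\<alpha> < 1" using assms by simp
  let ?D = "\<lambda>k l. Ddir f [V k s, V l s] (X s)"
  have bil: "bilinear (\<lambda>v w. Ddir f [v, w] (X s))" by (rule D2_bilinear[OF \<alpha>1])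
  have "Ddir f [\<Sum>k\<in>UNIV. (Z t - Z s) $ k *\<^sub>R V k s, \<Sum>k\<in>UNIV. (Z t - Z s) $ k *\<^sub>R V k s] (X s)
      = (\<Sum>k\<in>UNIV. \<Sum>l\<in>UNIV. ((Z t - Z s) $ k * (Z t - Z s) $ l) * ?D k l)"
    unfolding bilinear_sum[OF bil] sum.cartesian_product[symmetric]
    by (simp add: bilinear_lmul[OF bil] bilinear_rmul[OF bil] mult_ac del: Ddir.simps vector_minus_component)
  also have "\<dots> = (\<Sum>k\<in>UNIV. \<Sum>l\<in>UNIV. ZZ s t $ k $ l * ?D k l) + (\<Sum>k\<in>UNIV. \<Sum>l\<in>UNIV. ZZ s t $ l $ k * ?D k l)"
    unfolding geometric_shuffle[OF Z assms, symmetric] by (simp only: distrib_right sum.distrib)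
  also have "(\<Sum>k\<in>UNIV. \<Sum>l\<in>UNIV. ZZ s t $ k $ l * ?D k l) = (\<Sum>k\<in>UNIV. \<Sum>l\<in>UNIV. ZZ s t $ l $ k * ?D l k)"
    by (rule sum.swap)
  also have "(\<Sum>k\<in>UNIV. \<Sum>l\<in>UNIV. ZZ s t $ l $ k * ?D k l) = (\<Sum>k\<in>UNIV. \<Sum>l\<in>UNIV. ZZ s t $ l $ k * ?D l k)"
    by (simp only: D2_symmetric[OF \<alpha>1, of "V _ s" "V _ s"])
  finally show ?thesis by simp
qed

text \<open>The Taylor remainder of third order is \<open>O((t - s)\<^sup>3\<^sup>\<alpha>)\<close>. So is the error made in the quadratic term by
  replacing \<open>X\<^sub>t - X\<^sub>s\<close> with \<open>V\<^sub>s (Z\<^sub>t - Z\<^sub>s)\<close>, after which that term belongs to the germ.\<close>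

lemma observable_expansion_rough:
  assumes "\<alpha> \<le> 1/2"
  shows "inc_o T (\<lambda>s t. f (X t) - f (X s) - observable_germ s t)"
proof -
  have \<alpha>1: "\<alpha> < 1" using assms by simp
  let ?R = "\<lambda>s t. X t - X s - ((t - s) *\<^sub>R b s + rough_germ \<alpha> Z ZZ V V' s t)"
  let ?W = "\<lambda>s t. \<Sum>k\<in>UNIV. (Z t - Z s) $ k *\<^sub>R V k s"
  let ?Q = "\<lambda>s t. X t - X s - ?W s t"
  note dX = q_holder[OF X]
  have "inc_O T (\<alpha> + 0) (\<lambda>s t. \<bar>(Z t - Z s) $ k\<bar> * q (V k s))" for k
    by (intro inc_O_mult q_bounded cont_V inc_O_le[OF geometric_holder_level1[OF Z \<alpha>(2), of k], of _ 1]) simp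
  then have "inc_O T \<alpha> (\<lambda>s t. \<Sum>k\<in>UNIV. \<bar>(Z t - Z s) $ k\<bar> * q (V k s))"
    by (intro inc_O_sum) simp
  then have W: "inc_O T \<alpha> (\<lambda>s t. q (?W s t))"
  proof (rule inc_O_le[of _ _ _ _ 1])
    fix s t
    have "q (?W s t) \<le> (\<Sum>k\<in>UNIV. \<bar>(Z t - Z s) $ k\<bar> * q (V k s))"
      by (intro order_trans[OF seminorm_sum[OF q] sum_mono]) (simp add: seminorm_scale[OF q])
    then show "\<bar>q (?W s t)\<bar> \<le> 1 * \<bar>\<Sum>k\<in>UNIV. \<bar>(Z t - Z s) $ k\<bar> * q (V k s)\<bar>"
      using q_nonneg[of "?W s t"] by linarith
  qed
  have inc_O_D2: "inc_O T \<beta> (\<lambda>s t. Ddir f [v s t, w s t] (X s))" if "inc_O T \<beta> (\<lambda>s t. q (v s t) * q (w s t))" for \<beta> v w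
    using that by (rule inc_O_le[where K = C]) (simp add: D2_bound[OF \<alpha>1] abs_mult q_nonneg del: Ddir.simps)
  have "inc_O T (\<alpha> + (\<alpha> + \<alpha>)) (\<lambda>s t. q (X t - X s) * (q (X t - X s) * q (X t - X s)))"
    by (intro inc_O_mult dX)
  then have A: "inc_O T (\<alpha> + (\<alpha> + \<alpha>))
      (\<lambda>s t. f (X t) - f (X s) - Ddir f [X t - X s] (X s) - Ddir f [X t - X s, X t - X s] (X s) / 2)"
  proof (rule inc_O_le[where K = C])
    fix s t
    show "\<bar>f (X t) - f (X s) - Ddir f [X t - X s] (X s) - Ddir f [X t - X s, X t - X s] (X s) / 2\<bar>
        \<le> C * \<bar>q (X t - X s) * (q (X t - X s) * q (X t - X s))\<bar>"
      using f_taylor3[OF assms, of "X s" "X t - X s"] q_nonneg[of "X t - X s"]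
      by (simp add: power3_eq_cube abs_mult mult.assoc del: Ddir.simps)
  qed
  have "inc_O T (2 * \<alpha> + \<alpha>) (\<lambda>s t. q (?Q s t) * q (X t - X s))" "inc_O T (\<alpha> + 2 * \<alpha>) (\<lambda>s t. q (?W s t) * q (?Q s t))"
    by (intro inc_O_mult dX W q_increment_controlled assms)+
  from this[THEN inc_O_D2]
  have "inc_O T (3 * \<alpha>) (\<lambda>s t. Ddir f [?Q s t, X t - X s] (X s))" "inc_O T (3 * \<alpha>) (\<lambda>s t. Ddir f [?W s t, ?Q s t] (X s))"
    using \<alpha>1 by (simp_all del: Ddir.simps)
  then have "inc_O T (3 * \<alpha>) (\<lambda>s t. Ddir f [?Q s t, X t - X s] (X s) + Ddir f [?W s t, ?Q s t] (X s))"
    by (rule inc_O_add)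
  then have "inc_O T (3 * \<alpha>) (\<lambda>s t. (f (X t) - f (X s) - Ddir f [X t - X s] (X s) - Ddir f [X t - X s, X t - X s] (X s) / 2)
      + (Ddir f [?Q s t, X t - X s] (X s) + Ddir f [?W s t, ?Q s t] (X s)) / 2)"
    using A by (intro inc_O_add inc_O_le[where K = "1/2" and r' = "\<lambda>s t. _ s t / 2"]) auto
  then have "inc_o T (\<lambda>s t. (f (X t) - f (X s) - Ddir f [X t - X s] (X s) - Ddir f [X t - X s, X t - X s] (X s) / 2)
      + (Ddir f [?Q s t, X t - X s] (X s) + Ddir f [?W s t, ?Q s t] (X s)) / 2)"
    by (rule inc_O_imp_o) (use \<alpha> in simp)
  from inc_o_add[OF this D_remainder]
  show ?thesis
  proof (rule inc_o_le[of _ _ 1])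
    fix s t assume st: "0 \<le> s" "s < t" "t \<le> T"
    interpret D: linear "\<lambda>v. Ddir f [v] (X s)" by (rule D_linear)
    have bil: "bilinear (\<lambda>v w. Ddir f [v, w] (X s))" by (rule D2_bilinear[OF \<alpha>1])
    have "Ddir f [X t - X s, X t - X s] (X s)
        = Ddir f [?W s t, ?W s t] (X s) + (Ddir f [?Q s t, X t - X s] (X s) + Ddir f [?W s t, ?Q s t] (X s))"
      unfolding bilinear_lsub[OF bil] bilinear_rsub[OF bil] by simp
    moreover have "rough_germ \<alpha> Z ZZ (\<lambda>k s. Ddir f [V k s] (X s)) (chain_gub f X V V') s t
        = Ddir f [rough_germ \<alpha> Z ZZ V V' s t] (X s) + Ddir f [?W s t, ?W s t] (X s) / 2"
      unfolding quadratic_term[OF assms st]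
      using assms by (simp add: rough_germ_def chain_gub_def D.add D.sum D.scale distrib_left sum.distrib del: Ddir.simps)
    moreover have "Ddir f [?R s t] (X s)
        = Ddir f [X t - X s] (X s) - ((t - s) * Ddir f [b s] (X s) + Ddir f [rough_germ \<alpha> Z ZZ V V' s t] (X s))"
      unfolding D.diff D.add D.scale by simp
    ultimately show "\<bar>f (X t) - f (X s) - observable_germ s t\<bar>
        \<le> 1 * \<bar>(f (X t) - f (X s) - Ddir f [X t - X s] (X s) - Ddir f [X t - X s, X t - X s] (X s) / 2)
          + (Ddir f [?Q s t, X t - X s] (X s) + Ddir f [?W s t, ?Q s t] (X s)) / 2 + Ddir f [?R s t] (X s)\<bar>"
      unfolding observable_germ_def by argo
  qed simp
qed

text \<open>For a Lipschitz driver only one derivative of \<open>f\<close> is available and it need not be Lipschitz. The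
  directions \<open>b\<^sub>s + c \<cdot> V\<^sub>s\<close>, with \<open>c\<close> in a ball that contains the difference quotients of \<open>Z\<close>, form a compact
  set, though, so joint continuity of \<open>(x, v) \<mapsto> Df(x) v\<close> becomes uniform where it is needed.\<close>

lemma observable_expansion_lipschitz:
  assumes "\<alpha> = 1"
  shows "inc_o T (\<lambda>s t. f (X t) - f (X s) - observable_germ s t)"
proof -
  from inc_O_choice[of T \<alpha> "\<lambda>k s t. (Z t - Z s) $ k", OF geometric_holder_level1[OF Z \<alpha>(2)], unfolded assms]
  obtain A where A: "\<And>k s t. 0 \<le> s \<and> s < t \<and> t \<le> T \<Longrightarrow> \<bar>(Z t - Z s) $ k\<bar> \<le> A k * (t - s) powr 1" by blast
  define B where "B = (\<Sum>k\<in>UNIV. A k)"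
  have Zlip: "norm (Z t - Z s) \<le> B * (t - s)" if "0 \<le> s" "s < t" "t \<le> T" for s t
  proof -
    have "norm (Z t - Z s) \<le> (\<Sum>k\<in>UNIV. \<bar>(Z t - Z s) $ k\<bar>)" by (rule norm_le_l1_cart)
    also have "\<dots> \<le> (\<Sum>k\<in>UNIV. A k * (t - s))" using A[of s t] that by (intro sum_mono) simp
    finally show ?thesis by (simp add: B_def sum_distrib_right)
  qed
  define W where "W s c = b s + (\<Sum>k\<in>UNIV. c $ k *\<^sub>R V k s)" for s and c :: "real ^ 'k"
  define K where "K = {0..T} \<times> cball (0 :: real ^ 'k) B \<times> {0..T}"
  define \<Phi> where "\<Phi> z = Ddir f [W (fst z) (fst (snd z))] (X (fst z) + snd (snd z) *\<^sub>R W (fst z) (fst (snd z)))"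
    for z :: "real \<times> (real ^ 'k) \<times> real"
  have path: "continuous_map (top_of_set K) (ftop p) (\<lambda>z. Y (fst z))" if "cont_path p T Y" for Y
  proof -
    have "continuous_map (top_of_set K) (top_of_set {0..T}) fst"
      by (auto simp: continuous_map_in_subtopology K_def intro!: continuous_intros)
    from continuous_map_compose[OF this that[unfolded cont_path_def]] show ?thesis by (simp add: o_def)
  qed
  have W: "continuous_map (top_of_set K) (ftop p) (\<lambda>z. W (fst z) (fst (snd z)))"
  proof -
    have "continuous_map (top_of_set K) (ftop p) (\<lambda>z. b (fst z) + 1 *\<^sub>R (\<Sum>k\<in>UNIV. fst (snd z) $ k *\<^sub>R V k (fst z)))"
      by (intro continuous_map_ftop_add_scale continuous_map_ftop_sum p path b cont_V)
        (auto intro!: continuous_intros)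
    then show ?thesis by (simp add: W_def)
  qed
  have "continuous_map (top_of_set K) (ftop p) (\<lambda>z. X (fst z) + snd (snd z) *\<^sub>R W (fst z) (fst (snd z)))"
    by (intro continuous_map_ftop_add_scale p path cont_X W) (auto intro!: continuous_intros)
  from Cb_continuous_map[of p, OF p f _ this, of 1 "\<lambda>_ z. W (fst z) (fst (snd z))"]
  have "continuous_on K \<Phi>" using W by (simp add: \<Phi>_def[abs_def])
  moreover have "compact K" unfolding K_def by (intro compact_Times) auto
  ultimately have uc: "uniformly_continuous_on K \<Phi>" by (rule compact_uniformly_continuous)
  let ?v = "\<lambda>s t. (t - s) *\<^sub>R b s + rough_germ \<alpha> Z ZZ V V' s t"
  have "inc_o T (\<lambda>s t. f (X s + ?v s t) - f (X s) - Ddir f [?v s t] (X s))"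
    unfolding inc_o_def
  proof (intro allI impI)
    fix e :: real assume "e > 0"
    then obtain \<delta> where \<delta>: "\<delta> > 0" "\<And>z z'. z \<in> K \<Longrightarrow> z' \<in> K \<Longrightarrow> dist z' z < \<delta> \<Longrightarrow> dist (\<Phi> z') (\<Phi> z) < e"
      using uc unfolding uniformly_continuous_on_def by blast
    have "\<bar>f (X s + ?v s t) - f (X s) - Ddir f [?v s t] (X s)\<bar> \<le> e * (t - s)"
      if st: "0 \<le> s \<and> s < t \<and> t \<le> T \<and> t - s < \<delta>" for s t
    proof -
      \<comment> \<open>the first-order increment of \<open>X\<close> is \<open>h\<close> times a direction from the compact set\<close>
      define h where "h = t - s"
      define c where "c = (1 / h) *\<^sub>R (Z t - Z s)"
      have h: "0 < h" "h \<le> T" "h < \<delta>" using st by (auto simp: h_def)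
      have v: "?v s t = h *\<^sub>R W s c"
        using h(1) assms by (simp add: rough_germ_def W_def c_def scaleR_right_distrib scaleR_sum_right flip: h_def)
      have c: "c \<in> cball 0 B"
        using Zlip[of s t] st h unfolding c_def mem_cball dist_0_norm norm_scaleR
        by (simp add: pos_divide_le_eq flip: h_def)
      obtain r where r: "0 < r" "r < h"
        "f (X s + h *\<^sub>R W s c) - f (X s + 0 *\<^sub>R W s c) = (h - 0) * Ddir f [W s c] (X s + r *\<^sub>R W s c)"
        using MVT2[OF h(1) Cb_has_derivative[OF f, of "[]" "X s" "W s c"]] by auto
      have "dist (\<Phi> (s, c, r)) (\<Phi> (s, c, 0)) < e"
        using \<delta>(2)[of "(s, c, 0)" "(s, c, r)"] st c r h T by (simp add: K_def dist_Pair_Pair dist_real_def)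
      then have "h * \<bar>\<Phi> (s, c, r) - \<Phi> (s, c, 0)\<bar> \<le> h * e" using h by (simp add: dist_real_def)
      moreover have "f (X s + h *\<^sub>R W s c) - f (X s) - Ddir f [h *\<^sub>R W s c] (X s)
          = h * (\<Phi> (s, c, r) - \<Phi> (s, c, 0))"
        using r(3) linear_scale[OF D_linear[of "X s"], of h "W s c"] by (simp add: \<Phi>_def right_diff_distrib del: Ddir.simps)
      ultimately show ?thesis unfolding v using h(1) by (simp add: abs_mult mult.commute flip: h_def del: Ddir.simps)
    qed
    then show "\<exists>\<delta>>0. \<forall>s t. 0 \<le> s \<and> s < t \<and> t \<le> T \<and> t - s < \<delta> \<longrightarrow>
        \<bar>f (X s + ?v s t) - f (X s) - Ddir f [?v s t] (X s)\<bar> \<le> e * (t - s)"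
      using \<delta>(1) by blast
  qed
  moreover have "inc_o T (\<lambda>s t. f (X t) - f (X s + ?v s t))"
    using increment_first_order[of bound_index] C(1)
  proof (rule inc_o_le)
    fix s t
    show "\<bar>f (X t) - f (X s + ?v s t)\<bar> \<le> C * \<bar>\<Sum>i\<le>bound_index. p i (X t - X s - ?v s t)\<bar>"
      using f_lipschitz[of "X s + ?v s t" "X t - X s - ?v s t"] q_nonneg[of "X t - X s - ?v s t"]
      by (simp add: q_def)
  qed
  ultimately have "inc_o T (\<lambda>s t. (f (X s + ?v s t) - f (X s) - Ddir f [?v s t] (X s)) + (f (X t) - f (X s + ?v s t)))"
    by (rule inc_o_add)
  then show ?thesis
  proof (rule inc_o_le[of _ _ 1])
    fix s t
    interpret D: linear "\<lambda>v. Ddir f [v] (X s)" by (rule D_linear)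
    have "\<not> \<alpha> \<le> 1/2" using assms by simp
    then have "observable_germ s t = Ddir f [?v s t] (X s)"
      by (simp add: observable_germ_def rough_germ_def D.add D.sum D.scale del: Ddir.simps)
    then show "\<bar>f (X t) - f (X s) - observable_germ s t\<bar>
        \<le> 1 * \<bar>(f (X s + ?v s t) - f (X s) - Ddir f [?v s t] (X s)) + (f (X t) - f (X s + ?v s t))\<bar>"
      by (simp del: Ddir.simps)
  qed simp
qed

lemma observable_expansion: "inc_o T (\<lambda>s t. f (X t) - f (X s) - observable_germ s t)"
  using observable_expansion_rough observable_expansion_young observable_expansion_lipschitz \<alpha>
  by (cases "\<alpha> \<le> 1/2"; cases "\<alpha> = 1") auto

text \<open>Summing the expansion over a partition telescopes. Since the sums of the \<open>dt\<close>-part converge, so do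
  those of the rough part: the rough integral exists without a separate construction.\<close>

theorem rough_chain_rule:
  assumes t: "t \<in> {0..T}"
  shows "\<exists>I. has_rdiff_integral \<alpha> Z ZZ real_sn (\<lambda>s. Ddir f [b s] (X s), \<lambda>k s. Ddir f [V k s] (X s))
      (chain_gub f X V V') t I \<and> f (X t) = f (X 0) + I"
proof -
  let ?E = "\<lambda>s t. f (X t) - f (X s) - observable_germ s t"
  let ?dt = "\<lambda>v w. (w - v) *\<^sub>R Ddir f [b v] (X v)"
  let ?germ = "rough_germ \<alpha> Z ZZ (\<lambda>k s. Ddir f [V k s] (X s)) (chain_gub f X V V')"
  have "continuous_map (top_of_set {0..T}) euclideanreal (\<lambda>z. Ddir f (map (\<lambda>i. b z) [0..<1]) (X z))"
    using cont_X b unfolding cont_path_def by (intro Cb_continuous_map[of p, OF p f]) auto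
  then have "cont_path real_sn T (\<lambda>s. Ddir f [b s] (X s))"
    by (simp add: cont_path_real del: Ddir.simps)
  then obtain I1 where I1: "has_dt_integral real_sn (\<lambda>s. Ddir f [b s] (X s)) 0 t I1"
    using has_dt_integral_exists[OF frechet_space_real_sn] t by (metis atLeastAtMost_iff)
  have "lim_q (real_sn 0) ?E 0 t 0"
    unfolding lim_q_iff[OF seminorm_real_sn]
  proof (intro allI impI)
    fix e :: real assume "e > 0"
    then have e: "e / (T + 1) > 0" using T by simp
    obtain \<delta> where \<delta>: "\<delta> > 0"
      "\<And>s t. 0 \<le> s \<and> s < t \<and> t \<le> T \<and> t - s < \<delta> \<Longrightarrow> \<bar>?E s t\<bar> \<le> e / (T + 1) * (t - s)"
      using observable_expansion e unfolding inc_o_def by meson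
    have "real_sn 0 (psum ?E ts - 0) < e" if ts: "partition_of 0 t ts" "finer \<delta> ts" for ts
    proof -
      have "real_sn 0 (psum ?E ts) \<le> e / (T + 1) * (t - 0)"
      proof (rule psum_bound[OF seminorm_real_sn ts])
        fix v w assume "0 \<le> v" "v < w" "w \<le> t" "w - v < \<delta>"
        then show "real_sn 0 (?E v w) \<le> e / (T + 1) * (w - v)"
          using \<delta>(2)[of v w] t by (simp add: real_sn_def)
      qed
      also have "\<dots> \<le> e / (T + 1) * T" using t e by (intro mult_left_mono) auto
      also have "\<dots> < e / (T + 1) * (T + 1)" using e by (intro mult_strict_left_mono) auto
      also have "\<dots> = e" using T by simp
      finally show ?thesis by simp
    qed
    then show "\<exists>\<delta>>0. \<forall>ts. partition_of 0 t ts \<longrightarrow> finer \<delta> ts \<longrightarrow> real_sn 0 (psum ?E ts - 0) < e"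
      using \<delta>(1) by blast
  qed
  then have "(psum ?E \<longlongrightarrow> 0) (meshes 0 t)" unfolding lim_q_real .
  moreover have "(psum ?dt \<longlongrightarrow> I1) (meshes 0 t)"
    using I1 unfolding has_dt_integral_def has_mesh_limit_real .
  ultimately have "((\<lambda>ts. (f (X t) - f (X 0)) - psum ?dt ts - psum ?E ts) \<longlongrightarrow> (f (X t) - f (X 0)) - I1 - 0) (meshes 0 t)"
    by (intro tendsto_diff tendsto_const)
  then have "(psum ?germ \<longlongrightarrow> (f (X t) - f (X 0)) - I1 - 0) (meshes 0 t)"
  proof (rule Lim_transform_eventually)
    show "\<forall>\<^sub>F ts in meshes 0 t. (f (X t) - f (X 0)) - psum ?dt ts - psum ?E ts = psum ?germ ts"
      using eventually_meshes_partition[of 0 t]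
    proof eventually_elim
      case (elim ts)
      have "psum ?dt ts + psum ?E ts + psum ?germ ts = psum (\<lambda>v w. f (X w) - f (X v)) ts"
        unfolding psum_add[symmetric] by (simp add: observable_germ_def del: Ddir.simps)
      also have "\<dots> = f (X t) - f (X 0)" by (rule psum_telescope_partition[OF elim])
      finally show ?case by linarith
    qed
  qed
  then have "has_rough_integral \<alpha> Z ZZ real_sn (\<lambda>k s. Ddir f [V k s] (X s)) (chain_gub f X V V') 0 t (f (X t) - f (X 0) - I1)"
    unfolding has_rough_integral_germ has_mesh_limit_real by simp
  then have "has_rdiff_integral \<alpha> Z ZZ real_sn (\<lambda>s. Ddir f [b s] (X s), \<lambda>k s. Ddir f [V k s] (X s))
      (chain_gub f X V V') t (I1 + (f (X t) - f (X 0) - I1))"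
    using I1 unfolding has_rdiff_integral_def fst_conv snd_conv by blast
  then show ?thesis by (intro exI[of _ "I1 + (f (X t) - f (X 0) - I1)"]) simp
qed

lemma observable_integrand_holder:
  assumes "\<alpha> < 1" and Y: "holder p T \<alpha> Y"
  shows "inc_O T \<alpha> (\<lambda>s t. Ddir f [Y t] (X t) - Ddir f [Y s] (X s))"
proof -
  have "cont_path p T Y" using \<alpha> by (intro holder_cont_path[of p, OF p _ Y]) simp
  then have "inc_O T (\<alpha> + 0) (\<lambda>s t. q (X t - X s) * q (Y s))"
    by (intro inc_O_mult q_holder X q_bounded)
  then have "inc_O T \<alpha> (\<lambda>s t. q (Y t - Y s) + q (X t - X s) * q (Y s))"
    using q_holder[OF Y] by (intro inc_O_add) auto
  then show ?thesis
  proof (rule inc_O_le[of _ _ _ _ C])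
    fix s t
    interpret D: linear "\<lambda>v. Ddir f [v] (X t)" by (rule D_linear)
    have "\<bar>Ddir f [Y t - Y s] (X t)\<bar> \<le> C * q (Y t - Y s)" by (rule D_bound)
    moreover have "\<bar>Ddir f [Y s] (X t) - Ddir f [Y s] (X s)\<bar> \<le> C * (q (X t - X s) * q (Y s))"
      using D_lipschitz[OF assms(1), of "Y s" "X s" "X t - X s"] by simp
    moreover have "0 \<le> q (Y t - Y s) + q (X t - X s) * q (Y s)" using q_nonneg by simp
    ultimately show "\<bar>Ddir f [Y t] (X t) - Ddir f [Y s] (X s)\<bar> \<le> C * \<bar>q (Y t - Y s) + q (X t - X s) * q (Y s)\<bar>"
      unfolding D.diff by (simp add: distrib_left del: Ddir.simps)
  qed
qed

lemma holder_V: "holder p T \<alpha> (V k)"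
  using V[of k] by (simp add: controlled_def)

lemma observable_second_derivative_holder:
  assumes "\<alpha> \<le> 1/2"
  shows "inc_O T \<alpha> (\<lambda>s t. Ddir f [V l t, V k t] (X t) - Ddir f [V l s, V k s] (X s))"
proof -
  have \<alpha>1: "\<alpha> < 1" using assms by simp
  have "inc_O T (\<alpha> + 0) (\<lambda>s t. q (V l t - V l s) * q (V k t))" "inc_O T (0 + \<alpha>) (\<lambda>s t. q (V l s) * q (V k t - V k s))"
    "inc_O T (\<alpha> + (0 + 0)) (\<lambda>s t. q (X t - X s) * (q (V l s) * q (V k s)))"
    by (intro inc_O_mult q_holder X q_bounded cont_V holder_V)+
  then have "inc_O T \<alpha> (\<lambda>s t. q (V l t - V l s) * q (V k t) + (q (V l s) * q (V k t - V k s)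
      + q (X t - X s) * (q (V l s) * q (V k s))))"
    by (intro inc_O_add) auto
  then show ?thesis
  proof (rule inc_O_le[of _ _ _ _ C])
    fix s t
    have bil: "bilinear (\<lambda>v w. Ddir f [v, w] (X t))" by (rule D2_bilinear[OF \<alpha>1])
    have "\<bar>Ddir f [V l t - V l s, V k t] (X t)\<bar> \<le> C * (q (V l t - V l s) * q (V k t))"
      "\<bar>Ddir f [V l s, V k t - V k s] (X t)\<bar> \<le> C * (q (V l s) * q (V k t - V k s))"
      by (rule D2_bound[OF \<alpha>1])+
    moreover have "\<bar>Ddir f [V l s, V k s] (X t) - Ddir f [V l s, V k s] (X s)\<bar> \<le> C * (q (X t - X s) * (q (V l s) * q (V k s)))"
      using D2_lipschitz[OF assms, of "V l s" "V k s" "X s" "X t - X s"] by simp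
    moreover have "0 \<le> q (V l t - V l s) * q (V k t) + (q (V l s) * q (V k t - V k s)
      + q (X t - X s) * (q (V l s) * q (V k s)))" using q_nonneg by simp
    ultimately show "\<bar>Ddir f [V l t, V k t] (X t) - Ddir f [V l s, V k s] (X s)\<bar>
        \<le> C * \<bar>q (V l t - V l s) * q (V k t) + (q (V l s) * q (V k t - V k s)
          + q (X t - X s) * (q (V l s) * q (V k s)))\<bar>"
      unfolding bilinear_lsub[OF bil] bilinear_rsub[OF bil] by (simp add: distrib_left del: Ddir.simps)
  qed
qed

text \<open>The increment of \<open>Df(X) V\<^sub>k\<close> splits into four errors of order \<open>2\<alpha>\<close>: the remainders of \<open>V\<^sub>k\<close> and of \<open>X\<close> as
  controlled paths, the Taylor remainder of \<open>Df\<close>, and the product of the increments of \<open>Df(X)\<close> and \<open>V\<^sub>k\<close>.\<close>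

lemma observable_integrand_remainder:
  assumes "\<alpha> \<le> 1/2"
  shows "inc_O T (2 * \<alpha>) (\<lambda>s t. Ddir f [V k t] (X t) - Ddir f [V k s] (X s)
    - (\<Sum>l\<in>UNIV. (Z t - Z s) $ l *\<^sub>R chain_gub f X V V' k l s))"
proof -
  have \<alpha>1: "\<alpha> < 1" using assms by simp
  let ?R = "\<lambda>s t. V k t - V k s - (\<Sum>l\<in>UNIV. (Z t - Z s) $ l *\<^sub>R V' k l s)"
  let ?Q = "\<lambda>s t. X t - X s - (\<Sum>l\<in>UNIV. (Z t - Z s) $ l *\<^sub>R V l s)"
  have "holder2 p T (2 * \<alpha>) ?R" using V[of k] assms by (simp add: controlled_def)
  then have "inc_O T (2 * \<alpha>) (\<lambda>s t. q (?R s t))" unfolding q_def by (rule inc_O_holder2[of p, OF p])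
  moreover have "inc_O T ((\<alpha> + \<alpha>) + 0) (\<lambda>s t. (q (X t - X s) * q (X t - X s)) * q (V k s))"
    "inc_O T (2 * \<alpha> + 0) (\<lambda>s t. q (?Q s t) * q (V k s))"
    "inc_O T (\<alpha> + \<alpha>) (\<lambda>s t. q (X t - X s) * q (V k t - V k s))"
    by (intro inc_O_mult q_holder X q_bounded cont_V holder_V q_increment_controlled assms)+
  ultimately have "inc_O T (2 * \<alpha>) (\<lambda>s t. q (?R s t) + ((q (X t - X s) * q (X t - X s)) * q (V k s)
      + (q (?Q s t) * q (V k s) + q (X t - X s) * q (V k t - V k s))))"
    by (intro inc_O_add) auto
  then show ?thesis
  proof (rule inc_O_le[of _ _ _ _ C])
    fix s t
    interpret D: linear "\<lambda>v. Ddir f [v] (X s)" by (rule D_linear)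
    interpret Dt: linear "\<lambda>v. Ddir f [v] (X t)" by (rule D_linear)
    have bil: "bilinear (\<lambda>v w. Ddir f [v, w] (X s))" by (rule D2_bilinear[OF \<alpha>1])
    interpret D2: linear "\<lambda>v. Ddir f [v, V k s] (X s)" using bil by (simp add: bilinear_def)
    have "\<bar>Ddir f [?R s t] (X s)\<bar> \<le> C * q (?R s t)" by (rule D_bound)
    moreover have "\<bar>Ddir f [V k s] (X t) - Ddir f [V k s] (X s) - Ddir f [X t - X s, V k s] (X s)\<bar>
        \<le> C * ((q (X t - X s) * q (X t - X s)) * q (V k s))"
      using D_taylor2[OF assms, of "V k s" "X s" "X t - X s"] by (simp add: power2_eq_square del: Ddir.simps)
    moreover have "\<bar>Ddir f [?Q s t, V k s] (X s)\<bar> \<le> C * (q (?Q s t) * q (V k s))" by (rule D2_bound[OF \<alpha>1])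
    moreover have "\<bar>Ddir f [V k t - V k s] (X t) - Ddir f [V k t - V k s] (X s)\<bar>
        \<le> C * (q (X t - X s) * q (V k t - V k s))"
      using D_lipschitz[OF \<alpha>1, of "V k t - V k s" "X s" "X t - X s"] by simp
    moreover have "Ddir f [V k t] (X t) - Ddir f [V k s] (X s)
        - (\<Sum>l\<in>UNIV. (Z t - Z s) $ l *\<^sub>R chain_gub f X V V' k l s)
      = Ddir f [?R s t] (X s)
        + ((Ddir f [V k s] (X t) - Ddir f [V k s] (X s) - Ddir f [X t - X s, V k s] (X s))
        + (Ddir f [?Q s t, V k s] (X s)
        + (Ddir f [V k t - V k s] (X t) - Ddir f [V k t - V k s] (X s))))"
      unfolding D.diff D.sum D.scale Dt.diff D2.diff D2.sum D2.scale chain_gub_def scaleR_right_distrib sum.distrib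
      by simp
    moreover have "0 \<le> q (?R s t) + ((q (X t - X s) * q (X t - X s)) * q (V k s)
      + (q (?Q s t) * q (V k s) + q (X t - X s) * q (V k t - V k s)))" using q_nonneg by simp
    ultimately show "\<bar>Ddir f [V k t] (X t) - Ddir f [V k s] (X s)
        - (\<Sum>l\<in>UNIV. (Z t - Z s) $ l *\<^sub>R chain_gub f X V V' k l s)\<bar>
      \<le> C * \<bar>q (?R s t) + ((q (X t - X s) * q (X t - X s)) * q (V k s)
          + (q (?Q s t) * q (V k s) + q (X t - X s) * q (V k t - V k s)))\<bar>"
      by (simp add: distrib_left del: Ddir.simps vector_minus_component)
  qed
qed

theorem observable_integrand_controlled:
  assumes "\<alpha> < 1"
  shows "controlled \<alpha> T Z real_sn (\<lambda>s. Ddir f [V k s] (X s)) (chain_gub f X V V' k)"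
  unfolding controlled_def
proof (intro conjI impI allI)
  show "holder real_sn T \<alpha> (\<lambda>s. Ddir f [V k s] (X s))"
    unfolding holder_def by (intro holder2_real_inc_O observable_integrand_holder assms holder_V)
next
  fix l assume \<alpha>2: "\<alpha> \<le> 1/2"
  have "inc_O T \<alpha> (\<lambda>s t. (Ddir f [V l t, V k t] (X t) - Ddir f [V l s, V k s] (X s))
      + (Ddir f [V' k l t] (X t) - Ddir f [V' k l s] (X s)))"
    by (intro inc_O_add observable_second_derivative_holder observable_integrand_holder assms \<alpha>2 holder_V')
  then show "holder real_sn T \<alpha> (chain_gub f X V V' k l)"
    unfolding holder_def chain_gub_def by (intro holder2_real_inc_O) (simp add: algebra_simps del: Ddir.simps)
next
  assume "\<alpha> \<le> 1/2"
  then show "holder2 real_sn T (2 * \<alpha>) (\<lambda>s t. Ddir f [V k t] (X t) - Ddir f [V k s] (X s)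
      - (\<Sum>l\<in>UNIV. (Z t - Z s) $ l *\<^sub>R chain_gub f X V V' k l s))"
    by (intro holder2_real_inc_O observable_integrand_remainder)
qed

end

section \<open>Algebra of integrals\<close>

lemma has_mesh_limit_cong:
  assumes p: "\<And>n. seminorm (p n)" and "\<And>v w. s \<le> v \<Longrightarrow> v < w \<Longrightarrow> w \<le> t \<Longrightarrow> \<Xi> v w = \<Theta> v w"
  shows "has_mesh_limit p \<Xi> s t I \<longleftrightarrow> has_mesh_limit p \<Theta> s t I"
  unfolding has_mesh_limit_iff_lim_q[of p, OF p] using lim_q_cong[of s t \<Xi> \<Theta>, OF assms(2)] by simp

lemma has_mesh_limit_add:
  assumes p: "\<And>n. seminorm (p n)" and "has_mesh_limit p \<Xi> s t I" "has_mesh_limit p \<Theta> s t J"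
  shows "has_mesh_limit p (\<lambda>v w. \<Xi> v w + \<Theta> v w) s t (I + J)"
  using assms(2,3) unfolding has_mesh_limit_iff_lim_q[of p, OF p] by (blast intro: lim_q_add p)

lemma has_mesh_limit_minus:
  assumes p: "\<And>n. seminorm (p n)" and "has_mesh_limit p \<Xi> s t I"
  shows "has_mesh_limit p (\<lambda>v w. - \<Xi> v w) s t (- I)"
  using assms(2) unfolding has_mesh_limit_iff_lim_q[of p, OF p] by (blast intro: lim_q_minus p)

lemma has_mesh_limit_prod:
  assumes p: "\<And>n. seminorm (p n)" and q: "\<And>n. seminorm (q n)"
    and I: "has_mesh_limit p \<Xi> s t I" and J: "has_mesh_limit q \<Theta> s t J"
  shows "has_mesh_limit (prod_sn p q) (\<lambda>v w. (\<Xi> v w, \<Theta> v w)) s t (I, J)"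
proof -
  have pq: "seminorm (prod_sn p q n)" for n by (intro seminorm_prod_sn p q)
  have eq: "prod_sn p q n (psum (\<lambda>v w. (\<Xi> v w, \<Theta> v w)) ts - (I, J)) = p n (psum \<Xi> ts - I) + q n (psum \<Theta> ts - J)" for n ts
    by (simp add: prod_sn_def psum_def fst_sum snd_sum)
  show ?thesis
    using I J
    unfolding has_mesh_limit_iff_lim_q[of p, OF p] has_mesh_limit_iff_lim_q[of q, OF q]
      has_mesh_limit_iff_lim_q[of "prod_sn p q", OF pq] lim_q_def eq
    by (auto intro: tendsto_add_zero)
qed

lemma has_dt_integral_add:
  assumes "\<And>n. seminorm (p n)" "has_dt_integral p F s t I" "has_dt_integral p G s t J"
  shows "has_dt_integral p (\<lambda>s. F s + G s) s t (I + J)"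
  using has_mesh_limit_add[of p, OF assms(1)] assms(2,3) unfolding has_dt_integral_def scaleR_right_distrib by blast

lemma has_dt_integral_minus:
  assumes "\<And>n. seminorm (p n)" "has_dt_integral p F s t I"
  shows "has_dt_integral p (\<lambda>s. - F s) s t (- I)"
  using has_mesh_limit_minus[of p, OF assms(1)] assms(2) unfolding has_dt_integral_def scaleR_minus_right by blast

lemma has_dt_integral_prod:
  assumes "\<And>n. seminorm (p n)" "\<And>n. seminorm (q n)" "has_dt_integral p F s t I" "has_dt_integral q G s t J"
  shows "has_dt_integral (prod_sn p q) (\<lambda>s. (F s, G s)) s t (I, J)"
  using has_mesh_limit_prod[of p q, OF assms(1,2)] assms(3,4) unfolding has_dt_integral_def scaleR_Pair by blast

lemma rough_germ_minus:
  "rough_germ \<alpha> Z ZZ (\<lambda>k s. - Y k s) (\<lambda>k l s. - Y' k l s) v w = - rough_germ \<alpha> Z ZZ Y Y' v w"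
  by (simp add: rough_germ_def sum_negf)

lemma rough_germ_Pair:
  "rough_germ \<alpha> Z ZZ (\<lambda>k s. (Y k s, W k s)) (\<lambda>k l s. (Y' k l s, W' k l s)) v w
    = (rough_germ \<alpha> Z ZZ Y Y' v w, rough_germ \<alpha> Z ZZ W W' v w)"
  by (simp add: rough_germ_def prod_eq_iff fst_sum snd_sum)

lemma has_rough_integral_minus:
  assumes "\<And>n. seminorm (p n)" "has_rough_integral \<alpha> Z ZZ p Y Y' s t I"
  shows "has_rough_integral \<alpha> Z ZZ p (\<lambda>k s. - Y k s) (\<lambda>k l s. - Y' k l s) s t (- I)"
  using has_mesh_limit_minus[of p, OF assms(1)] assms(2) unfolding has_rough_integral_germ rough_germ_minus[abs_def] .

lemma has_rough_integral_prod:
  assumes "\<And>n. seminorm (p n)" "\<And>n. seminorm (q n)"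
    "has_rough_integral \<alpha> Z ZZ p Y Y' s t I" "has_rough_integral \<alpha> Z ZZ q W W' s t J"
  shows "has_rough_integral \<alpha> Z ZZ (prod_sn p q) (\<lambda>k s. (Y k s, W k s)) (\<lambda>k l s. (Y' k l s, W' k l s)) s t (I, J)"
  using has_mesh_limit_prod[of p q, OF assms(1,2)] assms(3,4)
  unfolding has_rough_integral_germ rough_germ_Pair[abs_def] by blast

lemma has_rdiff_integral_cong:
  assumes p: "\<And>n. seminorm (p n)"
    and F: "\<And>s. s \<in> {0..t} \<Longrightarrow> F s = G s" and Y: "\<And>s k. s \<in> {0..t} \<Longrightarrow> Y k s = W k s"
  shows "has_rdiff_integral \<alpha> Z ZZ p (F, Y) Y' t I \<longleftrightarrow> has_rdiff_integral \<alpha> Z ZZ p (G, W) Y' t I"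
proof -
  have "has_dt_integral p F 0 t J \<longleftrightarrow> has_dt_integral p G 0 t J" for J
    unfolding has_dt_integral_def using F by (intro has_mesh_limit_cong[of p, OF p]) simp
  moreover have "has_rough_integral \<alpha> Z ZZ p Y Y' 0 t J \<longleftrightarrow> has_rough_integral \<alpha> Z ZZ p W Y' 0 t J" for J
    unfolding has_rough_integral_def using Y by (intro has_mesh_limit_cong[of p, OF p]) simp
  ultimately show ?thesis unfolding has_rdiff_integral_def by simp
qed

lemma holder2_cong:
  assumes "holder2 p T \<beta> \<Xi>" "\<And>s t. 0 \<le> s \<Longrightarrow> s < t \<Longrightarrow> t \<le> T \<Longrightarrow> \<Xi> s t = \<Theta> s t"
  shows "holder2 p T \<beta> \<Theta>"
  using assms unfolding holder2_def by (metis (no_types, lifting))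

lemma controlled_cong:
  assumes "controlled \<alpha> T Z p Y Y'" "\<And>s. s \<in> {0..T} \<Longrightarrow> Y s = W s"
  shows "controlled \<alpha> T Z p W Y'"
  using assms unfolding controlled_def holder_def by (auto elim!: holder2_cong)

lemma controlled_minus:
  assumes "controlled \<alpha> T Z p Y Y'"
  shows "controlled \<alpha> T Z p (\<lambda>s. - Y s) (\<lambda>l s. - Y' l s)"
proof -
  have eq: "(\<lambda>s t. - Y t - - Y s) = (\<lambda>s t. - (Y t - Y s))"
    "\<And>l. (\<lambda>s t. - Y' l t - - Y' l s) = (\<lambda>s t. - (Y' l t - Y' l s))"
    "(\<lambda>s t. - Y t - - Y s - (\<Sum>k\<in>UNIV. (Z t - Z s) $ k *\<^sub>R - Y' k s))
      = (\<lambda>s t. - (Y t - Y s - (\<Sum>k\<in>UNIV. (Z t - Z s) $ k *\<^sub>R Y' k s)))"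
    by (simp_all add: sum_negf fun_eq_iff diff_diff_eq2 diff_add_eq add.commute)
  show ?thesis using assms unfolding controlled_def holder_def eq holder2_minus .
qed

lemma controlled_prod:
  assumes p: "\<And>n. seminorm (p n)" and q: "\<And>n. seminorm (q n)"
    and Y: "controlled \<alpha> T Z p Y Y'" and W: "controlled \<alpha> T Z q W W'"
  shows "controlled \<alpha> T Z (prod_sn p q) (\<lambda>s. (Y s, W s)) (\<lambda>l s. (Y' l s, W' l s))"
proof -
  have "(Y t, W t) - (Y s, W s) - (\<Sum>k\<in>UNIV. (Z t - Z s) $ k *\<^sub>R (Y' k s, W' k s))
      = (Y t - Y s - (\<Sum>k\<in>UNIV. (Z t - Z s) $ k *\<^sub>R Y' k s), W t - W s - (\<Sum>k\<in>UNIV. (Z t - Z s) $ k *\<^sub>R W' k s))" for s t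
    by (simp add: prod_eq_iff fst_sum snd_sum)
  then show ?thesis
    using Y W unfolding controlled_def holder_def by (auto intro!: holder2_prod p q)
qed

section \<open>Functional derivatives\<close>

lemma dual_density_involution: "snd F \<le> 1 \<Longrightarrow> dual_density (dual_density F) = F"
proof -
  have "dual_summand (dual_summand A) = A" for A by (cases A) auto
  then show "snd F \<le> 1 \<Longrightarrow> dual_density (dual_density F) = F"
    by (simp add: dual_density_def prod_eq_iff map_idI)
qed

lemma one_form_densities_dual: "one_form_densities = dual_density tangent_bundle"
  by (simp add: one_form_densities_def tangent_bundle_def dual_density_def)

lemma emb_zero: "function_space \<A> F E \<Longrightarrow> emb E 0 \<phi> = 0"
  unfolding function_space_def by (metis linear_0)

text \<open>The pairings are nondegenerate because they test distributions against smooth sections, and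
  distributions are determined by these values.\<close>

lemma pairing_nondegenerate_left:
  assumes F: "snd F \<le> 1" and EV: "function_space \<A> (dual_density F) EV" and E: "function_space \<A> F E"
    and B: "pairing_extends \<A> F EV E B" and l: "\<And>e. B l e = 0"
  shows "l = 0"
proof -
  have "emb EV l \<phi> = 0" for \<phi>
  proof (cases "smooth_section \<A> F \<phi>")
    case True
    then obtain e where "emb E e = of_smooth \<A> F \<phi>" using E unfolding function_space_def by (metis rangeE)
    then show ?thesis using B l True unfolding pairing_extends_def by metis
  next
    case False
    have "distribution \<A> (dual_density F) (emb EV l)" using EV by (simp add: function_space_def)
    then show ?thesis using False unfolding distribution_def dual_density_involution[OF F] by blast
  qed
  then have "emb EV l = emb EV 0" using emb_zero[OF EV] by (simp add: fun_eq_iff)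
  then show ?thesis using EV unfolding function_space_def by (metis injD)
qed

lemma pairing_nondegenerate_right:
  assumes EV: "function_space \<A> (dual_density F) EV" and E: "function_space \<A> F E"
    and B: "pairing_extends \<A> F EV E B" and e: "\<And>l. B l e = 0"
  shows "e = 0"
proof -
  have "emb E e \<phi> = 0" for \<phi>
  proof (cases "smooth_section \<A> (dual_density F) \<phi>")
    case True
    then obtain l where "emb EV l = of_smooth \<A> (dual_density F) \<phi>" using EV unfolding function_space_def by (metis rangeE)
    then show ?thesis using B e True unfolding pairing_extends_def by metis
  next
    case False
    have "distribution \<A> F (emb E e)" using E by (simp add: function_space_def)
    then show ?thesis using False unfolding distribution_def by blast
  qed
  then have "emb E e = emb E 0" using emb_zero[OF E] by (simp add: fun_eq_iff)
  then show ?thesis using E unfolding function_space_def by (metis injD)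
qed

context
  fixes S :: "('m::t2_space, 'd::finite, 'x::real_vector, 'xv::real_vector, 'a::real_vector, 'av::real_vector) setting"
  assumes S: "geometric_setting S"
begin

lemma setting_spaces:
  "function_space (atlas S) tangent_bundle (spX S)"
  "function_space (atlas S) (dual_density tangent_bundle) (spXV S)"
  "function_space (atlas S) (bundle_A S) (spA S)"
  "function_space (atlas S) (dual_density (bundle_A S)) (spAV S)"
  using S by (auto simp: geometric_setting_def one_form_densities_dual)

lemma setting_pairings:
  "pairing_extends (atlas S) tangent_bundle (spXV S) (spX S) (pairX S)"
  "pairing_extends (atlas S) (bundle_A S) (spAV S) (spA S) (pairA S)"
  using S by (auto simp: geometric_setting_def)

lemma setting_bilinear: "bilinear (pairX S)" "bilinear (pairA S)" "bilinear (diamond S)"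
  using setting_pairings S by (auto simp: pairing_extends_def geometric_setting_def is_diamond_def)

lemma setting_frechet: "frechet_space (sn (spXV S))" "frechet_space (sn (spA S))" "frechet_space (sn (spAV S))"
  using setting_spaces by (auto simp: function_space_def)

lemma setting_seminorm: "seminorm (sn (spXV S) n)" "seminorm (sn (spA S) n)"
  using setting_frechet by (auto intro: frechet_seminorm)

lemma has_ham_deriv_unique:
  assumes "has_ham_deriv S f m a x \<phi>" "has_ham_deriv S f m a y \<psi>"
  shows "x = y" "\<phi> = \<psi>"
proof -
  have eq: "pairX S dm x + pairA S \<phi> da = pairX S dm y + pairA S \<psi> da" for dm da
    using assms DERIV_unique unfolding has_ham_deriv_def by blast
  have "pairX S dm (x - y) = 0" for dm
    using eq[of dm 0] by (simp add: bilinear_rsub bilinear_rzero setting_bilinear)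
  then show "x = y"
    using pairing_nondegenerate_right[OF setting_spaces(2,1) setting_pairings(1), of "x - y"] by simp
  have "pairA S (\<phi> - \<psi>) da = 0" for da
    using eq[of 0 da] by (simp add: bilinear_lsub bilinear_lzero setting_bilinear)
  then show "\<phi> = \<psi>"
    using pairing_nondegenerate_left[OF _ setting_spaces(4,3) setting_pairings(2), of "\<phi> - \<psi>"]
    by (simp add: bundle_A_def)
qed

lemma functional_derivatives_eq:
  assumes "has_ham_deriv S f m a x \<phi>"
  shows "df_dm S f m a = x" "df_da S f m a = \<phi>"
  unfolding df_dm_def df_da_def using assms has_ham_deriv_unique by blast+

lemma functional_derivatives:
  assumes "\<exists>x \<phi>. has_ham_deriv S f m a x \<phi>"
  shows "has_ham_deriv S f m a (df_dm S f m a) (df_da S f m a)"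
  using assms functional_derivatives_eq by metis

lemma has_ham_deriv_Gham: "has_ham_deriv S (Gham S \<xi> k) m a (\<xi> k) 0"
  unfolding has_ham_deriv_def Gham_def
  by (auto simp: bilinear_ladd bilinear_lmul bilinear_lzero setting_bilinear intro!: derivative_eq_intros)

lemma Ddir_functional:
  assumes "\<exists>x \<phi>. has_ham_deriv S f m a x \<phi>"
  shows "Ddir f [(dm, da)] (m, a) = pairX S dm (df_dm S f m a) + pairA S (df_da S f m a) da"
  using functional_derivatives[OF assms] unfolding has_ham_deriv_def by (simp add: DERIV_imp_deriv)

text \<open>The direction on the right is the Hamiltonian vector field of \<open>k\<close>. Pairing it with the functional derivatives
  of \<open>f\<close> is differentiating \<open>f\<close> along it.\<close>

lemma LP_bracket_eq_Ddir:
  assumes "\<exists>x \<phi>. has_ham_deriv S f m a x \<phi>" and k: "has_ham_deriv S k m a y \<psi>"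
  shows "LP_bracket S f k (m, a) = Ddir f [(- adstar S y m - diamond S \<psi> a, - lieA S y a)] (m, a)"
  unfolding Ddir_functional[OF assms(1)] LP_bracket_def
  by (simp add: functional_derivatives_eq[OF k] bilinear_ladd bilinear_lsub bilinear_lneg bilinear_rneg setting_bilinear)

lemma cont_path_diamond:
  assumes "cont_path (sn (spAV S)) T \<phi>" "cont_path (sn (spA S)) T a"
  shows "cont_path (sn (spXV S)) T (\<lambda>t. diamond S (\<phi> t) (a t))"
proof -
  have "continuous_map (prod_topology (ftop (sn (spAV S))) (ftop (sn (spA S)))) (ftop (sn (spXV S))) (\<lambda>(\<phi>, a). diamond S \<phi> a)"
    using S by (simp add: geometric_setting_def is_diamond_def)
  moreover have "continuous_map (top_of_set {0..T}) (prod_topology (ftop (sn (spAV S))) (ftop (sn (spA S)))) (\<lambda>t. (\<phi> t, a t))"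
    using assms unfolding cont_path_def by (simp add: continuous_map_paired)
  ultimately have "continuous_map (top_of_set {0..T}) (ftop (sn (spXV S))) ((\<lambda>(\<phi>, a). diamond S \<phi> a) \<circ> (\<lambda>t. (\<phi> t, a t)))"
    by (intro continuous_map_compose)
  then show ?thesis by (simp add: cont_path_def o_def)
qed

text \<open>The Lie--Poisson equation for \<open>m\<close> only provides the integral of the sum of the coadjoint and the diamond term. The
  latter is continuous, hence integrable by itself, and removing it leaves the integral in the Euler--Poincare
  equation.\<close>

lemma euler_poincare_iff_lie_poisson:
  assumes T: "0 < T" and D: "cont_path (sn (spXV S)) T (\<lambda>s. diamond S (dL_da S L (u s) (a s)) (a s))"
    and dhm: "\<And>t. t \<in> {0..T} \<Longrightarrow> fst dhm t = u t" "\<And>t k. t \<in> {0..T} \<Longrightarrow> snd dhm k t = \<xi> k"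
    and dha: "\<And>t. t \<in> {0..T} \<Longrightarrow> fst dha t = - dL_da S L (u t) (a t)" "\<And>t k. t \<in> {0..T} \<Longrightarrow> snd dha k t = 0"
  shows "euler_poincare S \<alpha> T Z ZZ L u (u, \<lambda>k t. \<xi> k) m a M' A' \<longleftrightarrow> lie_poisson S \<alpha> T Z ZZ dhm dha m a M' A'"
proof -
  note sn = setting_seminorm
  let ?D = "\<lambda>s. diamond S (dL_da S L (u s) (a s)) (a s)"
  let ?F = "\<lambda>s. adstar S (u s) (m s)" and ?Y = "\<lambda>k s. adstar S (\<xi> k) (m s)"
  have m_eq: "(\<exists>I J. has_rdiff_integral \<alpha> Z ZZ (sn (spXV S)) (?F, ?Y) M' t I \<and>
        has_dt_integral (sn (spXV S)) ?D 0 t J \<and> m t + I = m 0 + J) \<longleftrightarrow>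
      (\<exists>I. has_rdiff_integral \<alpha> Z ZZ (sn (spXV S)) (\<lambda>s. ?F s + - ?D s, ?Y) M' t I \<and> m t = m 0 - I)"
    (is "?EP \<longleftrightarrow> ?LP") if t: "t \<in> {0..T}" for t
  proof
    assume ?EP
    then obtain I1 I2 J where I: "has_dt_integral (sn (spXV S)) ?F 0 t I1"
      "has_rough_integral \<alpha> Z ZZ (sn (spXV S)) ?Y M' 0 t I2"
      "has_dt_integral (sn (spXV S)) ?D 0 t J" "m t + (I1 + I2) = m 0 + J"
      unfolding has_rdiff_integral_def by auto
    have "has_dt_integral (sn (spXV S)) (\<lambda>s. ?F s + - ?D s) 0 t (I1 + - J)"
      by (intro has_dt_integral_add has_dt_integral_minus sn I)
    with I(2) have "has_rdiff_integral \<alpha> Z ZZ (sn (spXV S)) (\<lambda>s. ?F s + - ?D s, ?Y) M' t ((I1 + - J) + I2)"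
      unfolding has_rdiff_integral_def fst_conv snd_conv by blast
    moreover have "m t = m 0 - ((I1 + - J) + I2)" using I(4) by (simp add: algebra_simps)
    ultimately show ?LP by blast
  next
    assume ?LP
    then obtain I1 I2 where I: "has_dt_integral (sn (spXV S)) (\<lambda>s. ?F s + - ?D s) 0 t I1"
      "has_rough_integral \<alpha> Z ZZ (sn (spXV S)) ?Y M' 0 t I2" "m t = m 0 - (I1 + I2)"
      unfolding has_rdiff_integral_def by auto
    obtain J where J: "has_dt_integral (sn (spXV S)) ?D 0 t J"
      using has_dt_integral_exists[OF setting_frechet(1) D] t by auto
    have "has_dt_integral (sn (spXV S)) (\<lambda>s. (?F s + - ?D s) + ?D s) 0 t (I1 + J)"
      by (intro has_dt_integral_add sn I J)
    then have "has_rdiff_integral \<alpha> Z ZZ (sn (spXV S)) (?F, ?Y) M' t ((I1 + J) + I2)"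
      using I(2) unfolding has_rdiff_integral_def fst_conv snd_conv by auto
    moreover have "m t + ((I1 + J) + I2) = m 0 + J" using I(3) by (simp add: algebra_simps)
    ultimately show ?EP using J by blast
  qed
  have m_cong: "has_rdiff_integral \<alpha> Z ZZ (sn (spXV S))
        (\<lambda>s. adstar S (fst dhm s) (m s) + diamond S (fst dha s) (a s),
         \<lambda>k s. adstar S (snd dhm k s) (m s) + diamond S (snd dha k s) (a s)) M' t I
      \<longleftrightarrow> has_rdiff_integral \<alpha> Z ZZ (sn (spXV S)) (\<lambda>s. ?F s + - ?D s, ?Y) M' t I" if "t \<in> {0..T}" for t I
    using that dhm dha
    by (intro has_rdiff_integral_cong sn) (simp_all add: bilinear_lneg bilinear_lzero setting_bilinear)
  have a_cong: "has_rdiff_integral \<alpha> Z ZZ (sn (spA S))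
        (\<lambda>s. lieA S (fst dhm s) (a s), \<lambda>k s. lieA S (snd dhm k s) (a s)) A' t I
      \<longleftrightarrow> has_rdiff_integral \<alpha> Z ZZ (sn (spA S)) (\<lambda>s. lieA S (u s) (a s), \<lambda>k s. lieA S (\<xi> k) (a s)) A' t I"
    if "t \<in> {0..T}" for t I
    using that dhm by (intro has_rdiff_integral_cong sn) simp_all
  show ?thesis
    unfolding euler_poincare_def lie_poisson_def fst_conv snd_conv
  proof (intro ball_cong refl)
    fix t assume t: "t \<in> {0..T}"
    show "((\<exists>I J. has_rdiff_integral \<alpha> Z ZZ (sn (spXV S)) (?F, ?Y) M' t I \<and>
          has_dt_integral (sn (spXV S)) ?D 0 t J \<and> m t + I = m 0 + J) \<and>
        (\<exists>I. has_rdiff_integral \<alpha> Z ZZ (sn (spA S))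
          (\<lambda>s. lieA S (u s) (a s), \<lambda>k s. lieA S (\<xi> k) (a s)) A' t I \<and> a t + I = a 0)) \<longleftrightarrow>
      ((\<exists>I. has_rdiff_integral \<alpha> Z ZZ (sn (spXV S))
          (\<lambda>s. adstar S (fst dhm s) (m s) + diamond S (fst dha s) (a s),
           \<lambda>k s. adstar S (snd dhm k s) (m s) + diamond S (snd dha k s) (a s)) M' t I \<and> m t = m 0 - I) \<and>
        (\<exists>I. has_rdiff_integral \<alpha> Z ZZ (sn (spA S))
          (\<lambda>s. lieA S (fst dhm s) (a s), \<lambda>k s. lieA S (snd dhm k s) (a s)) A' t I \<and> a t = a 0 - I))"
      unfolding m_cong[OF t] a_cong[OF t] m_eq[OF t] by (simp only: eq_diff_eq)
  qed
qed

end

text \<open>The coupled system becomes a single equation in the product space; the signs come from moving the transport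
  terms to the right-hand side.\<close>

lemma euler_poincare_rough_equation:
  fixes S :: "('m::t2_space, 'd::finite, 'x::real_vector, 'xv::real_vector, 'a::real_vector, 'av::real_vector) setting"
    and Z :: "real \<Rightarrow> real ^ 'k::finite"
  assumes S: "geometric_setting S"
    and T: "T > 0" and \<alpha>: "1/3 < \<alpha>" "\<alpha> \<le> 1" and Z: "geometric_rough_path \<alpha> T Z ZZ"
    and m: "holder (sn (spXV S)) T \<alpha> m" and a: "holder (sn (spA S)) T \<alpha> a"
    and D: "cont_path (sn (spXV S)) T (\<lambda>s. diamond S (dL_da S L (u s) (a s)) (a s))"
    and F: "cont_path (sn (spXV S)) T (\<lambda>s. adstar S (u s) (m s))"
    and G: "cont_path (sn (spA S)) T (\<lambda>s. lieA S (u s) (a s))"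
    and M': "\<And>k. controlled \<alpha> T Z (sn (spXV S)) (\<lambda>t. adstar S (\<xi> k) (m t)) (M' k)"
    and A': "\<And>k. controlled \<alpha> T Z (sn (spA S)) (\<lambda>t. lieA S (\<xi> k) (a t)) (A' k)"
    and EP: "euler_poincare S \<alpha> T Z ZZ L u (u, \<lambda>k t. \<xi> k) m a M' A'"
  shows "rough_equation (prod_sn (sn (spXV S)) (sn (spA S))) \<alpha> T Z ZZ (\<lambda>s. (m s, a s))
    (\<lambda>s. (- adstar S (u s) (m s) + diamond S (dL_da S L (u s) (a s)) (a s), - lieA S (u s) (a s)))
    (\<lambda>k s. (- adstar S (\<xi> k) (m s), - lieA S (\<xi> k) (a s))) (\<lambda>k l s. (- M' k l s, - A' k l s))"
    (is "rough_equation ?p _ _ _ _ _ ?b ?V ?V'")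
proof
  note sn = setting_seminorm[OF S]
  show "seminorm (prod_sn (sn (spXV S)) (sn (spA S)) n)" for n
    by (intro seminorm_prod_sn sn)
  show "holder ?p T \<alpha> (\<lambda>s. (m s, a s))"
    using holder2_prod[of "sn (spXV S)" "sn (spA S)", OF sn] m a by (simp add: holder_def)
  show "cont_path ?p T ?b"
  proof -
    have "continuous_map (top_of_set {0..T}) (ftop (sn (spXV S)))
        (\<lambda>s. diamond S (dL_da S L (u s) (a s)) (a s) + (- 1) *\<^sub>R adstar S (u s) (m s))"
      "continuous_map (top_of_set {0..T}) (ftop (sn (spA S))) (\<lambda>s. 0 + (- 1) *\<^sub>R lieA S (u s) (a s))"
      using D F G unfolding cont_path_def
      by (intro continuous_map_ftop_add_scale continuous_map_ftop_const sn; simp)+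
    then show ?thesis
      unfolding cont_path_def by (intro continuous_map_ftop_prod sn) simp_all
  qed
  show "controlled \<alpha> T Z ?p
      (\<lambda>s. (- adstar S (\<xi> k) (m s), - lieA S (\<xi> k) (a s))) (\<lambda>l s. (- M' k l s, - A' k l s))" for k
    by (intro controlled_prod controlled_minus sn M' A')
  fix t assume t: "t \<in> {0..T}"
  obtain I1 I2 J where I: "has_dt_integral (sn (spXV S)) (\<lambda>s. adstar S (u s) (m s)) 0 t I1"
    "has_rough_integral \<alpha> Z ZZ (sn (spXV S)) (\<lambda>k s. adstar S (\<xi> k) (m s)) M' 0 t I2"
    "has_dt_integral (sn (spXV S)) (\<lambda>s. diamond S (dL_da S L (u s) (a s)) (a s)) 0 t J"
    "m t + (I1 + I2) = m 0 + J"
    using EP t unfolding euler_poincare_def has_rdiff_integral_def by fastforce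
  obtain K1 K2 where K: "has_dt_integral (sn (spA S)) (\<lambda>s. lieA S (u s) (a s)) 0 t K1"
    "has_rough_integral \<alpha> Z ZZ (sn (spA S)) (\<lambda>k s. lieA S (\<xi> k) (a s)) A' 0 t K2"
    "a t + (K1 + K2) = a 0"
    using EP t unfolding euler_poincare_def has_rdiff_integral_def by fastforce
  have "has_rdiff_integral \<alpha> Z ZZ ?p (?b, ?V) ?V' t
      ((- I1 + J, - K1) + (- I2, - K2))"
    unfolding has_rdiff_integral_def fst_conv snd_conv
    using has_dt_integral_prod[of "sn (spXV S)" "sn (spA S)", OF sn
        has_dt_integral_add[of "sn (spXV S)", OF sn(1) has_dt_integral_minus[of "sn (spXV S)", OF sn(1) I(1)] I(3)]
        has_dt_integral_minus[of "sn (spA S)", OF sn(2) K(1)]]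
      has_rough_integral_prod[of "sn (spXV S)" "sn (spA S)", OF sn
        has_rough_integral_minus[of "sn (spXV S)", OF sn(1) I(2)]
        has_rough_integral_minus[of "sn (spA S)", OF sn(2) K(2)]]
    by blast
  moreover have "(m t, a t) = (m 0, a 0) + ((- I1 + J, - K1) + (- I2, - K2))"
    using I(4) K(3) by (simp add: algebra_simps eq_diff_eq)
  ultimately show "\<exists>I. has_rdiff_integral \<alpha> Z ZZ ?p (?b, ?V) ?V' t I \<and>
      (m t, a t) = (m 0, a 0) + I"
    by blast
qed (use T \<alpha> Z in auto)

section \<open>The Lie--Poisson form of the Euler--Poincare equations\<close>

theorem corollary3p19:
  fixes S :: "('m::t2_space, 'd::finite, 'x::real_vector, 'xv::real_vector, 'a::real_vector, 'av::real_vector) setting"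
    and \<alpha> T :: real
    and Z :: "real \<Rightarrow> real ^ 'k::finite" and ZZ :: "real \<Rightarrow> real \<Rightarrow> real ^ 'k ^ 'k"
    and \<xi> :: "'k \<Rightarrow> 'x" and L :: "'x \<times> 'a \<Rightarrow> real"
    and m :: "real \<Rightarrow> 'xv" and m' :: "'k \<Rightarrow> real \<Rightarrow> 'xv"
    and a :: "real \<Rightarrow> 'a" and a' :: "'k \<Rightarrow> real \<Rightarrow> 'a"
    and u :: "real \<Rightarrow> 'x" and dx :: "('x, 'k) rdiff" and h :: "real \<Rightarrow> real"
    and M' :: "'k \<Rightarrow> 'k \<Rightarrow> real \<Rightarrow> 'xv" and A' :: "'k \<Rightarrow> 'k \<Rightarrow> real \<Rightarrow> 'a"
  assumes setting: "geometric_setting S"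
    and T: "T > 0" and alpha: "1/3 < \<alpha>" "\<alpha> \<le> 1"
    and Z: "geometric_rough_path \<alpha> T Z ZZ"
    and L_deriv: "\<And>v b. \<exists>\<mu> \<phi>. has_lag_deriv S L v b \<mu> \<phi>"
    and L_inv: "\<And>b. bij (\<lambda>v. dL_du S L v b)"
    and legendre: "legendre_regular S L"
    and m: "controlled \<alpha> T Z (sn (spXV S)) m m'"
    and a: "controlled \<alpha> T Z (sn (spA S)) a a'"
    and u: "\<And>t. t \<in> {0..T} \<Longrightarrow> m t = dL_du S L (u t) (a t)"
    and dx: "dx = (u, \<lambda>k t. \<xi> k)"
    and h: "\<And>t. t \<in> {0..T} \<Longrightarrow> has_rdiff_integral \<alpha> Z ZZ real_sn
              (\<lambda>s. pairX S (m s) (u s) - L (u s, a s), \<lambda>k s. pairX S (m s) (\<xi> k))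
              (\<lambda>k l s. pairX S (m' l s) (\<xi> k)) t (h t)"
    \<comment> \<open>existence of the integrands in the stated spaces\<close>
    and in_XV: "\<And>t k. t \<in> {0..T} \<Longrightarrow>
          in_space (spXV S) (adstarD S (u t) (m t)) \<and> in_space (spXV S) (adstarD S (\<xi> k) (m t))"
    and in_A: "\<And>t k. t \<in> {0..T} \<Longrightarrow>
          in_space (spA S) (lieAD S (u t) (a t)) \<and> in_space (spA S) (lieAD S (\<xi> k) (a t))"
    and cont_dt: "cont_path (sn (spX S)) T u"
          "cont_path (sn (spAV S)) T (\<lambda>t. dL_da S L (u t) (a t))"
          "cont_path (sn (spXV S)) T (\<lambda>t. adstar S (u t) (m t))"
          "cont_path (sn (spA S)) T (\<lambda>t. lieA S (u t) (a t))"
    and ctrl_M: "\<And>k. controlled \<alpha> T Z (sn (spXV S)) (\<lambda>t. adstar S (\<xi> k) (m t)) (M' k)"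
    and ctrl_A: "\<And>k. controlled \<alpha> T Z (sn (spA S)) (\<lambda>t. lieA S (\<xi> k) (a t)) (A' k)"
  shows
    \<comment> \<open>the second expression for the rough Hamiltonian\<close>
    "(\<forall>t\<in>{0..T}. has_rdiff_integral \<alpha> Z ZZ real_sn
        (\<lambda>s. Ham S L (m s, a s), \<lambda>k s. Gham S \<xi> k (m s, a s)) (\<lambda>k l s. pairX S (m' l s) (\<xi> k)) t (h t)) \<and>
     \<comment> \<open>the differentials of its functional derivatives\<close>
     (\<forall>t\<in>{0..T}.
        fst (d_dh_dm S (Ham S L) (Gham S \<xi>) m a) t = fst dx t \<and>
        (\<forall>k. snd (d_dh_dm S (Ham S L) (Gham S \<xi>) m a) k t = snd dx k t) \<and>
        fst (d_dh_da S (Ham S L) (Gham S \<xi>) m a) t = - dL_da S L (u t) (a t) \<and>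
        (\<forall>k. snd (d_dh_da S (Ham S L) (Gham S \<xi>) m a) k t = 0)) \<and>
     (euler_poincare S \<alpha> T Z ZZ L u dx m a M' A' \<longleftrightarrow>
      lie_poisson S \<alpha> T Z ZZ (d_dh_dm S (Ham S L) (Gham S \<xi>) m a) (d_dh_da S (Ham S L) (Gham S \<xi>) m a) m a M' A') \<and>
     \<comment> \<open>evolution of observables\<close>
     (euler_poincare S \<alpha> T Z ZZ L u dx m a M' A' \<longrightarrow>
      (\<forall>f :: 'xv \<times> 'a \<Rightarrow> real.
         Cb (prod_sn (sn (spXV S)) (sn (spA S))) (N_reg \<alpha> + 1) f \<and>
         (\<forall>t\<in>{0..T}. \<exists>x \<phi>. has_ham_deriv S f (m t) (a t) x \<phi>) \<and>
         cont_path (sn (spX S)) T (\<lambda>t. df_dm S f (m t) (a t)) \<and>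
         (\<exists>\<phi>'. controlled \<alpha> T Z (sn (spAV S)) (\<lambda>t. df_da S f (m t) (a t)) \<phi>') \<longrightarrow>
         (let Y' = chain_gub f (\<lambda>s. (m s, a s))
                     (\<lambda>k s. (- adstar S (\<xi> k) (m s), - lieA S (\<xi> k) (a s)))
                     (\<lambda>k l s. (- M' k l s, - A' k l s))
          in
           (\<alpha> < 1 \<longrightarrow> (\<forall>k. controlled \<alpha> T Z real_sn (\<lambda>s. LP_bracket S f (Gham S \<xi> k) (m s, a s)) (Y' k))) \<and>
           (\<forall>t\<in>{0..T}. \<exists>I. has_rdiff_integral \<alpha> Z ZZ real_sn
               (\<lambda>s. LP_bracket S f (Ham S L) (m s, a s), \<lambda>k s. LP_bracket S f (Gham S \<xi> k) (m s, a s)) Y' t I \<and>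
               f (m t, a t) = f (m 0, a 0) + I))))"
proof -
  let ?dhm = "d_dh_dm S (Ham S L) (Gham S \<xi>) m a" and ?dha = "d_dh_da S (Ham S L) (Gham S \<xi>) m a"
  have velocity: "velocity S L (m t) (a t) = u t" if "t \<in> {0..T}" for t
    using inv_f_f[OF bij_is_inj[OF L_inv[of "a t"]], of "u t"] by (simp add: velocity_def u[OF that])
  have dHam: "has_ham_deriv S (Ham S L) (m t) (a t) (u t) (- dL_da S L (u t) (a t))" if "t \<in> {0..T}" for t
    using legendre unfolding legendre_regular_def by (metis velocity[OF that])
  note dGham = has_ham_deriv_Gham[OF setting]
  have h2: "\<forall>t\<in>{0..T}. has_rdiff_integral \<alpha> Z ZZ real_sn
        (\<lambda>s. Ham S L (m s, a s), \<lambda>k s. Gham S \<xi> k (m s, a s)) (\<lambda>k l s. pairX S (m' l s) (\<xi> k)) t (h t)"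
  proof
    fix t assume t: "t \<in> {0..T}"
    then show "has_rdiff_integral \<alpha> Z ZZ real_sn
        (\<lambda>s. Ham S L (m s, a s), \<lambda>k s. Gham S \<xi> k (m s, a s)) (\<lambda>k l s. pairX S (m' l s) (\<xi> k)) t (h t)"
      using h[OF t] velocity
      by (subst has_rdiff_integral_cong[OF seminorm_real_sn]) (auto simp: Ham_def Gham_def)
  qed
  have dh: "\<forall>t\<in>{0..T}. fst ?dhm t = fst dx t \<and> (\<forall>k. snd ?dhm k t = snd dx k t) \<and>
      fst ?dha t = - dL_da S L (u t) (a t) \<and> (\<forall>k. snd ?dha k t = 0)"
    by (simp add: d_dh_dm_def d_dh_da_def dx
        functional_derivatives_eq[OF setting dHam] functional_derivatives_eq[OF setting dGham])
  have "cont_path (sn (spA S)) T a"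
    using a alpha holder_cont_path[of "sn (spA S)", OF setting_seminorm(2)[OF setting], of \<alpha>] by (simp add: controlled_def)
  from cont_path_diamond[OF setting cont_dt(2) this]
  have D: "cont_path (sn (spXV S)) T (\<lambda>s. diamond S (dL_da S L (u s) (a s)) (a s))" .
  have EPLP: "euler_poincare S \<alpha> T Z ZZ L u dx m a M' A' \<longleftrightarrow> lie_poisson S \<alpha> T Z ZZ ?dhm ?dha m a M' A'"
    unfolding dx using dh by (intro euler_poincare_iff_lie_poisson[OF setting T D]) (auto simp: dx)
  have chain: "let Y' = chain_gub f (\<lambda>s. (m s, a s))
                     (\<lambda>k s. (- adstar S (\<xi> k) (m s), - lieA S (\<xi> k) (a s)))
                     (\<lambda>k l s. (- M' k l s, - A' k l s))
          in
           (\<alpha> < 1 \<longrightarrow> (\<forall>k. controlled \<alpha> T Z real_sn (\<lambda>s. LP_bracket S f (Gham S \<xi> k) (m s, a s)) (Y' k))) \<and>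
           (\<forall>t\<in>{0..T}. \<exists>I. has_rdiff_integral \<alpha> Z ZZ real_sn
               (\<lambda>s. LP_bracket S f (Ham S L) (m s, a s), \<lambda>k s. LP_bracket S f (Gham S \<xi> k) (m s, a s)) Y' t I \<and>
               f (m t, a t) = f (m 0, a 0) + I)"
    if EP: "euler_poincare S \<alpha> T Z ZZ L u dx m a M' A'"
      and f: "Cb (prod_sn (sn (spXV S)) (sn (spA S))) (N_reg \<alpha> + 1) f"
      and df: "\<forall>t\<in>{0..T}. \<exists>x \<phi>. has_ham_deriv S f (m t) (a t) x \<phi>" for f
  proof -
    let ?b = "\<lambda>s. (- adstar S (u s) (m s) + diamond S (dL_da S L (u s) (a s)) (a s), - lieA S (u s) (a s))"
    let ?V = "\<lambda>k s. (- adstar S (\<xi> k) (m s), - lieA S (\<xi> k) (a s))"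
    let ?Y' = "chain_gub f (\<lambda>s. (m s, a s)) ?V (\<lambda>k l s. (- M' k l s, - A' k l s))"
    let ?br = "(\<lambda>s. LP_bracket S f (Ham S L) (m s, a s), \<lambda>k s. LP_bracket S f (Gham S \<xi> k) (m s, a s))"
    interpret rough_observable "prod_sn (sn (spXV S)) (sn (spA S))" \<alpha> T Z ZZ "\<lambda>s. (m s, a s)"
      ?b ?V "\<lambda>k l s. (- M' k l s, - A' k l s)" f
      using m a f EP unfolding controlled_def dx
      by (intro rough_observable.intro rough_observable_axioms.intro
          euler_poincare_rough_equation[OF setting T alpha Z _ _ D cont_dt(3,4) ctrl_M ctrl_A]) auto
    have brH: "LP_bracket S f (Ham S L) (m s, a s) = Ddir f [?b s] (m s, a s)" if "s \<in> {0..T}" for s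
      using LP_bracket_eq_Ddir[OF setting df[rule_format, OF that] dHam[OF that]]
      by (simp add: bilinear_lneg setting_bilinear[OF setting] del: Ddir.simps)
    have brG: "LP_bracket S f (Gham S \<xi> k) (m s, a s) = Ddir f [?V k s] (m s, a s)" if "s \<in> {0..T}" for s k
      using LP_bracket_eq_Ddir[OF setting df[rule_format, OF that] dGham]
      by (simp add: bilinear_lzero setting_bilinear[OF setting] del: Ddir.simps)
    show ?thesis
      unfolding Let_def
    proof (intro conjI impI allI ballI)
      fix k assume "\<alpha> < 1"
      from observable_integrand_controlled[OF this, of k]
      show "controlled \<alpha> T Z real_sn (\<lambda>s. LP_bracket S f (Gham S \<xi> k) (m s, a s))
          (?Y' k)"
        by (rule controlled_cong) (simp add: brG del: Ddir.simps)
    next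
      fix t assume t: "t \<in> {0..T}"
      have "has_rdiff_integral \<alpha> Z ZZ real_sn ?br
          ?Y' t I
        \<longleftrightarrow> has_rdiff_integral \<alpha> Z ZZ real_sn (\<lambda>s. Ddir f [?b s] (m s, a s), \<lambda>k s. Ddir f [?V k s] (m s, a s))
          ?Y' t I" for I
        using t by (intro has_rdiff_integral_cong seminorm_real_sn) (auto simp: brH brG simp del: Ddir.simps)
      then show "\<exists>I. has_rdiff_integral \<alpha> Z ZZ real_sn ?br
          ?Y' t I \<and>
          f (m t, a t) = f (m 0, a 0) + I"
        using rough_chain_rule[OF t] by blast
    qed
  qed
  show ?thesis
    using h2 dh EPLP chain by blast
qed

end
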